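(* Let $n\ge1$ and $0<\alpha<1$. Write $\tilde B=B(0,1)\times[-1,1]\subset\mathbb R^{n+1}$ and $\tilde B_r=B(0,r)\times[-r,r]$ for $r>0$. Let $p'=\frac{p}{p-1}$, with $p'=\infty$ if $p=1$. (a) Let $\{a_j\}_{j\in\mathbb Z}$ be a $\rho$-lacunary sequence and let $\{v_j\}_{j\in\mathbb Z}\in\ell^p(\mathbb Z)$ for some $1\le p\le\infty$. For every $f\in L^\infty(\mathbb R^{n+1})$ with support in the cylinder $\tilde B$ and for any cylinder $\tilde B_r\subset\tilde B$ with $2r<1$, $$\frac1{|\tilde B_r|}\int_{\tilde B_r}|T^*f(x,t)|\,dx\,dt\le C\Big(\log\frac2r\Big)^{1/p'}\|v\|_{\ell^p(\mathbb Z)}\|f\|_{L^\infty(\mathbb R^{n+1})},$$ with a constant $C$ independent of $f$ and $r$. (b) When $1<p<\infty$, for any $\varepsilon>0$ there exist a $\rho$-lacunary sequence $\{a_j\}_{j\in\mathbb Z}$, a sequence $\{v_j\}_{j\in\mathbb Z}\in\ell^p(\mathbb Z)$ and a function $f\in L^\infty(\mathbb R^{n+1})$ with support in $\tilde B$ satisfying the following: for any cylinder $\tilde B_r\subset\tilde B$ with $2r<1$, $$\frac1{|\tilde B_r|}\int_{\tilde B_r}|T^*f(x,t)|\,dx\,dt\ge C\Big(\log\frac2r\Big)^{1/(p-\varepsilon)'}\|v\|_{\ell^p(\mathbb Z)}\|f\|_{L^\infty(\mathbb R^{n+1})},$$ with a constant $C>0$ independent of $r$. (c) When $p=\infty$,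 there exist a $\rho$-lacunary sequence $\{a_j\}_{j\in\mathbb Z}$, a sequence $\{v_j\}_{j\in\mathbb Z}\in\ell^\infty(\mathbb Z)$ and a function $f\in L^\infty(\mathbb R^{n+1})$ with support in $\tilde B$ satisfying the following: for any cylinder $\tilde B_r\subset\tilde B$ with $2r<1$, $$\frac1{|\tilde B_r|}\int_{\tilde B_r}|T^*f(x,t)|\,dx\,dt\ge C\Big(\log\frac2r\Big)\|v\|_{\ell^\infty(\mathbb Z)}\|f\|_{L^\infty(\mathbb R^{n+1})},$$ with a constant $C>0$ independent of $r$.
   Context: For $0<\alpha<1$ and $\tau>0$, the fractional Poisson operator generated by the parabolic operator $L=\partial_t-\Delta$ on $\mathbb R^{n+1}=\mathbb R^n\times\mathbb R$ is $$\mathcal P_\tau^\alpha f(x,t)=\frac{\tau^{2\alpha}}{4^\alpha\Gamma(\alpha)}\int_0^\infty\int_{\mathbb R^n}\frac{e^{-(\tau^2+|y|^2)/(4s)}}{(4\pi s)^{n/2}}f(x-y,t-s)\,dy\,\frac{ds}{s^{1+\alpha}}.$$ An increasing sequence $\{a_j\}_{j\in\mathbb Z}$ of positive real numbers is $\rho$-lacunary, where $\rho>1$, if $a_{j+1}/a_j\ge\rho$ for all $j\in\mathbb Z$. For a bounded real sequence $\{v_j\}_{j\in\mathbb Z}$ and $N=(N_1,N_2)\in\mathbb Z^2$ with $N_1<N_2$, $$T_N^\alpha f(x,t)=\sum_{j=N_1}^{N_2}v_j\big(\mathcal P_{a_{j+1}}^\alpha f(x,t)-\mathcal P_{a_j}^\alpha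 f(x,t)\big),$$ and $T^*f(x,t)=\sup_N|T_N^\alpha f(x,t)|$, the supremum being over all $N=(N_1,N_2)\in\mathbb Z^2$ with $N_1<N_2$. $B(0,r)$ is the Euclidean ball in $\mathbb R^n$ centred at $0$ with radius $r$. For $p=\infty$, $p'$ is understood as $1$.
   Formalization: In (b), ε is restricted to 0<ε<p: for ε=p the exponent 1/(p-ε)' is undefined, and for ε>p it exceeds 1, which contradicts (a) unless v or f is zero; in (b) and (c), v and f are required to be nonzero. *)

theory Defs
  imports "HOL-Analysis.Analysis" "HOL-Probability.Essential_Supremum"
begin

text \<open>
  Points of $\mathbb R^{n+1} = \mathbb R^n \times \mathbb R$ are pairs \<open>(x, t) :: (real ^ 'n) \<times> real\<close>,
  with \<open>n = CARD('n)\<close>.  Functions are total Lebesgue measurable representatives, and all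
  integrals are taken with respect to Lebesgue measure.
\<close>

definition frac_poisson ::
  "real \<Rightarrow> real \<Rightarrow> ((real ^ 'n) \<times> real \<Rightarrow> real) \<Rightarrow> (real ^ 'n) \<times> real \<Rightarrow> real" where
  "frac_poisson \<alpha> \<tau> f = (\<lambda>(x, t).
     \<tau> powr (2 * \<alpha>) / (4 powr \<alpha> * Gamma \<alpha>) *
     (LINT s:{0<..}|lebesgue.
        (LINT y|lebesgue.
           exp (- (\<tau>\<^sup>2 + (norm y)\<^sup>2) / (4 * s)) / (4 * pi * s) powr (real CARD('n) / 2)
           * f (x - y, t - s))
        / s powr (1 + \<alpha>)))"

definition lacunary :: "real \<Rightarrow> (int \<Rightarrow> real) \<Rightarrow> bool" where
  "lacunary \<rho> a \<longleftrightarrow> strict_mono a \<and> (\<forall>j. 0 < a j) \<and> (\<forall>j. a (j + 1) / a j \<ge> \<rho>)"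

definition diff_transform ::
  "real \<Rightarrow> (int \<Rightarrow> real) \<Rightarrow> (int \<Rightarrow> real) \<Rightarrow> int \<Rightarrow> int \<Rightarrow>
   ((real ^ 'n) \<times> real \<Rightarrow> real) \<Rightarrow> (real ^ 'n) \<times> real \<Rightarrow> real" where
  "diff_transform \<alpha> a v N\<^sub>1 N\<^sub>2 f z =
     (\<Sum>j = N\<^sub>1..N\<^sub>2. v j * (frac_poisson \<alpha> (a (j + 1)) f z - frac_poisson \<alpha> (a j) f z))"

text \<open>The supremum can be infinite at individual points, so it is taken in \<open>[0, \<infinity>]\<close>.\<close>

definition max_transform ::
  "real \<Rightarrow> (int \<Rightarrow> real) \<Rightarrow> (int \<Rightarrow> real) \<Rightarrow>
   ((real ^ 'n) \<times> real \<Rightarrow> real) \<Rightarrow> (real ^ 'n) \<times> real \<Rightarrow> ennreal" where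
  "max_transform \<alpha> a v f z =
     (SUP (N\<^sub>1, N\<^sub>2) \<in> {(N\<^sub>1, N\<^sub>2). N\<^sub>1 < N\<^sub>2}. ennreal \<bar>diff_transform \<alpha> a v N\<^sub>1 N\<^sub>2 f z\<bar>)"

definition cylinder :: "real \<Rightarrow> ((real ^ 'n) \<times> real) set" where
  "cylinder r = ball 0 r \<times> {- r..r}"

definition average :: "((real ^ 'n) \<times> real) set \<Rightarrow> ((real ^ 'n) \<times> real \<Rightarrow> ennreal) \<Rightarrow> ennreal" where
  "average A g = (\<integral>\<^sup>+ z \<in> A. g z \<partial>lebesgue) / emeasure lebesgue A"

definition Linfty :: "((real ^ 'n) \<times> real \<Rightarrow> real) set" where
  "Linfty = {f. f \<in> borel_measurable lebesgue \<and> esssup lebesgue (\<lambda>z. ereal \<bar>f z\<bar>) < \<infinity>}"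

definition Linfty_norm :: "((real ^ 'n) \<times> real \<Rightarrow> real) \<Rightarrow> real" where
  "Linfty_norm f = real_of_ereal (esssup lebesgue (\<lambda>z. ereal \<bar>f z\<bar>))"

text \<open>Support of an element of $L^\infty$: the function vanishes almost everywhere off \<open>A\<close>.\<close>

definition supported_in :: "((real ^ 'n) \<times> real \<Rightarrow> real) \<Rightarrow> ((real ^ 'n) \<times> real) set \<Rightarrow> bool" where
  "supported_in f A \<longleftrightarrow> (AE z in lebesgue. z \<notin> A \<longrightarrow> f z = 0)"

text \<open>The exponent \<open>p\<close> ranges over \<open>1 \<le> p \<le> \<infinity>\<close> in the next two definitions.\<close>

definition lp :: "ereal \<Rightarrow> (int \<Rightarrow> real) set" where
  "lp p = (if p = \<infinity> then {v. bounded (range v)}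
           else {v. (\<lambda>j. \<bar>v j\<bar> powr real_of_ereal p) summable_on UNIV})"

definition lp_norm :: "ereal \<Rightarrow> (int \<Rightarrow> real) \<Rightarrow> real" where
  "lp_norm p v = (if p = \<infinity> then (SUP j. \<bar>v j\<bar>)
                  else (\<Sum>\<^sub>\<infinity>j. \<bar>v j\<bar> powr real_of_ereal p) powr (1 / real_of_ereal p))"

definition conj_exp :: "ereal \<Rightarrow> ereal" where
  "conj_exp p = (if p = 1 then \<infinity> else if p = \<infinity> then 1 else p / (p - 1))"

end

theory Submission
  imports Defs
begin

text \<open>
  The operator \<open>\<P>\<^sub>\<tau>\<^sup>\<alpha>\<close> is convolution with a positive kernel \<open>k\<^sub>\<tau>\<close> which is a parabolic dilate of
  \<open>k\<^sub>1\<close>. For lacunary \<open>a\<close> the differences \<open>q\<^sub>j\<close> of consecutive kernels have mean zero, and their moment and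
  smoothness bounds make the \<open>L\<^sup>1\<close> norm of \<open>q\<^sub>i * q\<^sub>j\<close> decay geometrically in \<open>\<bar>i - j\<bar>\<close>. Splitting \<open>q\<^sub>j\<close>
  into its even and odd part, Cotlar--Stein bounds the sums \<open>\<Sum> v\<^sub>j q\<^sub>j * f\<close> on \<open>L\<^sup>2\<close>, uniformly for \<open>\<bar>v\<^sub>j\<bar> \<le> 1\<close>.
  A tail \<open>\<Sum> v\<^sub>j q\<^sub>j * f\<close> over \<open>j \<ge> N\<close> differs from the normalised kernel of height \<open>a\<^sub>N\<close> applied to the full sum by
  errors controlled by square functions, and the maximal operator of the kernels is bounded on \<open>L\<^sup>2\<close> by a
  measurable selection and an estimate of the product of the selected operator with its adjoint; hence
  \<open>T\<^sup>*\<close> is bounded on \<open>L\<^sup>2\<close>.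

  For the average over the cylinder of size \<open>r\<close>, the part of \<open>f\<close> in the doubled cylinder is handled by this
  \<open>L\<^sup>2\<close> bound. For the remaining part the scales with \<open>a\<^sub>j \<le> r\<close> and those with \<open>a\<^sub>j \<ge> 1\<close> contribute geometric series,
  while the number of the remaining scales is of order \<open>ln (2 / r)\<close>; Hoelder's inequality for their coefficients gives
  the power \<open>1 / p'\<close>.

  For the lower bounds take \<open>a\<^sub>j = B\<^sup>j\<close> with \<open>B\<close> large and a function of time that changes sign from one
  scale to the next. Near the origin all differences of consecutive extensions then have size of order one and
  alternating sign, and \<open>v\<^sub>j = -(-1)\<^sup>j \<bar>j\<bar>\<^sup>-\<^sup>\<beta>\<close> on \<open>j < 0\<close> makes them add up to a multiple of
  \<open>(ln (2 / r))\<^sup>1\<^sup>-\<^sup>\<beta>\<close>, where \<open>\<beta> = 0\<close> for bounded \<open>v\<close> and \<open>1 / p < \<beta>\<close>, \<open>\<beta> \<le> 1 / (p - \<epsilon>)\<close> for \<open>v\<close> in \<open>l\<^sup>p\<close>.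
\<close>

section \<open>Convolution of bounded integrable kernels\<close>

text \<open>Each kernel enters through two numbers only: a moment of order \<alpha> and a Hoelder
  constant of order \<alpha> for its translates in L1. This order is available on both sides: the
  kernel decays like the power -(n + 2 + 2 \<alpha>) of the parabolic distance, whose homogeneous
  dimension is n + 2, so moments exist below 2 \<alpha>; and since \<alpha> < 1, Lipschitz bounds
  may be weakened to it. The kernel vanishes at negative times. The maximal bound therefore works
  with an even majorant, and it replaces covering arguments by one algebraic fact: the convolution
  of two majorants is at most a constant times their sum. The cylinders have time width of order r
  and not r^2, so they are not adapted to the parabolic distance. This costs constants only. Leaving
  the doubled cylinder is still a parabolic step of length at least r, because r < 1; and in the
  lower bound only the scales with a_j^2 above a multiple of r see the oscillation, which is about
  half of those between r and 1, hence a fixed fraction of ln (2 / r).\<close>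

lemma distr_lborel_diff: "distr lborel borel (\<lambda>w. z - w) = (lborel :: 'a::euclidean_space measure)"
  by (subst (2) lborel_affine[of "-1" z]) (auto simp: density_1 algebra_simps)

lemma distr_lborel_minus: "distr lborel borel (\<lambda>w. w - z) = (lborel :: 'a::euclidean_space measure)"
proof -
  have "(\<lambda>w. w - z) = (+) (- z)" by auto
  then show ?thesis using lborel_distr_plus[of "- z"] by simp
qed

lemma nn_integral_lborel_diff:
  fixes f :: "'a::euclidean_space \<Rightarrow> ennreal"
  assumes [measurable]: "f \<in> borel_measurable borel"
  shows "(\<integral>\<^sup>+w. f (z - w) \<partial>lborel) = (\<integral>\<^sup>+w. f w \<partial>lborel)"
    and "(\<integral>\<^sup>+w. f (w - z) \<partial>lborel) = (\<integral>\<^sup>+w. f w \<partial>lborel)"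
    and "(\<integral>\<^sup>+w. f (- w) \<partial>lborel) = (\<integral>\<^sup>+w. f w \<partial>lborel)"
proof -
  show "(\<integral>\<^sup>+w. f (z - w) \<partial>lborel) = (\<integral>\<^sup>+w. f w \<partial>lborel)" for z
    by (subst (2) distr_lborel_diff[of z, symmetric], subst nn_integral_distr) auto
  from this[of 0] show "(\<integral>\<^sup>+w. f (- w) \<partial>lborel) = (\<integral>\<^sup>+w. f w \<partial>lborel)" by simp
  show "(\<integral>\<^sup>+w. f (w - z) \<partial>lborel) = (\<integral>\<^sup>+w. f w \<partial>lborel)"
    by (subst (2) distr_lborel_minus[of z, symmetric], subst nn_integral_distr) auto
qed

lemma integral_lborel_diff:
  fixes f :: "'a::euclidean_space \<Rightarrow> real"
  assumes [measurable]: "f \<in> borel_measurable borel"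
  shows "(LINT w|lborel. f (z - w)) = (LINT w|lborel. f w)"
    and "(LINT w|lborel. f (w - z)) = (LINT w|lborel. f w)"
    and "(LINT w|lborel. f (- w)) = (LINT w|lborel. f w)"
proof -
  show "(LINT w|lborel. f (z - w)) = (LINT w|lborel. f w)" for z
    by (subst (2) distr_lborel_diff[of z, symmetric], subst integral_distr) auto
  from this[of 0] show "(LINT w|lborel. f (- w)) = (LINT w|lborel. f w)" by simp
  show "(LINT w|lborel. f (w - z)) = (LINT w|lborel. f w)"
    by (subst (2) distr_lborel_minus[of z, symmetric], subst integral_distr) auto
qed

lemma integrable_lborel_diff:
  fixes f :: "'a::euclidean_space \<Rightarrow> real"
  assumes "integrable lborel f"
  shows "integrable lborel (\<lambda>w. f (z - w))" "integrable lborel (\<lambda>w. f (w - z))"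
    "integrable lborel (\<lambda>w. f (- w))"
proof -
  have [measurable]: "f \<in> borel_measurable borel" using assms by auto
  show "integrable lborel (\<lambda>w. f (z - w))" for z
    using assms by (subst (asm) distr_lborel_diff[of z, symmetric], subst (asm) integrable_distr_eq) auto
  from this[of 0] show "integrable lborel (\<lambda>w. f (- w))" by simp
  show "integrable lborel (\<lambda>w. f (w - z))"
    using assms by (subst (asm) distr_lborel_minus[of z, symmetric], subst (asm) integrable_distr_eq) auto
qed

section \<open>Convolution and the norms of L1 and L2 on bounded integrable functions\<close>

text \<open>Integrability together with boundedness gives square integrability and makes
  \<open>conv f g z\<close> an absolutely convergent integral at every \<open>z\<close>, so that
  identities between convolutions hold pointwise and not merely almost everywhere.\<close>

definition bddL1 :: "('a::euclidean_space \<Rightarrow> real) set" where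
  "bddL1 = {f. f \<in> borel_measurable borel \<and> integrable lborel f \<and> bounded (range f)}"

definition conv :: "('a::euclidean_space \<Rightarrow> real) \<Rightarrow> ('a \<Rightarrow> real) \<Rightarrow> 'a \<Rightarrow> real" where
  "conv f g = (\<lambda>z. LINT w|lborel. f w * g (z - w))"

definition norm1 :: "('a::euclidean_space \<Rightarrow> real) \<Rightarrow> real" where
  "norm1 f = (LINT w|lborel. \<bar>f w\<bar>)"

definition norm2 :: "('a::euclidean_space \<Rightarrow> real) \<Rightarrow> real" where
  "norm2 f = sqrt (LINT w|lborel. (f w)\<^sup>2)"

lemma bddL1_meas: "f \<in> bddL1 \<Longrightarrow> f \<in> borel_measurable borel"
  by (simp add: bddL1_def)

lemma bddL1_int: "f \<in> bddL1 \<Longrightarrow> integrable lborel f"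
  by (simp add: bddL1_def)

lemma bddL1_bdd: assumes "f \<in> bddL1" obtains B where "0 < B" "\<And>z. \<bar>f z\<bar> \<le> B"
  using assms unfolding bddL1_def bounded_pos by auto

lemma bddL1I:
  assumes "f \<in> borel_measurable borel" "integrable lborel f" "\<And>z. \<bar>f z\<bar> \<le> B"
  shows "f \<in> bddL1"
  using assms unfolding bddL1_def bounded_iff by auto

lemma bddL1_dom:
  assumes [measurable]: "f \<in> borel_measurable borel" and g: "g \<in> bddL1" and le: "\<And>z. \<bar>f z\<bar> \<le> g z"
  shows "f \<in> bddL1"
proof -
  obtain B where B: "\<And>z. \<bar>g z\<bar> \<le> B" using bddL1_bdd[OF g] by metis
  show ?thesis
  proof (rule bddL1I[where B=B])
    show "integrable lborel f"
      by (rule Bochner_Integration.integrable_bound[OF bddL1_int[OF g]])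
        (use le in \<open>auto intro!: AE_I2 order.trans[OF le]\<close>)
    show "\<bar>f z\<bar> \<le> B" for z using le[of z] B[of z] by linarith
  qed simp
qed

lemma bddL1_mult:
  assumes f: "f \<in> bddL1" and [measurable]: "g \<in> borel_measurable borel" and B: "\<And>z. \<bar>g z\<bar> \<le> B"
  shows "(\<lambda>z. f z * g z) \<in> bddL1"
proof -
  note [measurable] = bddL1_meas[OF f]
  obtain C where C: "\<And>z. \<bar>f z\<bar> \<le> C" "0 < C" using bddL1_bdd[OF f] by metis
  have "0 \<le> B" using B[of undefined] by linarith
  have int: "integrable lborel (\<lambda>z. B * \<bar>f z\<bar>)" using bddL1_int[OF f] by auto
  have "integrable lborel (\<lambda>z. f z * g z)"
    by (rule Bochner_Integration.integrable_bound[OF int])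
      (auto simp: abs_mult \<open>0 \<le> B\<close> intro!: AE_I2 mult_right_mono B simp: mult.commute[of "\<bar>f _\<bar>"])
  then show ?thesis
    by (rule bddL1I[where B="C * B", rotated]) 
      (use C B \<open>0 \<le> B\<close> in \<open>auto simp: abs_mult intro!: mult_mono\<close>)
qed

lemma bddL1_add: "f \<in> bddL1 \<Longrightarrow> g \<in> bddL1 \<Longrightarrow> (\<lambda>z. f z + g z) \<in> bddL1"
proof -
  assume f: "f \<in> bddL1" and g: "g \<in> bddL1"
  obtain A B where "\<And>z. \<bar>f z\<bar> \<le> A" "\<And>z. \<bar>g z\<bar> \<le> B" using bddL1_bdd f g by metis
  then have "\<bar>f z + g z\<bar> \<le> A + B" for z by (meson abs_triangle_ineq add_mono order.trans)
  then show ?thesis using f g bddL1_int[OF f] bddL1_int[OF g] by (intro bddL1I[where B="A + B"]) auto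
qed

lemma bddL1_cmult: "f \<in> bddL1 \<Longrightarrow> (\<lambda>z. c * f z) \<in> bddL1"
  using bddL1_mult[of f "\<lambda>_. c" "\<bar>c\<bar>"] by (simp add: mult.commute)

lemma bddL1_uminus: "f \<in> bddL1 \<Longrightarrow> (\<lambda>z. - f z) \<in> bddL1"
  using bddL1_cmult[of f "-1"] by simp

lemma bddL1_diff: "f \<in> bddL1 \<Longrightarrow> g \<in> bddL1 \<Longrightarrow> (\<lambda>z. f z - g z) \<in> bddL1"
  using bddL1_add[of f "\<lambda>z. - g z"] bddL1_uminus by auto

lemma bddL1_zero: "(\<lambda>z. 0) \<in> bddL1"
  by (rule bddL1I[where B=0]) auto

lemma bddL1_sum: "(\<And>i. i \<in> I \<Longrightarrow> f i \<in> bddL1) \<Longrightarrow> (\<lambda>z. \<Sum>i\<in>I. f i z) \<in> bddL1"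
  by (induction I rule: infinite_finite_induct) (auto intro!: bddL1_add bddL1_zero)

lemma bddL1_abs: "f \<in> bddL1 \<Longrightarrow> (\<lambda>z. \<bar>f z\<bar>) \<in> bddL1"
  unfolding bddL1_def bounded_iff by auto

lemma bddL1_reflect: "f \<in> bddL1 \<Longrightarrow> (\<lambda>z. f (- z)) \<in> bddL1"
  using integrable_lborel_diff(3)[of f] unfolding bddL1_def bounded_iff by auto

lemma bddL1_shift: "f \<in> bddL1 \<Longrightarrow> (\<lambda>z. f (z - w)) \<in> bddL1" "f \<in> bddL1 \<Longrightarrow> (\<lambda>z. f (w - z)) \<in> bddL1"
  using integrable_lborel_diff(1,2)[of f w] unfolding bddL1_def bounded_iff by auto

lemma bddL1_int_mult: "f \<in> bddL1 \<Longrightarrow> g \<in> bddL1 \<Longrightarrow> integrable lborel (\<lambda>z. f z * g z)"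
  using bddL1_mult[of f g] bddL1_bdd[of g] by (metis bddL1_int bddL1_meas)

lemma bddL1_int_sq: "f \<in> bddL1 \<Longrightarrow> integrable lborel (\<lambda>z. (f z)\<^sup>2)"
  using bddL1_int_mult[of f f] by (simp add: power2_eq_square)

lemma conv_int: "f \<in> bddL1 \<Longrightarrow> g \<in> bddL1 \<Longrightarrow> integrable lborel (\<lambda>w. f w * g (z - w))"
  by (intro bddL1_int_mult bddL1_shift)

lemma conv_integrable_pair:
  fixes f g :: "'a::euclidean_space \<Rightarrow> real"
  assumes "f \<in> bddL1" "g \<in> bddL1"
  shows "integrable (lborel \<Otimes>\<^sub>M lborel) (\<lambda>(z, w). f w * g (z - w))"
proof (rule integrableI_bounded)
  note [measurable] = assms[THEN bddL1_meas]
  show "(\<lambda>(z, w). f w * g (z - w)) \<in> borel_measurable (lborel \<Otimes>\<^sub>M lborel)" by measurable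
  have "(\<integral>\<^sup>+x. ennreal (norm (case x of (z, w) \<Rightarrow> f w * g (z - w))) \<partial>(lborel \<Otimes>\<^sub>M lborel)) =
    (\<integral>\<^sup>+w. (\<integral>\<^sup>+z. ennreal \<bar>f w\<bar> * ennreal \<bar>g (z - w)\<bar> \<partial>lborel) \<partial>lborel)"
    by (subst lborel_pair.nn_integral_snd[symmetric]) (auto simp: abs_mult ennreal_mult)
  also have "\<dots> = (\<integral>\<^sup>+w. ennreal \<bar>f w\<bar> * (\<integral>\<^sup>+z. ennreal \<bar>g z\<bar> \<partial>lborel) \<partial>lborel)"
    by (subst nn_integral_cmult, simp, subst nn_integral_lborel_diff(2)) auto
  also have "\<dots> = (\<integral>\<^sup>+w. ennreal \<bar>f w\<bar> \<partial>lborel) * (\<integral>\<^sup>+z. ennreal \<bar>g z\<bar> \<partial>lborel)"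
    by (subst nn_integral_multc) auto
  also have "\<dots> < \<infinity>"
    using assms[THEN bddL1_int] by (auto simp: integrable_iff_bounded ennreal_mult_less_top)
  finally show "(\<integral>\<^sup>+x. ennreal (norm (case x of (z, w) \<Rightarrow> f w * g (z - w))) \<partial>(lborel \<Otimes>\<^sub>M lborel)) < \<infinity>" .
qed

lemma conv_bddL1:
  assumes f: "f \<in> bddL1" and g: "g \<in> bddL1"
  shows "conv f g \<in> bddL1"
proof -
  note [measurable] = bddL1_meas[OF f] bddL1_meas[OF g]
  obtain B where B: "\<And>z. \<bar>g z\<bar> \<le> B" using bddL1_bdd[OF g] by metis
  have "\<bar>conv f g z\<bar> \<le> (LINT w|lborel. \<bar>f w\<bar> * B)" for z
    unfolding conv_def
    by (rule order.trans[OF integral_abs_bound], rule integral_mono)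
      (use conv_int[OF f g, of z] bddL1_int[OF f] B in \<open>auto simp: abs_mult intro!: mult_left_mono dest: integrable_abs\<close>)
  moreover have "integrable lborel (conv f g)"
    using lborel_pair.integrable_fst[of "\<lambda>z w. f w * g (z - w)"] conv_integrable_pair[OF f g]
    by (simp add: conv_def)
  moreover have "conv f g \<in> borel_measurable borel" unfolding conv_def by measurable
  ultimately show ?thesis by (intro bddL1I) auto
qed

lemma conv_commute:
  assumes "f \<in> bddL1" "g \<in> bddL1"
  shows "conv f g = conv g f"
proof
  fix z
  note [measurable] = assms[THEN bddL1_meas]
  show "conv f g z = conv g f z"
    unfolding conv_def
    using integral_lborel_diff(1)[of "\<lambda>w. g w * f (z - w)" z] by (simp add: mult.commute)
qed

lemma conv_add_left:
  assumes "f \<in> bddL1" "g \<in> bddL1" "h \<in> bddL1"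
  shows "conv (\<lambda>w. f w + g w) h z = conv f h z + conv g h z"
  unfolding conv_def by (simp add: distrib_right conv_int assms)

lemma conv_cmult_left: "conv (\<lambda>w. c * f w) h z = c * conv f h z"
  unfolding conv_def by (simp add: mult.assoc)

lemma conv_sum_left:
  assumes "\<And>i. i \<in> I \<Longrightarrow> f i \<in> bddL1" "h \<in> bddL1"
  shows "conv (\<lambda>w. \<Sum>i\<in>I. f i w) h z = (\<Sum>i\<in>I. conv (f i) h z)"
  unfolding conv_def by (simp add: sum_distrib_right conv_int assms)

lemma conv_diff_left:
  assumes "f \<in> bddL1" "g \<in> bddL1" "h \<in> bddL1"
  shows "conv (\<lambda>w. f w - g w) h z = conv f h z - conv g h z"
  unfolding conv_def by (simp add: left_diff_distrib conv_int assms)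

lemma conv_add_right:
  assumes "f \<in> bddL1" "g \<in> bddL1" "h \<in> bddL1"
  shows "conv h (\<lambda>w. f w + g w) z = conv h f z + conv h g z"
  unfolding conv_def by (simp add: distrib_left conv_int assms)

text \<open>Fubini for the triple product; boundedness of \<open>h\<close> reduces its joint
  integrability to that of the pair \<open>f\<close>, \<open>g\<close>.\<close>

lemma conv_assoc:
  assumes f: "f \<in> bddL1" and g: "g \<in> bddL1" and h: "h \<in> bddL1"
  shows "conv f (conv g h) = conv (conv f g) h"
proof
  fix z
  note [measurable] = bddL1_meas[OF f] bddL1_meas[OF g] bddL1_meas[OF h]
  obtain B where B: "\<And>z. \<bar>h z\<bar> \<le> B" "0 < B" using bddL1_bdd[OF h] by metis
  have i1: "integrable (lborel \<Otimes>\<^sub>M lborel) (\<lambda>(u, w). f w * g (u - w))"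
    by (rule conv_integrable_pair[OF f g])
  have i2: "integrable (lborel \<Otimes>\<^sub>M lborel) (\<lambda>(u, w). f w * g (u - w) * h (z - u))"
    by (rule Bochner_Integration.integrable_bound[of _ "\<lambda>x. B * (case x of (u, w) \<Rightarrow> f w * g (u - w))"])
      (use i1 B in \<open>auto simp: abs_mult mult.commute[of "\<bar>h _\<bar>"] intro!: AE_I2 mult_left_mono simp: mult.commute[of B]\<close>)
  have "conv (conv f g) h z = (LINT u|lborel. LINT w|lborel. f w * g (u - w) * h (z - u))"
    unfolding conv_def by (simp flip: integral_mult_left_zero)
  also have "\<dots> = (LINT w|lborel. LINT u|lborel. f w * g (u - w) * h (z - u))"
    using lborel_pair.Fubini_integral[OF i2] by simp
  also have "\<dots> = (LINT w|lborel. f w * conv g h (z - w))"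
  proof (rule Bochner_Integration.integral_cong[OF refl])
    fix w
    have "(LINT u|lborel. f w * g (u - w) * h (z - u)) = f w * (LINT u|lborel. g (u - w) * h (z - w - (u - w)))"
      by (simp add: mult.assoc)
    also have "\<dots> = f w * conv g h (z - w)"
      unfolding conv_def by (subst integral_lborel_diff(2)[of "\<lambda>u. g u * h (z - w - u)"]) auto
    finally show "(LINT u|lborel. f w * g (u - w) * h (z - u)) = f w * conv g h (z - w)" .
  qed
  finally show "conv f (conv g h) z = conv (conv f g) h z" by (simp add: conv_def[of f "conv g h"])
qed

lemma norm1_nonneg: "0 \<le> norm1 f"
  unfolding norm1_def by simp

lemma norm1_nn: "f \<in> bddL1 \<Longrightarrow> (\<integral>\<^sup>+w. ennreal \<bar>f w\<bar> \<partial>lborel) = ennreal (norm1 f)"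
  unfolding norm1_def by (rule nn_integral_eq_integral) (auto dest: bddL1_int)

lemma norm1_le: "f \<in> bddL1 \<Longrightarrow> 0 \<le> C \<Longrightarrow> (\<integral>\<^sup>+w. ennreal \<bar>f w\<bar> \<partial>lborel) \<le> ennreal C \<Longrightarrow> norm1 f \<le> C"
  by (simp add: norm1_nn)

lemma norm1_add:
  assumes f: "f \<in> bddL1" and g: "g \<in> bddL1"
  shows "norm1 (\<lambda>z. f z + g z) \<le> norm1 f + norm1 g"
proof -
  note i = bddL1_int[OF bddL1_abs[OF f]] bddL1_int[OF bddL1_abs[OF g]] bddL1_int[OF bddL1_abs[OF bddL1_add[OF f g]]]
  have "norm1 (\<lambda>z. f z + g z) \<le> (LINT z|lborel. \<bar>f z\<bar> + \<bar>g z\<bar>)"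
    unfolding norm1_def by (intro integral_mono i Bochner_Integration.integrable_add) auto
  then show ?thesis using i unfolding norm1_def by simp
qed

lemma norm1_cmult: "norm1 (\<lambda>z. c * f z) = \<bar>c\<bar> * norm1 f"
  unfolding norm1_def by (simp add: abs_mult)

lemma norm1_diff: "f \<in> bddL1 \<Longrightarrow> g \<in> bddL1 \<Longrightarrow> norm1 (\<lambda>z. f z - g z) \<le> norm1 f + norm1 g"
  using norm1_add[of f "\<lambda>z. - g z"] norm1_cmult[of "-1" g] bddL1_uminus[of g] by simp

lemma norm1_reflect: "f \<in> bddL1 \<Longrightarrow> norm1 (\<lambda>z. f (- z)) = norm1 f"
  unfolding norm1_def using integral_lborel_diff(3)[of "\<lambda>z. \<bar>f z\<bar>"] bddL1_meas[of f] by simp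

lemma norm1_conv:
  assumes f: "f \<in> bddL1" and g: "g \<in> bddL1"
  shows "norm1 (conv f g) \<le> norm1 f * norm1 g"
proof (rule norm1_le[OF conv_bddL1[OF f g]])
  note [measurable] = bddL1_meas[OF f] bddL1_meas[OF g]
  have "(\<integral>\<^sup>+z. ennreal \<bar>conv f g z\<bar> \<partial>lborel) \<le> (\<integral>\<^sup>+z. (\<integral>\<^sup>+w. ennreal \<bar>f w\<bar> * ennreal \<bar>g (z - w)\<bar> \<partial>lborel) \<partial>lborel)"
  proof (rule nn_integral_mono)
    fix z
    have "ennreal (norm (conv f g z)) \<le> (\<integral>\<^sup>+w. norm (f w * g (z - w)) \<partial>lborel)"
      unfolding conv_def by (rule integral_norm_bound_ennreal[OF conv_int[OF f g]])
    then show "ennreal \<bar>conv f g z\<bar> \<le> (\<integral>\<^sup>+w. ennreal \<bar>f w\<bar> * ennreal \<bar>g (z - w)\<bar> \<partial>lborel)"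
      by (simp add: abs_mult ennreal_mult)
  qed
  also have "\<dots> = (\<integral>\<^sup>+w. (\<integral>\<^sup>+z. ennreal \<bar>f w\<bar> * ennreal \<bar>g (z - w)\<bar> \<partial>lborel) \<partial>lborel)"
    by (rule lborel_pair.Fubini') measurable
  also have "\<dots> = (\<integral>\<^sup>+w. ennreal \<bar>f w\<bar> * ennreal (norm1 g) \<partial>lborel)"
    by (subst nn_integral_cmult, simp, subst nn_integral_lborel_diff(2)[of "\<lambda>z. ennreal \<bar>g z\<bar>"]) (auto simp: norm1_nn g)
  also have "\<dots> = ennreal (norm1 f * norm1 g)"
    by (subst nn_integral_multc) (auto simp: norm1_nn f ennreal_mult norm1_nonneg)
  finally show "(\<integral>\<^sup>+z. ennreal \<bar>conv f g z\<bar> \<partial>lborel) \<le> ennreal (norm1 f * norm1 g)" .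
qed (simp add: norm1_nonneg)

lemma norm2_nonneg: "0 \<le> norm2 f"
  unfolding norm2_def by simp

lemma norm2_sq: "(norm2 f)\<^sup>2 = (LINT w|lborel. (f w)\<^sup>2)"
  unfolding norm2_def by simp

lemma norm2_nn: "f \<in> bddL1 \<Longrightarrow> (\<integral>\<^sup>+w. ennreal ((f w)\<^sup>2) \<partial>lborel) = ennreal ((norm2 f)\<^sup>2)"
  unfolding norm2_sq by (rule nn_integral_eq_integral) (auto intro: bddL1_int_sq)

lemma norm2_mono:
  assumes "f \<in> bddL1" "g \<in> bddL1" "\<And>z. \<bar>f z\<bar> \<le> \<bar>g z\<bar>"
  shows "norm2 f \<le> norm2 g"
  unfolding norm2_def
  by (intro real_sqrt_le_mono integral_mono bddL1_int_sq) (use assms in \<open>auto simp: abs_le_square_iff\<close>)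

lemma norm2_cmult: "norm2 (\<lambda>z. c * f z) = \<bar>c\<bar> * norm2 f"
  unfolding norm2_def by (simp add: power_mult_distrib real_sqrt_mult)

lemma Cauchy_Schwarz_norm2:
  assumes f: "f \<in> bddL1" and g: "g \<in> bddL1"
  shows "(LINT z|lborel. \<bar>f z * g z\<bar>) \<le> norm2 f * norm2 g"
proof -
  note [measurable] = bddL1_meas[OF f] bddL1_meas[OF g]
  have "ennreal ((LINT z|lborel. \<bar>f z * g z\<bar>)\<^sup>2) = (\<integral>\<^sup>+z. ennreal \<bar>f z\<bar> * ennreal \<bar>g z\<bar> \<partial>lborel)\<^sup>2"
    by (subst ennreal_power[symmetric], simp, subst nn_integral_eq_integral[symmetric])
      (auto intro!: bddL1_int_mult f g bddL1_abs simp: abs_mult ennreal_mult)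
  also have "\<dots> \<le> (\<integral>\<^sup>+z. (ennreal \<bar>f z\<bar>)\<^sup>2 \<partial>lborel) * (\<integral>\<^sup>+z. (ennreal \<bar>g z\<bar>)\<^sup>2 \<partial>lborel)"
    by (rule Cauchy_Schwarz_nn_integral) auto
  also have "\<dots> = ennreal ((norm2 f * norm2 g)\<^sup>2)"
    by (simp add: ennreal_power norm2_nn f g ennreal_mult power_mult_distrib)
  finally show ?thesis by (simp add: abs_le_square_iff[symmetric] norm2_nonneg abs_mult)
qed

lemma Cauchy_Schwarz_norm2':
  assumes "f \<in> bddL1" "g \<in> bddL1"
  shows "\<bar>LINT z|lborel. f z * g z\<bar> \<le> norm2 f * norm2 g"
  using Cauchy_Schwarz_norm2[OF assms] integral_abs_bound[of lborel "\<lambda>z. f z * g z"] by linarith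

lemma norm2_add:
  assumes f: "f \<in> bddL1" and g: "g \<in> bddL1"
  shows "norm2 (\<lambda>z. f z + g z) \<le> norm2 f + norm2 g"
proof -
  have "(norm2 (\<lambda>z. f z + g z))\<^sup>2 = (norm2 f)\<^sup>2 + 2 * (LINT z|lborel. f z * g z) + (norm2 g)\<^sup>2"
    unfolding norm2_sq using bddL1_int_sq[OF f] bddL1_int_sq[OF g] bddL1_int_mult[OF f g]
    by (simp add: power2_sum mult.assoc)
  also have "\<dots> \<le> (norm2 f + norm2 g)\<^sup>2"
    using Cauchy_Schwarz_norm2'[OF f g] by (simp add: power2_sum)
  finally show ?thesis by (rule power2_le_imp_le) (simp add: norm2_nonneg)
qed

lemma norm2_sum:
  assumes "\<And>i. i \<in> I \<Longrightarrow> f i \<in> bddL1"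
  shows "norm2 (\<lambda>z. \<Sum>i\<in>I. f i z) \<le> (\<Sum>i\<in>I. norm2 (f i))"
  using assms
proof (induction I rule: infinite_finite_induct)
  case (insert i I)
  have "norm2 (\<lambda>z. f i z + (\<Sum>i\<in>I. f i z)) \<le> norm2 (f i) + norm2 (\<lambda>z. \<Sum>i\<in>I. f i z)"
    by (rule norm2_add) (use insert in \<open>auto intro!: bddL1_sum\<close>)
  with insert show ?case by auto
qed (auto simp: norm2_def)

lemma norm2_conv:
  assumes f: "f \<in> bddL1" and g: "g \<in> bddL1"
  shows "norm2 (conv f g) \<le> norm1 f * norm2 g"
proof -
  note [measurable] = bddL1_meas[OF f] bddL1_meas[OF g] bddL1_meas[OF conv_bddL1[OF f g]]
  have 1: "ennreal ((conv f g z)\<^sup>2) \<le> ennreal (norm1 f) * (\<integral>\<^sup>+w. ennreal \<bar>f w\<bar> * ennreal ((g (z - w))\<^sup>2) \<partial>lborel)" for z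
  proof -
    have "ennreal (norm (conv f g z)) \<le> (\<integral>\<^sup>+w. norm (f w * g (z - w)) \<partial>lborel)"
      unfolding conv_def by (rule integral_norm_bound_ennreal[OF conv_int[OF f g]])
    \<comment> \<open>Splitting the modulus of \<open>f\<close> into two square roots lets
      Cauchy-Schwarz return one factor \<open>norm1 f\<close> at once and a second one after
      integration in \<open>z\<close>.\<close>
    also have "\<dots> = (\<integral>\<^sup>+w. ennreal (sqrt \<bar>f w\<bar>) * ennreal (sqrt \<bar>f w\<bar> * \<bar>g (z - w)\<bar>) \<partial>lborel)"
      by (intro nn_integral_cong) (simp add: ennreal_mult[symmetric] abs_mult mult.assoc[symmetric])
    finally have "(ennreal \<bar>conv f g z\<bar>)\<^sup>2 \<le> (\<integral>\<^sup>+w. ennreal (sqrt \<bar>f w\<bar>) * ennreal (sqrt \<bar>f w\<bar> * \<bar>g (z - w)\<bar>) \<partial>lborel)\<^sup>2"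
      by (intro power_mono) auto
    also have "\<dots> \<le> (\<integral>\<^sup>+w. (ennreal (sqrt \<bar>f w\<bar>))\<^sup>2 \<partial>lborel) * (\<integral>\<^sup>+w. (ennreal (sqrt \<bar>f w\<bar> * \<bar>g (z - w)\<bar>))\<^sup>2 \<partial>lborel)"
      by (rule Cauchy_Schwarz_nn_integral) auto
    also have "\<dots> = ennreal (norm1 f) * (\<integral>\<^sup>+w. ennreal \<bar>f w\<bar> * ennreal ((g (z - w))\<^sup>2) \<partial>lborel)"
      by (simp add: ennreal_power power_mult_distrib norm1_nn f ennreal_mult)
    finally show ?thesis by (simp add: ennreal_power)
  qed
  have "ennreal ((norm2 (conv f g))\<^sup>2) = (\<integral>\<^sup>+z. ennreal ((conv f g z)\<^sup>2) \<partial>lborel)"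
    by (rule norm2_nn[symmetric]) (rule conv_bddL1[OF f g])
  also have "\<dots> \<le> (\<integral>\<^sup>+z. ennreal (norm1 f) * (\<integral>\<^sup>+w. ennreal \<bar>f w\<bar> * ennreal ((g (z - w))\<^sup>2) \<partial>lborel) \<partial>lborel)"
    by (intro nn_integral_mono 1)
  also have "\<dots> = ennreal (norm1 f) * (\<integral>\<^sup>+w. (\<integral>\<^sup>+z. ennreal \<bar>f w\<bar> * ennreal ((g (z - w))\<^sup>2) \<partial>lborel) \<partial>lborel)"
    by (subst nn_integral_cmult, measurable, subst lborel_pair.Fubini') auto
  also have "\<dots> = ennreal (norm1 f) * (\<integral>\<^sup>+w. ennreal \<bar>f w\<bar> * ennreal ((norm2 g)\<^sup>2) \<partial>lborel)"
    by (subst nn_integral_cmult, simp, subst nn_integral_lborel_diff(2)[of "\<lambda>z. ennreal ((g z)\<^sup>2)"]) (auto simp: norm2_nn g)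
  also have "\<dots> = ennreal ((norm1 f * norm2 g)\<^sup>2)"
    by (subst nn_integral_multc) (auto simp: norm1_nn f ennreal_mult norm1_nonneg power_mult_distrib, simp add: power2_eq_square mult.assoc ennreal_mult norm1_nonneg)
  finally have "(norm2 (conv f g))\<^sup>2 \<le> (norm1 f * norm2 g)\<^sup>2" by simp
  then show ?thesis by (rule power2_le_imp_le) (simp add: norm1_nonneg norm2_nonneg)
qed

text \<open>Both sides are the same triple convolution evaluated at 0, once \<open>g\<close> is
  replaced by its reflection, so associativity and commutativity suffice.\<close>

lemma conv_adjoint:
  assumes q: "q \<in> bddL1" and f: "f \<in> bddL1" and g: "g \<in> bddL1"
  shows "(LINT z|lborel. conv q f z * g z) = (LINT z|lborel. f z * conv (\<lambda>w. q (- w)) g z)"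
proof -
  note [measurable] = bddL1_meas[OF q] bddL1_meas[OF f] bddL1_meas[OF g]
  have r: "(\<lambda>z. g (- z)) \<in> bddL1" by (rule bddL1_reflect[OF g])
  have "(LINT z|lborel. conv q f z * g z) = conv (conv q f) (\<lambda>z. g (- z)) 0"
    by (simp add: conv_def[of "conv q f"])
  also have "\<dots> = conv f (conv q (\<lambda>z. g (- z))) 0"
    using conv_assoc[OF f q r] conv_commute[OF f q] by simp
  also have "\<dots> = (LINT z|lborel. f z * conv (\<lambda>w. q (- w)) g z)"
    unfolding conv_def[of f]
  proof (intro Bochner_Integration.integral_cong refl arg_cong2[where f="(*)"])
    fix z show "conv q (\<lambda>z. g (- z)) (0 - z) = conv (\<lambda>w. q (- w)) g z"
      unfolding conv_def using integral_lborel_diff(3)[of "\<lambda>w. q (- w) * g (z - w)"]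
      by (simp add: algebra_simps)
  qed
  finally show ?thesis .
qed

section \<open>A Cotlar--Stein lemma for convolution kernels\<close>

lemma conv_power_bddL1: "K \<in> bddL1 \<Longrightarrow> f \<in> bddL1 \<Longrightarrow> (conv K ^^ k) f \<in> bddL1"
  by (induction k) (auto intro: conv_bddL1)

lemma conv_left_commute:
  assumes "f \<in> bddL1" "g \<in> bddL1" "h \<in> bddL1"
  shows "conv f (conv g h) = conv g (conv f h)"
  using conv_assoc[OF assms] conv_assoc[OF assms(2,1,3)] conv_commute[OF assms(1,2)] by simp

text \<open>The words in the single kernels that arise when a power of their linear combination is
  multiplied out.\<close>

definition conv_list :: "('i \<Rightarrow> 'a::euclidean_space \<Rightarrow> real) \<Rightarrow> 'i list \<Rightarrow> ('a \<Rightarrow> real) \<Rightarrow> 'a \<Rightarrow> real" where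
  "conv_list q l f = foldr (\<lambda>i. conv (q i)) l f"

lemma conv_list_Nil [simp]: "conv_list q [] f = f"
  and conv_list_Cons [simp]: "conv_list q (i # l) f = conv (q i) (conv_list q l f)"
  by (simp_all add: conv_list_def)

lemma conv_list_bddL1:
  assumes "\<And>i. i \<in> set l \<Longrightarrow> q i \<in> bddL1" "f \<in> bddL1"
  shows "conv_list q l f \<in> bddL1"
  using assms by (induction l) (auto intro: conv_bddL1)

lemma conv_list_conv:
  assumes "\<And>i. i \<in> set l \<Longrightarrow> q i \<in> bddL1" "f \<in> bddL1" "K \<in> bddL1"
  shows "conv_list q l (conv K f) = conv K (conv_list q l f)"
  using assms by (induction l) (auto simp: conv_left_commute conv_list_bddL1)

text \<open>Bounding a product of kernels by grouping consecutive factors into pairs, starting either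
  at the first or at the second factor, gives two estimates; their geometric mean is
  controlled by \<open>chain_weight\<close>.\<close>

fun pair_weight :: "real \<Rightarrow> ('i \<Rightarrow> 'i \<Rightarrow> real) \<Rightarrow> 'i list \<Rightarrow> real" where
  "pair_weight C \<omega> [] = 1"
| "pair_weight C \<omega> [i] = C"
| "pair_weight C \<omega> (i # j # l) = (\<omega> i j)\<^sup>2 * pair_weight C \<omega> l"

fun chain_weight :: "('i \<Rightarrow> 'i \<Rightarrow> real) \<Rightarrow> 'i list \<Rightarrow> real" where
  "chain_weight \<omega> (i # j # l) = \<omega> i j * chain_weight \<omega> (j # l)"
| "chain_weight \<omega> l = 1"

text \<open>The pairs formed from the first factor on and those formed from the second factor on
  together use every adjacent pair exactly once. For either parity of the length exactly one of the
  two groupings leaves a single factor over, which accounts for the one \<open>C\<close>.\<close>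

lemma pair_weight_mult:
  "l \<noteq> [] \<Longrightarrow> pair_weight C \<omega> l * pair_weight C \<omega> (tl l) = C * (chain_weight \<omega> l)\<^sup>2"
  by (induction \<omega> l rule: chain_weight.induct) (auto simp: power_mult_distrib algebra_simps)

lemma pair_weight_nonneg: "0 \<le> C \<Longrightarrow> 0 \<le> pair_weight C \<omega> l"
  by (induction C \<omega> l rule: pair_weight.induct) auto

lemma chain_weight_nonneg: "(\<And>i j. 0 \<le> \<omega> i j) \<Longrightarrow> 0 \<le> chain_weight \<omega> l"
  by (induction \<omega> l rule: chain_weight.induct) auto

text \<open>The kernels are even or odd according to \<open>\<sigma>\<close>, so that convolution with a combination of
  them is self-adjoint up to sign and its norm can be read off its powers.\<close>

locale almost_orthogonal =
  fixes F :: "'i set" and q :: "'i \<Rightarrow> 'a::euclidean_space \<Rightarrow> real" and \<sigma> C D :: real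
    and \<omega> :: "'i \<Rightarrow> 'i \<Rightarrow> real" and v :: "'i \<Rightarrow> real"
  assumes F: "finite F" and q: "\<And>i. i \<in> F \<Longrightarrow> q i \<in> bddL1"
    and sym: "\<And>i z. i \<in> F \<Longrightarrow> q i (- z) = \<sigma> * q i z" and \<sigma>: "\<bar>\<sigma>\<bar> = 1"
    and C: "0 \<le> C" "\<And>i. i \<in> F \<Longrightarrow> norm1 (q i) \<le> C"
    and \<omega>: "\<And>i j. 0 \<le> \<omega> i j" "\<And>i j. i \<in> F \<Longrightarrow> j \<in> F \<Longrightarrow> norm1 (conv (q i) (q j)) \<le> (\<omega> i j)\<^sup>2"
    and D: "0 < D" "\<And>i. i \<in> F \<Longrightarrow> (\<Sum>j\<in>F. \<omega> j i) \<le> D"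
    and v: "\<And>i. i \<in> F \<Longrightarrow> \<bar>v i\<bar> \<le> 1"
begin

definition K where "K = (\<lambda>z. \<Sum>i\<in>F. v i * q i z)"

lemma K: "K \<in> bddL1"
  unfolding K_def using q by (auto intro!: bddL1_sum bddL1_cmult)

lemma conv_K: "f \<in> bddL1 \<Longrightarrow> conv K f z = (\<Sum>i\<in>F. v i * conv (q i) f z)"
  unfolding K_def by (subst conv_sum_left) (auto intro!: bddL1_cmult q simp: conv_cmult_left)

lemma norm2_conv_K:
  assumes f: "f \<in> bddL1"
  shows "norm2 (conv K f) \<le> (\<Sum>i\<in>F. norm2 (conv (q i) f))"
proof -
  have "norm2 (conv K f) = norm2 (\<lambda>z. \<Sum>i\<in>F. v i * conv (q i) f z)"
    using conv_K[OF f] by presburger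
  also have "\<dots> \<le> (\<Sum>i\<in>F. norm2 (\<lambda>z. v i * conv (q i) f z))"
    by (rule norm2_sum) (auto intro!: bddL1_cmult conv_bddL1 q f)
  also have "\<dots> \<le> (\<Sum>i\<in>F. norm2 (conv (q i) f))"
    by (rule sum_mono) (use v in \<open>auto simp: norm2_cmult norm2_nonneg mult_left_le_one_le\<close>)
  finally show ?thesis .
qed

lemma norm2_conv_list_pair:
  assumes "set l \<subseteq> F" "f \<in> bddL1"
  shows "norm2 (conv_list q l f) \<le> pair_weight C \<omega> l * norm2 f"
  using assms(1)
proof (induction l rule: induct_list012)
  case (2 i)
  have "norm2 (conv (q i) f) \<le> norm1 (q i) * norm2 f" using 2 assms(2) q by (auto intro: norm2_conv)
  also have "\<dots> \<le> C * norm2 f" using 2 C by (intro mult_right_mono norm2_nonneg) auto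
  finally show ?case by simp
next
  case (3 i j l)
  then have ij: "i \<in> F" "j \<in> F" "set l \<subseteq> F" by auto
  have lb: "conv_list q l f \<in> bddL1" using ij q by (intro conv_list_bddL1 assms) auto
  have "norm2 (conv_list q (i # j # l) f) = norm2 (conv (conv (q i) (q j)) (conv_list q l f))"
    using ij q lb by (simp add: conv_assoc)
  also have "\<dots> \<le> norm1 (conv (q i) (q j)) * norm2 (conv_list q l f)"
    using ij q lb by (intro norm2_conv conv_bddL1) auto
  also have "\<dots> \<le> (\<omega> i j)\<^sup>2 * (pair_weight C \<omega> l * norm2 f)"
    using ij \<omega> 3 by (intro mult_mono) (auto simp: norm2_nonneg)
  finally show ?case by (simp add: mult.assoc)
qed simp

lemma norm2_conv_list:
  assumes l: "set l \<subseteq> F" "l \<noteq> []" and f: "f \<in> bddL1"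
  shows "norm2 (conv_list q l f) \<le> C * chain_weight \<omega> l * norm2 f"
proof (rule power2_le_imp_le)
  obtain i r where ir: "l = i # r" using l by (cases l) auto
  have lb: "conv_list q r f \<in> bddL1" using l ir q by (intro conv_list_bddL1 f) auto
  have "norm2 (conv_list q l f) \<le> norm1 (q i) * norm2 (conv_list q r f)"
    using l ir by (simp add: norm2_conv q lb)
  also have "\<dots> \<le> C * (pair_weight C \<omega> r * norm2 f)"
    using l ir C by (intro mult_mono norm2_conv_list_pair f) (auto simp: norm2_nonneg)
  finally have 1: "norm2 (conv_list q l f) \<le> C * (pair_weight C \<omega> (tl l) * norm2 f)" using ir by simp
  have "(norm2 (conv_list q l f))\<^sup>2 \<le> (pair_weight C \<omega> l * norm2 f) * (C * (pair_weight C \<omega> (tl l) * norm2 f))"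
    unfolding power2_eq_square
    by (intro mult_mono 1 norm2_conv_list_pair l f mult_nonneg_nonneg norm2_nonneg pair_weight_nonneg C)
  also have "\<dots> = (C * chain_weight \<omega> l * norm2 f)\<^sup>2"
    using pair_weight_mult[OF l(2), of C \<omega>] by (simp add: power2_eq_square)
  finally show "(norm2 (conv_list q l f))\<^sup>2 \<le> (C * chain_weight \<omega> l * norm2 f)\<^sup>2" .
  show "0 \<le> C * chain_weight \<omega> l * norm2 f"
    using C \<omega> by (auto intro!: mult_nonneg_nonneg chain_weight_nonneg norm2_nonneg)
qed

text \<open>Each power of \<open>K\<close> is expanded by one letter at a time. As convolutions
  commute, the new letter can be put in front of the word, where summing over it costs the factor
  \<open>D\<close> by the bound on the sums of \<open>\<omega>\<close>. The word must be nonempty so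
  that the new letter has a neighbour.\<close>

lemma norm2_conv_list_power:
  assumes "set l \<subseteq> F" "l \<noteq> []" and f: "f \<in> bddL1"
  shows "norm2 (conv_list q l ((conv K ^^ k) f)) \<le> C * chain_weight \<omega> l * D ^ k * norm2 f"
  using assms(1,2)
proof (induction k arbitrary: l)
  case 0
  then show ?case using norm2_conv_list[OF _ _ f] by simp
next
  case (Suc k)
  define g where "g = (conv K ^^ k) f"
  have g: "g \<in> bddL1" unfolding g_def by (intro conv_power_bddL1 K f)
  obtain j r where jr: "l = j # r" using Suc.prems by (cases l) auto
  have j: "j \<in> F" using Suc.prems jr by auto
  have "norm2 (conv_list q l ((conv K ^^ Suc k) f)) = norm2 (conv K (conv_list q l g))"
    using Suc.prems q K g by (simp add: g_def[symmetric], subst conv_list_conv) auto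
  also have "\<dots> \<le> (\<Sum>i\<in>F. norm2 (conv_list q (i # l) g))"
    using Suc.prems by (simp, intro norm2_conv_K conv_list_bddL1 g q) auto
  also have "\<dots> \<le> (\<Sum>i\<in>F. C * chain_weight \<omega> (i # l) * D ^ k * norm2 f)"
    unfolding g_def by (intro sum_mono Suc.IH) (use Suc.prems in auto)
  also have "\<dots> = (\<Sum>i\<in>F. \<omega> i j) * (C * chain_weight \<omega> l * D ^ k * norm2 f)"
    by (simp add: jr sum_distrib_left sum_distrib_right algebra_simps)
  also have "\<dots> \<le> D * (C * chain_weight \<omega> l * D ^ k * norm2 f)"
    using D(2)[OF j] C D \<omega> by (intro mult_right_mono) (auto intro!: mult_nonneg_nonneg chain_weight_nonneg norm2_nonneg)
  finally show ?case by (simp add: algebra_simps)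
qed

text \<open>The first letter has no neighbour and is summed trivially, whence the factor
  \<open>card F\<close>. It is harmless because it does not grow with \<open>k\<close>.\<close>

lemma norm2_power:
  assumes f: "f \<in> bddL1"
  shows "norm2 ((conv K ^^ Suc k) f) \<le> real (card F) * C * D ^ k * norm2 f"
proof -
  have "norm2 ((conv K ^^ Suc k) f) \<le> (\<Sum>i\<in>F. norm2 (conv_list q [i] ((conv K ^^ k) f)))"
    using norm2_conv_K[OF conv_power_bddL1[OF K f]] by simp
  also have "\<dots> \<le> (\<Sum>i\<in>F. C * D ^ k * norm2 f)"
  proof (rule sum_mono)
    fix i assume "i \<in> F"
    then show "norm2 (conv_list q [i] ((conv K ^^ k) f)) \<le> C * D ^ k * norm2 f"
      using norm2_conv_list_power[of "[i]" f k] f by auto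
  qed
  finally show ?thesis by simp
qed

text \<open>Moving the factors of \<open>K\<close> one by one to the other side of the inner product
  changes only its sign, because \<open>K\<close> is even or odd; then Cauchy-Schwarz.\<close>

lemma norm2_conv_K_sq:
  assumes f: "f \<in> bddL1"
  shows "(norm2 ((conv K ^^ k) f))\<^sup>2 \<le> norm2 ((conv K ^^ (2 * k)) f) * norm2 f"
proof -
  have adj: "\<bar>LINT z|lborel. conv K g z * h z\<bar> = \<bar>LINT z|lborel. g z * conv K h z\<bar>"
    if g: "g \<in> bddL1" and h: "h \<in> bddL1" for g h
  proof -
    have "(\<lambda>w. K (- w)) = (\<lambda>w. \<sigma> * K w)" unfolding K_def by (auto simp: sym sum_distrib_left algebra_simps)
    then have "(LINT z|lborel. conv K g z * h z) = \<sigma> * (LINT z|lborel. g z * conv K h z)"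
      using conv_adjoint[OF K g h] by (simp add: conv_cmult_left algebra_simps flip: integral_mult_right_zero)
    then show ?thesis using \<sigma> by (simp add: abs_mult)
  qed
  have "\<bar>LINT z|lborel. (conv K ^^ i) f z * (conv K ^^ j) f z\<bar> = \<bar>LINT z|lborel. (conv K ^^ (i + j)) f z * f z\<bar>" for i j
  proof (induction j arbitrary: i)
    case (Suc j)
    show ?case using adj[of "(conv K ^^ i) f" "(conv K ^^ j) f"] Suc[of "Suc i"] conv_power_bddL1[OF K f] by simp
  qed simp
  from this[of k k] have "(norm2 ((conv K ^^ k) f))\<^sup>2 = \<bar>LINT z|lborel. (conv K ^^ (2 * k)) f z * f z\<bar>"
    unfolding norm2_sq by (simp add: power2_eq_square mult_2)
  also have "\<dots> \<le> norm2 ((conv K ^^ (2 * k)) f) * norm2 f"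
    by (intro Cauchy_Schwarz_norm2' conv_power_bddL1 K f)
  finally show ?thesis .
qed

text \<open>Along the exponents 2^i the ratio x of the two norms satisfies (x / D)^(2^i) \<le> card
  F * C / D. The right side does not depend on i, so x > D is impossible; the crude constants
  \<open>card F\<close> and \<open>C\<close> disappear in this limit.\<close>

theorem cotlar_stein:
  assumes f: "f \<in> bddL1"
  shows "norm2 (conv K f) \<le> D * norm2 f"
proof (cases "norm2 f = 0")
  case True
  then show ?thesis using norm2_conv[OF K f] by simp
next
  case False
  then have pos: "0 < norm2 f" using norm2_nonneg[of f] by simp
  define x where "x = norm2 (conv K f) / norm2 f"
  have x0: "0 \<le> x" unfolding x_def using norm2_nonneg[of "conv K f"] pos by simp
  have dbl: "x ^ (2 ^ i) \<le> norm2 ((conv K ^^ (2 ^ i)) f) / norm2 f" for i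
  proof (induction i)
    case (Suc i)
    have "x ^ (2 ^ Suc i) = (x ^ (2 ^ i))\<^sup>2" by (simp add: power_mult[symmetric] mult.commute)
    also have "\<dots> \<le> (norm2 ((conv K ^^ (2 ^ i)) f) / norm2 f)\<^sup>2" using Suc x0 by (intro power_mono) auto
    also have "\<dots> \<le> norm2 ((conv K ^^ (2 ^ Suc i)) f) * norm2 f / (norm2 f)\<^sup>2"
      using norm2_conv_K_sq[OF f, of "2 ^ i"] by (simp add: power_divide divide_right_mono)
    finally show ?case using pos by (simp add: power2_eq_square)
  qed (simp add: x_def)
  have bnd: "(x / D) ^ (2 ^ i) \<le> real (card F) * C / D" for i
  proof -
    obtain k where k: "2 ^ i = Suc k" by (metis not0_implies_Suc power_not_zero zero_neq_numeral)
    have "x ^ (2 ^ i) \<le> (real (card F) * C * D ^ k * norm2 f) / norm2 f"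
      using dbl[of i] unfolding k
      by (rule order.trans) (intro divide_right_mono norm2_power f norm2_nonneg)
    then have "x ^ (2 ^ i) \<le> real (card F) * C * D ^ k" using pos by simp
    then have "(x / D) ^ (2 ^ i) \<le> real (card F) * C * D ^ k / D ^ (Suc k)"
      unfolding k using D by (simp only: power_divide) (intro divide_right_mono, auto)
    then show ?thesis using D by simp
  qed
  have "x / D \<le> 1"
  proof (rule ccontr)
    assume "\<not> x / D \<le> 1"
    then obtain N where N: "real (card F) * C / D < (x / D) ^ N" using real_arch_pow by force
    have "(x / D) ^ N \<le> (x / D) ^ (2 ^ N)" using \<open>\<not> x / D \<le> 1\<close> by (intro power_increasing) (auto intro: less_imp_le)
    with bnd[of N] N show False by linarith
  qed
  then show ?thesis unfolding x_def using D pos by (simp add: field_simps)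
qed

end

section \<open>Maximal functions with comparable kernels\<close>

lemma ennreal_power2_le_imp_le:
  fixes a b :: ennreal
  assumes "a\<^sup>2 \<le> b\<^sup>2"
  shows "a \<le> b"
proof (cases "b = \<infinity>")
  case False
  then obtain y where y: "0 \<le> y" "b = ennreal y" by (cases b) auto
  have *: "a * a \<le> ennreal (y\<^sup>2)" using assms y by (simp add: ennreal_power power2_eq_square[of a])
  have "a \<noteq> top"
  proof
    assume "a = top"
    with * show False by (simp add: top_unique)
  qed
  then obtain x where x: "0 \<le> x" "a = ennreal x" by (cases a) auto
  have "x\<^sup>2 \<le> y\<^sup>2" using assms x y by (simp add: ennreal_power)
  then show ?thesis using power2_le_imp_le x y by (simp add: ennreal_leI)
qed simp

text \<open>Young's inequality for arbitrary nonnegative \<open>g\<close>, possibly of infinite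
  norm. It provides the first finite bound from which the bootstrap for the maximal function
  starts.\<close>

lemma nn_Young2:
  fixes L :: "'a::euclidean_space \<Rightarrow> real" and g :: "'a \<Rightarrow> ennreal"
  assumes [measurable]: "L \<in> borel_measurable borel" "g \<in> borel_measurable borel"
    and L: "\<And>z. 0 \<le> L z"
  shows "(\<integral>\<^sup>+z. (\<integral>\<^sup>+w. ennreal (L (z - w)) * g w \<partial>lborel)\<^sup>2 \<partial>lborel)
    \<le> (\<integral>\<^sup>+z. ennreal (L z) \<partial>lborel)\<^sup>2 * (\<integral>\<^sup>+w. (g w)\<^sup>2 \<partial>lborel)"
proof -
  let ?N = "\<integral>\<^sup>+z. ennreal (L z) \<partial>lborel"
  have 1: "(\<integral>\<^sup>+w. ennreal (L (z - w)) * g w \<partial>lborel)\<^sup>2 \<le> ?N * (\<integral>\<^sup>+w. ennreal (L (z - w)) * (g w)\<^sup>2 \<partial>lborel)" for z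
  proof -
    have "(\<integral>\<^sup>+w. ennreal (L (z - w)) * g w \<partial>lborel) =
      (\<integral>\<^sup>+w. ennreal (sqrt (L (z - w))) * (ennreal (sqrt (L (z - w))) * g w) \<partial>lborel)"
      by (intro nn_integral_cong) (simp add: mult.assoc[symmetric] ennreal_mult[symmetric] L)
    also have "\<dots>\<^sup>2 \<le> (\<integral>\<^sup>+w. (ennreal (sqrt (L (z - w))))\<^sup>2 \<partial>lborel) *
        (\<integral>\<^sup>+w. (ennreal (sqrt (L (z - w))) * g w)\<^sup>2 \<partial>lborel)"
      by (rule Cauchy_Schwarz_nn_integral) auto
    also have "\<dots> = ?N * (\<integral>\<^sup>+w. ennreal (L (z - w)) * (g w)\<^sup>2 \<partial>lborel)"
      by (simp add: ennreal_power power_mult_distrib L nn_integral_lborel_diff(1)[of "\<lambda>w. ennreal (L w)"])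
    finally show ?thesis .
  qed
  have "(\<integral>\<^sup>+z. (\<integral>\<^sup>+w. ennreal (L (z - w)) * g w \<partial>lborel)\<^sup>2 \<partial>lborel)
    \<le> (\<integral>\<^sup>+z. ?N * (\<integral>\<^sup>+w. ennreal (L (z - w)) * (g w)\<^sup>2 \<partial>lborel) \<partial>lborel)"
    by (intro nn_integral_mono 1)
  also have "\<dots> = ?N * (\<integral>\<^sup>+w. (\<integral>\<^sup>+z. ennreal (L (z - w)) * (g w)\<^sup>2 \<partial>lborel) \<partial>lborel)"
    by (subst nn_integral_cmult, measurable, subst lborel_pair.Fubini') auto
  also have "\<dots> = ?N * (?N * (\<integral>\<^sup>+w. (g w)\<^sup>2 \<partial>lborel))"
    by (simp add: nn_integral_multc nn_integral_lborel_diff(2)[of "\<lambda>w. ennreal (L w)"] nn_integral_cmult)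
  finally show ?thesis by (simp add: power2_eq_square mult.assoc)
qed

text \<open>\<open>L_conv\<close> is the decisive property: composing two of the averaging operators
  yields at most a multiple of their sum, whatever their scales. The final bound depends on
  \<open>C\<close> and not on the number \<open>m\<close> of kernels.\<close>

locale maximal_kernels =
  fixes m :: nat and L :: "nat \<Rightarrow> 'a::euclidean_space \<Rightarrow> real" and C :: real
  assumes m: "0 < m" and C: "0 < C"
    and L_meas [measurable]: "\<And>i. L i \<in> borel_measurable borel"
    and L_nonneg: "\<And>i z. 0 \<le> L i z"
    and L_even: "\<And>i z. L i (- z) = L i z"
    and L_fin: "\<And>i. (\<integral>\<^sup>+z. ennreal (L i z) \<partial>lborel) < \<infinity>"
    and L_conv: "\<And>i j z. (\<integral>\<^sup>+w. ennreal (L i (z - w)) * ennreal (L j w) \<partial>lborel)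
      \<le> ennreal C * (ennreal (L i z) + ennreal (L j z))"
begin

definition A :: "('a \<Rightarrow> ennreal) \<Rightarrow> nat \<Rightarrow> 'a \<Rightarrow> ennreal" where
  "A g i z = (\<integral>\<^sup>+w. ennreal (L i (z - w)) * g w \<partial>lborel)"

definition M :: "('a \<Rightarrow> ennreal) \<Rightarrow> 'a \<Rightarrow> ennreal" where
  "M g z = (SUP i\<in>{..<m}. A g i z)"

lemma A_meas [measurable]:
  assumes [measurable]: "g \<in> borel_measurable borel"
  shows "A g i \<in> borel_measurable borel"
  unfolding A_def by measurable

lemma M_meas [measurable]: "g \<in> borel_measurable borel \<Longrightarrow> M g \<in> borel_measurable borel"
  unfolding M_def by measurable

lemma A_le_M: "i < m \<Longrightarrow> A g i z \<le> M g z"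
  unfolding M_def by (intro SUP_upper) auto

lemma M_attained: "\<exists>i<m. M g z = A g i z"
proof -
  have "M g z = Max ((\<lambda>i. A g i z) ` {..<m})"
    unfolding M_def using m by (subst Max_Sup) auto
  also have "\<dots> \<in> (\<lambda>i. A g i z) ` {..<m}" using m by (intro Max_in) auto
  finally show ?thesis by auto
qed

text \<open>Linearising the maximal function by a measurable selection, the \<open>T T\<^sup>*\<close> kernel of the
  linearised operator is bounded by the kernels of that operator and of its adjoint, so a bound
  \<open>B\<close> for the squared norm improves to \<open>2 C \<surd>B\<close>.\<close>

lemma M_bootstrap:
  assumes B: "0 \<le> B" "\<And>g. g \<in> borel_measurable borel \<Longrightarrow>
      (\<integral>\<^sup>+z. (M g z)\<^sup>2 \<partial>lborel) \<le> ennreal B * (\<integral>\<^sup>+z. (g z)\<^sup>2 \<partial>lborel)"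
    and g [measurable]: "g \<in> borel_measurable borel"
  shows "(\<integral>\<^sup>+z. (M g z)\<^sup>2 \<partial>lborel) \<le> ennreal (2 * C * sqrt B) * (\<integral>\<^sup>+z. (g z)\<^sup>2 \<partial>lborel)"
proof -
  define h where "h = M g"
  have h [measurable]: "h \<in> borel_measurable borel" unfolding h_def by measurable
  \<comment> \<open>Choosing the least maximising index makes the selection measurable.\<close>
  define \<tau> where "\<tau> z = (LEAST i. i < m \<and> M g z = A g i z)" for z
  have \<tau>: "\<tau> z < m" "M g z = A g (\<tau> z) z" for z
    using LeastI_ex[of "\<lambda>i. i < m \<and> M g z = A g i z"] M_attained[of g z] unfolding \<tau>_def by auto
  have \<tau>_meas [measurable]: "\<tau> \<in> borel \<rightarrow>\<^sub>M count_space UNIV"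
    unfolding \<tau>_def by measurable
  have L\<tau> [measurable]: "(\<lambda>(z, w). L (\<tau> z) (z - w)) \<in> borel_measurable (borel \<Otimes>\<^sub>M borel)"
    "(\<lambda>(z, w). L (\<tau> w) (w - z)) \<in> borel_measurable (borel \<Otimes>\<^sub>M borel)"
    unfolding split_beta by measurable
  define S where "S w = (\<integral>\<^sup>+z. h z * ennreal (L (\<tau> z) (z - w)) \<partial>lborel)" for w
  have S [measurable]: "S \<in> borel_measurable borel" unfolding S_def by measurable
  define X where "X = (\<integral>\<^sup>+z. (h z)\<^sup>2 \<partial>lborel)"
  define G where "G = (\<integral>\<^sup>+z. (g z)\<^sup>2 \<partial>lborel)"
  define P where "P = (\<integral>\<^sup>+z. h z * M h z \<partial>lborel)"
  have "X = (\<integral>\<^sup>+z. (\<integral>\<^sup>+w. h z * (ennreal (L (\<tau> z) (z - w)) * g w) \<partial>lborel) \<partial>lborel)"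
    unfolding X_def power2_eq_square
    by (intro nn_integral_cong, subst nn_integral_cmult) (auto simp: h_def \<tau>(2) A_def)
  also have "\<dots> = (\<integral>\<^sup>+w. (\<integral>\<^sup>+z. h z * (ennreal (L (\<tau> z) (z - w)) * g w) \<partial>lborel) \<partial>lborel)"
    by (rule lborel_pair.Fubini') measurable
  also have "\<dots> = (\<integral>\<^sup>+w. g w * S w \<partial>lborel)"
    unfolding S_def by (intro nn_integral_cong, subst nn_integral_cmult[symmetric]) (auto simp: ac_simps)
  finally have "X\<^sup>2 \<le> G * (\<integral>\<^sup>+w. (S w)\<^sup>2 \<partial>lborel)"
    unfolding G_def using Cauchy_Schwarz_nn_integral[of g lborel S] by simp
  moreover have "(\<integral>\<^sup>+w. (S w)\<^sup>2 \<partial>lborel) \<le> ennreal (2 * C) * P"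
  proof -
    \<comment> \<open>The square is written as a double integral so that, after interchanging, the
      innermost integral in \<open>w\<close> is a composition of two kernels, to which
      \<open>L_conv\<close> applies.\<close>
    have "(\<integral>\<^sup>+w. (S w)\<^sup>2 \<partial>lborel) = (\<integral>\<^sup>+w. (\<integral>\<^sup>+z. (\<integral>\<^sup>+z'. h z * h z' *
        (ennreal (L (\<tau> z) (z - w)) * ennreal (L (\<tau> z') (z' - w))) \<partial>lborel) \<partial>lborel) \<partial>lborel)"
      unfolding S_def power2_eq_square
      by (intro nn_integral_cong, subst nn_integral_multc[symmetric], measurable,
        intro nn_integral_cong, subst nn_integral_cmult[symmetric]) (auto simp: ac_simps)
    also have "\<dots> = (\<integral>\<^sup>+z. (\<integral>\<^sup>+w. (\<integral>\<^sup>+z'. h z * h z' *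
        (ennreal (L (\<tau> z) (z - w)) * ennreal (L (\<tau> z') (z' - w))) \<partial>lborel) \<partial>lborel) \<partial>lborel)"
      by (rule lborel_pair.Fubini') measurable
    also have "\<dots> = (\<integral>\<^sup>+z. (\<integral>\<^sup>+z'. (\<integral>\<^sup>+w. h z * h z' *
        (ennreal (L (\<tau> z) (z - w)) * ennreal (L (\<tau> z') (z' - w))) \<partial>lborel) \<partial>lborel) \<partial>lborel)"
      by (rule nn_integral_cong, rule lborel_pair.Fubini') measurable
    also have "\<dots> \<le> (\<integral>\<^sup>+z. (\<integral>\<^sup>+z'. h z * h z' *
        (ennreal C * (ennreal (L (\<tau> z) (z - z')) + ennreal (L (\<tau> z') (z - z')))) \<partial>lborel) \<partial>lborel)"
    proof (intro nn_integral_mono)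
      fix z z'
      have "(\<integral>\<^sup>+w. ennreal (L (\<tau> z) (z - w)) * ennreal (L (\<tau> z') (z' - w)) \<partial>lborel) =
        (\<integral>\<^sup>+w. ennreal (L (\<tau> z) (z - z' - (w - z'))) * ennreal (L (\<tau> z') (w - z')) \<partial>lborel)"
        using L_even[of "\<tau> z'" "z' - _"] by (intro nn_integral_cong) simp
      also have "\<dots> = (\<integral>\<^sup>+w. ennreal (L (\<tau> z) (z - z' - w)) * ennreal (L (\<tau> z') w) \<partial>lborel)"
        by (rule nn_integral_lborel_diff(2)) measurable
      also have "\<dots> \<le> ennreal C * (ennreal (L (\<tau> z) (z - z')) + ennreal (L (\<tau> z') (z - z')))"
        by (rule L_conv)
      finally show "(\<integral>\<^sup>+w. h z * h z' * (ennreal (L (\<tau> z) (z - w)) * ennreal (L (\<tau> z') (z' - w))) \<partial>lborel)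
        \<le> h z * h z' * (ennreal C * (ennreal (L (\<tau> z) (z - z')) + ennreal (L (\<tau> z') (z - z'))))"
        by (subst nn_integral_cmult) (auto intro: mult_left_mono)
    qed
    also have "\<dots> = ennreal C * ((\<integral>\<^sup>+z. (\<integral>\<^sup>+z'. h z * h z' * ennreal (L (\<tau> z) (z - z')) \<partial>lborel) \<partial>lborel) +
       (\<integral>\<^sup>+z. (\<integral>\<^sup>+z'. h z * h z' * ennreal (L (\<tau> z') (z' - z)) \<partial>lborel) \<partial>lborel))"
      using L_even[of _ "_ - _"]
      by (simp add: nn_integral_add[symmetric] nn_integral_cmult[symmetric]) (simp add: algebra_simps)
    \<comment> \<open>By evenness the second term carries the kernel selected at \<open>z'\<close>;
      renaming the two variables turns it into the first term.\<close>
    also have "(\<integral>\<^sup>+z. (\<integral>\<^sup>+z'. h z * h z' * ennreal (L (\<tau> z') (z' - z)) \<partial>lborel) \<partial>lborel) =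
       (\<integral>\<^sup>+z'. (\<integral>\<^sup>+z. h z * h z' * ennreal (L (\<tau> z') (z' - z)) \<partial>lborel) \<partial>lborel)"
      by (rule lborel_pair.Fubini') measurable
    also have "\<dots> = (\<integral>\<^sup>+z. (\<integral>\<^sup>+z'. h z * h z' * ennreal (L (\<tau> z) (z - z')) \<partial>lborel) \<partial>lborel)"
      by (simp add: ac_simps)
    also have "(\<integral>\<^sup>+z. (\<integral>\<^sup>+z'. h z * h z' * ennreal (L (\<tau> z) (z - z')) \<partial>lborel) \<partial>lborel) \<le> P"
      unfolding P_def
    proof (rule nn_integral_mono)
      fix z
      have "(\<integral>\<^sup>+z'. h z * h z' * ennreal (L (\<tau> z) (z - z')) \<partial>lborel) = h z * A h (\<tau> z) z"
        unfolding A_def by (subst nn_integral_cmult[symmetric]) (auto simp: ac_simps)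
      also have "\<dots> \<le> h z * M h z" by (intro mult_left_mono A_le_M \<tau>) simp
      finally show "(\<integral>\<^sup>+z'. h z * h z' * ennreal (L (\<tau> z) (z - z')) \<partial>lborel) \<le> h z * M h z" .
    qed
    finally show ?thesis using C
      by (simp add: mult_left_mono add_mono ennreal_mult mult.assoc mult_2[symmetric] mult.left_commute)
  qed
  moreover have "P \<le> ennreal (sqrt B) * X"
  proof -
    have "P\<^sup>2 \<le> X * (\<integral>\<^sup>+z. (M h z)\<^sup>2 \<partial>lborel)"
      unfolding P_def X_def by (rule Cauchy_Schwarz_nn_integral) measurable
    also have "\<dots> \<le> X * (ennreal B * X)"
      using B(2)[OF h] unfolding X_def by (intro mult_left_mono) auto
    also have "\<dots> = (ennreal (sqrt B) * X)\<^sup>2"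
    proof -
      have "ennreal B = ennreal (sqrt B) * ennreal (sqrt B)" using B(1) by (simp flip: ennreal_mult)
      then show ?thesis by (simp add: power2_eq_square ac_simps)
    qed
    finally show ?thesis by (rule ennreal_power2_le_imp_le)
  qed
  ultimately have "X\<^sup>2 \<le> G * (ennreal (2 * C) * (ennreal (sqrt B) * X))"
    by (meson mult_left_mono order.trans zero_le)
  also have "\<dots> = (ennreal (2 * C * sqrt B) * G) * X"
    using C B by (simp add: ennreal_mult ac_simps)
  finally have XX: "X * X \<le> (ennreal (2 * C * sqrt B) * G) * X" by (simp add: power2_eq_square)
  show ?thesis
  proof (cases "G = \<infinity> \<or> X = 0")
    case True
    then show ?thesis
    proof
      assume "G = \<infinity>"
      \<comment> \<open>An infinite \<open>G\<close> makes the claim trivial except for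
        \<open>B = 0\<close>, where the product on the right is 0 and the assumed bound itself has
        to be used.\<close>
      show ?thesis
      proof (cases "B = 0")
        case True
        then show ?thesis using B(2)[OF g] by simp
      next
        case False
        then have "0 < 2 * C * sqrt B" using C B(1) by simp
        then have "ennreal (2 * C * sqrt B) * G = \<infinity>"
          unfolding \<open>G = \<infinity>\<close> by (metis ennreal_mult_eq_top_iff infinity_ennreal_def ennreal_eq_0_iff not_le)
        then show ?thesis unfolding G_def[symmetric] by simp
      qed
    qed (simp add: X_def h_def)
  next
    case False
    \<comment> \<open>The assumed bound is used a second time to know that \<open>X\<close> is
      finite, so that the factor \<open>X\<close> may be cancelled.\<close>
    have "X \<le> ennreal B * G" unfolding X_def h_def G_def by (rule B(2)[OF g])
    also have "\<dots> < \<infinity>" using False by (simp add: ennreal_mult_less_top less_top)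
    finally have "X < \<infinity>" .
    then have X: "X \<noteq> 0" "X \<noteq> top" using False by auto
    have "X * X \<le> X * (ennreal (2 * C * sqrt B) * G)" 
      using XX by (simp only: mult.commute[of X "ennreal (2 * C * sqrt B) * G"])
    then have "X \<le> ennreal (2 * C * sqrt B) * G"
      by (rule iffD1[OF ennreal_mult_le_mult_iff[OF X]])
    then show ?thesis unfolding X_def h_def G_def .
  qed
qed

text \<open>The set \<open>V\<close> of admissible bounds is nonempty by summing the crude bounds of
  the finitely many kernels, and it is mapped into itself by B -> 2 C sqrt B. A bound slightly above
  an infimum exceeding the fixed point 4 C^2 would be mapped below that infimum. The summand 1
  leaves room for an infimum that is not attained.\<close>

theorem maximal_bound:
  assumes "g \<in> borel_measurable borel"
  shows "(\<integral>\<^sup>+z. (M g z)\<^sup>2 \<partial>lborel) \<le> ennreal (4 * C\<^sup>2 + 1) * (\<integral>\<^sup>+z. (g z)\<^sup>2 \<partial>lborel)"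
proof -
  define V where "V = {B. 0 \<le> B \<and> (\<forall>g. g \<in> borel_measurable borel \<longrightarrow>
      (\<integral>\<^sup>+z. (M g z)\<^sup>2 \<partial>lborel) \<le> ennreal B * (\<integral>\<^sup>+z. (g z)\<^sup>2 \<partial>lborel))}"
  have step: "2 * C * sqrt B \<in> V" if "B \<in> V" for B
    using that M_bootstrap[of B] C unfolding V_def by auto
  have "V \<noteq> {}"
  proof -
    define B where "B = (\<Sum>i<m. (\<integral>\<^sup>+z. ennreal (L i z) \<partial>lborel)\<^sup>2)"
    have fin: "B < \<infinity>" unfolding B_def using L_fin by (simp add: power_less_top_ennreal)
    then obtain b where b: "0 \<le> b" "B = ennreal b" by (cases B) auto
    have "b \<in> V"
      unfolding V_def
    proof (intro CollectI conjI allI impI)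
      fix g :: "'a \<Rightarrow> ennreal" assume g[measurable]: "g \<in> borel_measurable borel"
      have "(M g z)\<^sup>2 \<le> (\<Sum>i<m. (A g i z)\<^sup>2)" for z
      proof -
        obtain i where i: "i < m" "M g z = A g i z" using M_attained by blast
        then show ?thesis using member_le_sum[of i "{..<m}" "\<lambda>i. (A g i z)\<^sup>2"] by simp
      qed
      then have "(\<integral>\<^sup>+z. (M g z)\<^sup>2 \<partial>lborel) \<le> (\<integral>\<^sup>+z. (\<Sum>i<m. (A g i z)\<^sup>2) \<partial>lborel)"
        by (intro nn_integral_mono)
      also have "\<dots> = (\<Sum>i<m. (\<integral>\<^sup>+z. (A g i z)\<^sup>2 \<partial>lborel))"
        by (rule nn_integral_sum) measurable
      also have "\<dots> \<le> (\<Sum>i<m. (\<integral>\<^sup>+z. ennreal (L i z) \<partial>lborel)\<^sup>2 * (\<integral>\<^sup>+z. (g z)\<^sup>2 \<partial>lborel))"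
        unfolding A_def by (intro sum_mono nn_Young2 L_nonneg) measurable
      finally show "(\<integral>\<^sup>+z. (M g z)\<^sup>2 \<partial>lborel) \<le> ennreal b * (\<integral>\<^sup>+z. (g z)\<^sup>2 \<partial>lborel)"
        unfolding b(2)[symmetric] B_def by (simp add: sum_distrib_right)
    qed (rule b)
    then show ?thesis by auto
  qed
  have bb: "bdd_below V" unfolding V_def by (rule bdd_belowI[of _ 0]) auto
  have "Inf V \<le> 4 * C\<^sup>2"
  proof (rule ccontr)
    assume *: "\<not> Inf V \<le> 4 * C\<^sup>2"
    then have "0 < Inf V" using C by (meson linorder_not_le order.trans zero_le_power2 mult_nonneg_nonneg zero_le_numeral)
    then have "Inf V < (Inf V)\<^sup>2 / (4 * C\<^sup>2)" using * C by (simp add: power2_eq_square field_simps)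
    then obtain B where B: "B \<in> V" "B < (Inf V)\<^sup>2 / (4 * C\<^sup>2)"
      using cInf_lessD[OF \<open>V \<noteq> {}\<close>] by blast
    have "sqrt B < sqrt ((Inf V / (2 * C))\<^sup>2)"
      using B by (intro real_sqrt_less_mono) (simp add: power_divide power_mult_distrib)
    also have "\<dots> = Inf V / (2 * C)" using \<open>0 < Inf V\<close> C by simp
    finally have "2 * C * sqrt B < Inf V" using C by (simp add: field_simps)
    moreover have "Inf V \<le> 2 * C * sqrt B" by (rule cInf_lower[OF step[OF B(1)] bb])
    ultimately show False by simp
  qed
  then obtain B where B: "B \<in> V" "B < 4 * C\<^sup>2 + 1"
    using cInf_lessD[OF \<open>V \<noteq> {}\<close>, of "4 * C\<^sup>2 + 1"] by auto
  have "(\<integral>\<^sup>+z. (M g z)\<^sup>2 \<partial>lborel) \<le> ennreal B * (\<integral>\<^sup>+z. (g z)\<^sup>2 \<partial>lborel)"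
    using B(1) assms unfolding V_def by auto
  also have "\<dots> \<le> ennreal (4 * C\<^sup>2 + 1) * (\<integral>\<^sup>+z. (g z)\<^sup>2 \<partial>lborel)"
    using B(2) by (intro mult_right_mono ennreal_leI) auto
  finally show ?thesis .
qed

end

section \<open>The fractional Poisson kernel\<close>

text \<open>Homogeneous of degree one under (x, t) -> (c x, c^2 t) for c > 0, the dilations that
  relate the kernels of different heights; its balls have volume of order r^(n + 2).\<close>

definition pn :: "(real ^ 'n) \<times> real \<Rightarrow> real" where
  "pn w = norm (fst w) + sqrt \<bar>snd w\<bar>"

lemma pn_measurable [measurable]: "pn \<in> borel_measurable borel"
  unfolding pn_def by (intro borel_measurable_continuous_onI continuous_intros)

lemma pn_nonneg [simp]: "0 \<le> pn w"
  unfolding pn_def by simp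

lemma pn_minus [simp]: "pn (- w) = pn w"
  unfolding pn_def by simp

lemma pn_triangle: "pn (u + w) \<le> pn u + pn w"
proof -
  have "\<bar>snd u + snd w\<bar> \<le> (sqrt \<bar>snd u\<bar> + sqrt \<bar>snd w\<bar>)\<^sup>2"
    by (simp add: power2_sum) (smt (verit) mult_nonneg_nonneg real_sqrt_ge_zero abs_ge_zero)
  then have "sqrt \<bar>snd u + snd w\<bar> \<le> sqrt \<bar>snd u\<bar> + sqrt \<bar>snd w\<bar>"
    by (intro real_le_lsqrt) auto
  then show ?thesis
    unfolding pn_def using norm_triangle_ineq[of "fst u" "fst w"] by simp
qed

lemma pn_diff: "pn (z - w) \<le> pn z + pn w"
  using pn_triangle[of z "- w"] by simp

lemma pn_le_diff: "pn z \<le> pn (z - w) + pn w"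
  using pn_triangle[of "z - w" w] by simp

lemma nn_integral_powr_atLeast:
  assumes "0 < e" "0 < x"
  shows "(\<integral>\<^sup>+u. ennreal (u powr (- e - 1)) * indicator {x..} u \<partial>lborel) = ennreal (x powr (- e) / e)"
proof -
  have "(\<integral>\<^sup>+u. ennreal (u powr (- e - 1)) * indicator {x..} u \<partial>lborel) = ennreal (0 - (- (x powr (- e) / e)))"
  proof (rule nn_integral_FTC_atLeast)
    fix u assume u: "x \<le> u"
    show "DERIV (\<lambda>u. - (u powr (- e) / e)) u :> u powr (- e - 1)"
      using u assms by (auto intro!: derivative_eq_intros simp: powr_diff powr_minus field_simps)
    show "0 \<le> u powr (- e - 1)" by simp
  next
    show "((\<lambda>u. - (u powr (- e) / e)) \<longlongrightarrow> 0) at_top"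
    proof -
      have "((\<lambda>u. - (u powr (- e) / e)) \<longlongrightarrow> - (0 / e)) at_top"
        by (intro tendsto_intros tendsto_neg_powr filterlim_ident) (use assms in auto)
      then show ?thesis by simp
    qed
  qed simp
  then show ?thesis by simp
qed

lemma emeasure_pn_le:
  assumes "0 \<le> r"
  shows "emeasure lborel {w :: (real ^ 'n) \<times> real. pn w \<le> r}
    \<le> ennreal (2 * unit_ball_vol (real CARD('n)) * r ^ (CARD('n) + 2))"
proof -
  have "{w :: (real ^ 'n) \<times> real. pn w \<le> r} \<subseteq> cball 0 r \<times> {- (r\<^sup>2)..r\<^sup>2}"
  proof
    fix w :: "(real ^ 'n) \<times> real" assume "w \<in> {w. pn w \<le> r}"
    then have "norm (fst w) + sqrt \<bar>snd w\<bar> \<le> r" by (simp add: pn_def)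
    then have "norm (fst w) \<le> r" "sqrt \<bar>snd w\<bar> \<le> r" by (smt (verit) norm_ge_zero real_sqrt_ge_zero abs_ge_zero)+
    then have "norm (fst w) \<le> r" "\<bar>snd w\<bar> \<le> r\<^sup>2" using sqrt_le_D by auto
    then show "w \<in> cball 0 r \<times> {- (r\<^sup>2)..r\<^sup>2}" by (cases w) (auto simp: abs_le_iff)
  qed
  then have "emeasure lborel {w :: (real ^ 'n) \<times> real. pn w \<le> r}
      \<le> emeasure lborel ((cball 0 r :: (real ^ 'n) set) \<times> {- (r\<^sup>2)..r\<^sup>2})"
    by (intro emeasure_mono) (auto intro!: borel_closed closed_Times)
  also have "\<dots> = emeasure lborel (cball 0 r :: (real ^ 'n) set) * emeasure lborel {- (r\<^sup>2)..r\<^sup>2}"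
    unfolding lborel_prod[symmetric] by (rule lborel.emeasure_pair_measure_Times) auto
  also have "\<dots> = ennreal (2 * unit_ball_vol (real CARD('n)) * r ^ (CARD('n) + 2))"
    using assms by (simp add: emeasure_cball ennreal_mult[symmetric] power_add power2_eq_square algebra_simps)
  finally show ?thesis .
qed

text \<open>Layer-cake formula: the power is the integral of m u^(-m - 1) over u \<ge> \<tau> + pn
  w. Interchanging the integrals leaves the volume of a gauge ball, and m > n + 2 makes the
  remaining integral in u converge.\<close>

lemma nn_integral_pn_powr:
  assumes m: "real CARD('n) + 2 < m"
  obtains C where "0 < C" "\<And>\<tau>. 0 < \<tau> \<Longrightarrow>
    (\<integral>\<^sup>+(w :: (real ^ 'n) \<times> real). ennreal ((\<tau> + pn w) powr (- m)) \<partial>lborel) \<le> ennreal (C * \<tau> powr (real CARD('n) + 2 - m))"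
proof -
  define k where "k = real CARD('n) + 2"
  define V where "V = 2 * unit_ball_vol (real CARD('n))"
  have V: "0 < V" unfolding V_def by simp
  have km: "k < m" "0 < k" using m unfolding k_def by auto
  have "(\<integral>\<^sup>+(w :: (real ^ 'n) \<times> real). ennreal ((\<tau> + pn w) powr (- m)) \<partial>lborel) \<le> ennreal (m * V / (m - k) * \<tau> powr (k - m))"
    if \<tau>: "0 < \<tau>" for \<tau>
  proof -
    have "(\<integral>\<^sup>+(w :: (real ^ 'n) \<times> real). ennreal ((\<tau> + pn w) powr (- m)) \<partial>lborel) =
      (\<integral>\<^sup>+(w :: (real ^ 'n) \<times> real). (\<integral>\<^sup>+u. ennreal m * (ennreal (u powr (- m - 1)) * indicator {\<tau> + pn w..} u) \<partial>lborel) \<partial>lborel)"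
    proof (rule nn_integral_cong)
      fix w :: "(real ^ 'n) \<times> real"
      have "0 < \<tau> + pn w" using \<tau> pn_nonneg[of w] by linarith
      then show "ennreal ((\<tau> + pn w) powr (- m)) =
         (\<integral>\<^sup>+u. ennreal m * (ennreal (u powr (- m - 1)) * indicator {\<tau> + pn w..} u) \<partial>lborel)"
        using km by (subst nn_integral_cmult) (auto simp: nn_integral_powr_atLeast ennreal_mult[symmetric])
    qed
    also have "\<dots> = (\<integral>\<^sup>+u. (\<integral>\<^sup>+(w :: (real ^ 'n) \<times> real). ennreal m * (ennreal (u powr (- m - 1)) * indicator {\<tau> + pn w..} u) \<partial>lborel) \<partial>lborel)"
      by (rule lborel_pair.Fubini') (unfold indicator_def atLeast_iff split_beta, measurable)
    also have "\<dots> \<le> (\<integral>\<^sup>+u. ennreal (m * V) * (ennreal (u powr (- (m - k) - 1)) * indicator {\<tau>..} u) \<partial>lborel)"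
    proof (rule nn_integral_mono)
      fix u :: real
      have "(\<integral>\<^sup>+(w :: (real ^ 'n) \<times> real). ennreal m * (ennreal (u powr (- m - 1)) * indicator {\<tau> + pn w..} u) \<partial>lborel)
        = ennreal (m * u powr (- m - 1)) * (\<integral>\<^sup>+(w :: (real ^ 'n) \<times> real). indicator {w. pn w \<le> u - \<tau>} w \<partial>lborel)"
        using km by (subst nn_integral_cmult[symmetric])
          (auto intro!: nn_integral_cong simp: ennreal_mult[symmetric] mult.assoc[symmetric] indicator_def)
      also have "\<dots> = ennreal (m * u powr (- m - 1)) * emeasure lborel {w :: (real ^ 'n) \<times> real. pn w \<le> u - \<tau>}"
        by (subst nn_integral_indicator) auto
      also have "\<dots> \<le> ennreal (m * V) * (ennreal (u powr (- (m - k) - 1)) * indicator {\<tau>..} u)"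
      proof (cases "\<tau> \<le> u")
        case True
        have "emeasure lborel {w :: (real ^ 'n) \<times> real. pn w \<le> u - \<tau>} \<le> ennreal (V * (u - \<tau>) ^ (CARD('n) + 2))"
          unfolding V_def by (rule emeasure_pn_le) (use True in simp)
        also have "\<dots> \<le> ennreal (V * u powr k)"
        proof (intro ennreal_leI mult_left_mono)
          have "(u - \<tau>) ^ (CARD('n) + 2) \<le> u ^ (CARD('n) + 2)" using True \<tau> by (intro power_mono) auto
          also have "\<dots> = u powr k" using True \<tau> unfolding k_def by (subst powr_realpow[symmetric]) (auto simp: add.commute)
          finally show "(u - \<tau>) ^ (CARD('n) + 2) \<le> u powr k" .
        qed (use V in simp)
        finally have "ennreal (m * u powr (- m - 1)) * emeasure lborel {w :: (real ^ 'n) \<times> real. pn w \<le> u - \<tau>} \<le>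
           ennreal (m * u powr (- m - 1)) * ennreal (V * u powr k)" by (rule mult_left_mono) simp
        also have "\<dots> = ennreal (m * V * (u powr (- m - 1) * u powr k))"
          using km V by (simp add: ennreal_mult[symmetric] algebra_simps)
        also have "u powr (- m - 1) * u powr k = u powr (- (m - k) - 1)"
          by (subst powr_add[symmetric]) (simp add: algebra_simps)
        finally show ?thesis using True km V by (simp add: ennreal_mult)
      next
        case False
        then have "{w :: (real ^ 'n) \<times> real. pn w \<le> u - \<tau>} = {}"
          by (auto simp: not_le intro!: less_le_trans[OF _ pn_nonneg])
        then show ?thesis by (simp only: emeasure_empty mult_zero_right zero_le)
      qed
      finally show "(\<integral>\<^sup>+(w :: (real ^ 'n) \<times> real). ennreal m * (ennreal (u powr (- m - 1)) * indicator {\<tau> + pn w..} u) \<partial>lborel)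
        \<le> ennreal (m * V) * (ennreal (u powr (- (m - k) - 1)) * indicator {\<tau>..} u)" .
    qed
    also have "\<dots> = ennreal (m * V) * (\<integral>\<^sup>+u. ennreal (u powr (- (m - k) - 1)) * indicator {\<tau>..} u \<partial>lborel)"
      by (rule nn_integral_cmult) measurable
    also have "\<dots> = ennreal (m * V) * ennreal (\<tau> powr (- (m - k)) / (m - k))"
      using km \<tau> by (subst nn_integral_powr_atLeast) auto
    also have "\<dots> = ennreal (m * V / (m - k) * \<tau> powr (k - m))"
      using km V by (simp add: ennreal_mult[symmetric])
    finally show ?thesis .
  qed
  moreover have "0 < m * V / (m - k)" using km V by simp
  ultimately show ?thesis using that unfolding k_def by blast
qed

section \<open>The heat profile: decay and Hoelder continuity\<close>

text \<open>The unnormalised heat kernel, damped by exp (- \<tau>^2 / (4 s)) and weighted by a power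
  of time. The exponent \<open>b\<close> stays free because derivatives of \<open>E \<tau> b\<close>
  are expressed by the profiles with \<open>b + 1\<close> and \<open>b + 2\<close>.\<close>

definition E :: "real \<Rightarrow> real \<Rightarrow> (real ^ 'n) \<times> real \<Rightarrow> real" where
  "E \<tau> b w = (if 0 < snd w then exp (- (\<tau>\<^sup>2 + (norm (fst w))\<^sup>2) / (4 * snd w)) * snd w powr (- b) else 0)"

lemma E_measurable [measurable]: "E \<tau> b \<in> borel_measurable borel"
  unfolding E_def borel_prod[symmetric] by measurable

lemma E_nonneg [simp]: "0 \<le> E \<tau> b w"
  unfolding E_def by simp

lemma E_shift: "0 < s \<Longrightarrow> E \<tau> b (y, s) = s * E \<tau> (b + 1) (y, s)"
  unfolding E_def by (simp add: powr_diff powr_minus field_simps)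

text \<open>With x = (\<tau>^2 + |y|^2) / s the claim says that exp (x / 4) dominates (1 + x)^b up
  to a constant. \<open>N\<close> is chosen to give 1 + x \<le> N exp (x / (4 b)), and the power
  \<open>b\<close> of this is what is wanted.\<close>

lemma E_le:
  assumes b: "0 < b"
  obtains C where "0 < C" "\<And>\<tau> w. 0 < \<tau> \<Longrightarrow> E \<tau> b w \<le> C * (\<tau> + pn w) powr (- (2 * b))"
proof -
  define N where "N = max 1 (4 * b)"
  have N: "1 \<le> N" "4 * b \<le> N" unfolding N_def by auto
  have "E \<tau> b w \<le> (3 * N) powr b * (\<tau> + pn w) powr (- (2 * b))" if \<tau>: "0 < \<tau>" for \<tau> w
  proof (cases "0 < snd w")
    case True
    define s where "s = snd w"
    define Q where "Q = \<tau>\<^sup>2 + (norm (fst w))\<^sup>2"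
    define P where "P = \<tau> + pn w"
    have s: "0 < s" and Q: "0 < Q" and P: "0 < P"
      using True \<tau> unfolding s_def Q_def P_def by (auto simp: add_pos_nonneg)
    define x where "x = Q / s"
    have x: "0 < x" using s Q unfolding x_def by simp
    have sq: "(a + b + c)\<^sup>2 \<le> 3 * (a\<^sup>2 + b\<^sup>2 + c\<^sup>2)" for a b c :: real
      using zero_le_power2[of "a - b"] zero_le_power2[of "a - c"] zero_le_power2[of "b - c"]
      by (simp add: power2_eq_square algebra_simps)
    have "P\<^sup>2 \<le> 3 * (Q + s)"
      using sq[of \<tau> "norm (fst w)" "sqrt s"] s unfolding P_def Q_def pn_def s_def by (simp add: add.assoc)
    also have "\<dots> = 3 * s * (1 + x)" using s unfolding x_def by (simp add: field_simps)
    also have "\<dots> \<le> 3 * s * (N * exp (x / (4 * b)))"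
    proof (intro mult_left_mono)
      have "x = 4 * b * (x / (4 * b))" using b by simp
      also have "\<dots> \<le> N * (x / (4 * b))" using N x b by (intro mult_right_mono) auto
      finally have "1 + x \<le> N * (1 + x / (4 * b))" using N(1) by (simp add: distrib_left)
      also have "\<dots> \<le> N * exp (x / (4 * b))" using N by (intro mult_left_mono exp_ge_add_one_self) auto
      finally show "1 + x \<le> N * exp (x / (4 * b))" .
    qed (use s in simp)
    finally have P2: "P\<^sup>2 \<le> 3 * s * (N * exp (x / (4 * b)))" .
    have "P powr (2 * b) = (P\<^sup>2) powr b" using P by (simp add: powr_powr flip: powr_numeral)
    also have "\<dots> \<le> (3 * s * (N * exp (x / (4 * b)))) powr b" using P2 b by (intro powr_mono2) auto
    also have "\<dots> = (3 * N) powr b * s powr b * exp (x / 4)"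
      using s N b by (simp add: powr_mult exp_powr_real mult_ac)
    finally have *: "P powr (2 * b) \<le> (3 * N) powr b * s powr b * exp (x / 4)" .
    have "E \<tau> b w = exp (- (x / 4)) * s powr (- b)"
      using True unfolding E_def x_def Q_def s_def by (simp add: field_simps)
    also have "\<dots> = 1 / (s powr b * exp (x / 4))" by (simp add: exp_minus powr_minus field_simps)
    also have "\<dots> \<le> (3 * N) powr b / P powr (2 * b)"
      using * s P by (simp add: field_simps)
    finally show ?thesis unfolding P_def by (simp add: powr_minus field_simps)
  qed (simp add: E_def)
  moreover have "0 < (3 * N) powr b" using N by simp
  ultimately show ?thesis using that by blast
qed

lemma powr_half_le:
  fixes R P e :: real
  assumes "0 < R" "R / 2 \<le> P" "0 \<le> e"
  shows "P powr (- e) \<le> 2 powr e * R powr (- e)"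
proof -
  have "P powr (- e) \<le> (R / 2) powr (- e)" using assms by (intro powr_mono2') auto
  also have "\<dots> = 2 powr e * R powr (- e)" using assms by (simp add: powr_divide powr_minus field_simps)
  finally show ?thesis .
qed

text \<open>Mean value theorem along the segment: a spatial derivative multiplies the profile by a
  component of y / s, and the division by s raises \<open>b\<close> by one, so in total one power of
  the gauge is gained. The hypothesis keeps the whole segment away from the origin at scale
  \<open>R\<close>.\<close>

lemma E_space_step:
  assumes b: "0 < b"
  obtains C where "0 < C" "\<And>\<tau> R (y :: real ^ 'n) s h. 0 < \<tau> \<Longrightarrow> 0 < R \<Longrightarrow>
    (\<And>\<theta>. 0 \<le> \<theta> \<Longrightarrow> \<theta> \<le> 1 \<Longrightarrow> R / 2 \<le> \<tau> + pn (y - \<theta> *\<^sub>R h, s)) \<Longrightarrow>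
    \<bar>E \<tau> b (y - h, s) - E \<tau> b (y, s)\<bar> \<le> C * norm h * R powr (- (2 * b + 1))"
proof -
  obtain C where C: "0 < C" "\<And>\<tau> w :: (real^'n) \<times> real. 0 < \<tau> \<Longrightarrow> E \<tau> (b + 1) w \<le> C * (\<tau> + pn w) powr (- (2 * (b + 1)))"
    using E_le[of "b + 1"] b by auto
  have main: "\<bar>E \<tau> b (y - h, s) - E \<tau> b (y, s)\<bar> \<le> (C * 2 powr (2 * b + 1)) * norm h * R powr (- (2 * b + 1))"
    if \<tau>: "0 < \<tau>" and R: "0 < R" and seg: "\<And>\<theta>. 0 \<le> \<theta> \<Longrightarrow> \<theta> \<le> 1 \<Longrightarrow> R / 2 \<le> \<tau> + pn (y - \<theta> *\<^sub>R h, s)"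
    for \<tau> R s and y h :: "real ^ 'n"
  proof (cases "0 < s")
    case True
    define \<phi> where "\<phi> \<theta> = exp (- (\<tau>\<^sup>2 + (y \<bullet> y - 2 * \<theta> * (y \<bullet> h) + \<theta>\<^sup>2 * (h \<bullet> h))) / (4 * s)) * s powr (- b)" for \<theta>
    have \<phi>: "E \<tau> b (y - \<theta> *\<^sub>R h, s) = \<phi> \<theta>" for \<theta>
      using True unfolding E_def \<phi>_def power2_norm_eq_inner
      by (simp add: inner_diff_left inner_diff_right inner_commute power2_eq_square algebra_simps)
    have der: "DERIV \<phi> \<theta> :> ((y - \<theta> *\<^sub>R h) \<bullet> h) / (2 * s) * \<phi> \<theta>" for \<theta>
      unfolding \<phi>_def using True
      by (auto intro!: derivative_eq_intros simp: inner_diff_left field_simps)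
    obtain \<theta> where \<theta>: "0 < \<theta>" "\<theta> < 1" "\<phi> 1 - \<phi> 0 = (1 - 0) * (((y - \<theta> *\<^sub>R h) \<bullet> h) / (2 * s) * \<phi> \<theta>)"
      using MVT2[of 0 1 \<phi> "\<lambda>\<theta>. ((y - \<theta> *\<^sub>R h) \<bullet> h) / (2 * s) * \<phi> \<theta>"] der by auto
    define P where "P = \<tau> + pn (y - \<theta> *\<^sub>R h, s)"
    have P: "R / 2 \<le> P" unfolding P_def using seg \<theta> by auto
    have P0: "0 < P" using P R by linarith
    have nP: "norm (y - \<theta> *\<^sub>R h) \<le> P" unfolding P_def pn_def using \<tau> by simp
    have e: "\<phi> \<theta> = s * E \<tau> (b + 1) (y - \<theta> *\<^sub>R h, s)"
      using \<phi>[of \<theta>] E_shift[OF True, of \<tau> b "y - \<theta> *\<^sub>R h"] by simp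
    have "\<bar>E \<tau> b (y - h, s) - E \<tau> b (y, s)\<bar> = \<bar>\<phi> 1 - \<phi> 0\<bar>"
      using \<phi>[of 1] \<phi>[of 0] by simp
    also have "\<bar>\<phi> 1 - \<phi> 0\<bar> = \<bar>(y - \<theta> *\<^sub>R h) \<bullet> h\<bar> / 2 * E \<tau> (b + 1) (y - \<theta> *\<^sub>R h, s)"
      unfolding \<theta>(3) using True by (simp add: e abs_mult)
    also have "\<dots> \<le> (P * norm h) * (C * P powr (- (2 * (b + 1))))"
    proof (intro mult_mono)
      have "\<bar>(y - \<theta> *\<^sub>R h) \<bullet> h\<bar> \<le> norm (y - \<theta> *\<^sub>R h) * norm h" by (rule Cauchy_Schwarz_ineq2)
      also have "\<dots> \<le> P * norm h" using nP by (intro mult_right_mono) auto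
      finally show "\<bar>(y - \<theta> *\<^sub>R h) \<bullet> h\<bar> / 2 \<le> P * norm h" by linarith
      show "E \<tau> (b + 1) (y - \<theta> *\<^sub>R h, s) \<le> C * P powr (- (2 * (b + 1)))"
        unfolding P_def by (rule C(2)[OF \<tau>])
    qed (use P0 in auto)
    also have "\<dots> = C * norm h * (P powr 1 * P powr (- (2 * (b + 1))))" using P0 by simp
    also have "P powr 1 * P powr (- (2 * (b + 1))) = P powr (- (2 * b + 1))"
      by (subst powr_add[symmetric]) (simp add: algebra_simps)
    also have "C * norm h * P powr (- (2 * b + 1)) \<le> C * norm h * (2 powr (2 * b + 1) * R powr (- (2 * b + 1)))"
      using C R P b by (intro mult_left_mono powr_half_le) auto
    finally show ?thesis by (simp add: algebra_simps)
  qed (use C in \<open>simp add: E_def\<close>)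
  have pos: "0 < C * 2 powr (2 * b + 1)" using C by simp
  show ?thesis by (rule that[OF pos main])
qed

text \<open>For positive times this is the mean value theorem: both terms of the time derivative
  gain two powers of the gauge, since \<tau>^2 + |y|^2 is at most the square of \<tau> + pn. At
  nonpositive times the profile vanishes, so an interval containing time 0 needs its own
  argument.\<close>

lemma E_time_step:
  assumes b: "0 < b"
  obtains C where "0 < C" "\<And>\<tau> R (y :: real ^ 'n) lo hi. 0 < \<tau> \<Longrightarrow> 0 < R \<Longrightarrow> lo \<le> hi \<Longrightarrow>
    (\<And>\<xi>. lo \<le> \<xi> \<Longrightarrow> \<xi> \<le> hi \<Longrightarrow> R / 2 \<le> \<tau> + pn (y, \<xi>)) \<Longrightarrow>
    \<bar>E \<tau> b (y, hi) - E \<tau> b (y, lo)\<bar> \<le> C * (hi - lo) * R powr (- (2 * b + 2))"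
proof -
  obtain C1 where C1: "0 < C1" "\<And>\<tau> w :: (real^'n) \<times> real. 0 < \<tau> \<Longrightarrow> E \<tau> (b + 1) w \<le> C1 * (\<tau> + pn w) powr (- (2 * (b + 1)))"
    using E_le[of "b + 1"] b by auto
  obtain C2 where C2: "0 < C2" "\<And>\<tau> w :: (real^'n) \<times> real. 0 < \<tau> \<Longrightarrow> E \<tau> (b + 2) w \<le> C2 * (\<tau> + pn w) powr (- (2 * (b + 2)))"
    using E_le[of "b + 2"] b by auto
  define C where "C = C2 + (b + 1) * C1"
  have C: "0 < C" unfolding C_def using C1 C2 b by (intro add_pos_pos mult_pos_pos) auto
  have main: "\<bar>E \<tau> b (y, hi) - E \<tau> b (y, lo)\<bar> \<le> (C * 2 powr (2 * b + 2)) * (hi - lo) * R powr (- (2 * b + 2))"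
    if \<tau>: "0 < \<tau>" and R: "0 < R" and lohi: "lo \<le> hi" and seg: "\<And>\<xi>. lo \<le> \<xi> \<Longrightarrow> \<xi> \<le> hi \<Longrightarrow> R / 2 \<le> \<tau> + pn (y, \<xi>)"
    for \<tau> R lo hi and y :: "real ^ 'n"
  proof -
    have fin: "\<bar>E \<tau> b (y, hi) - E \<tau> b (y, lo)\<bar> \<le> (C * 2 powr (2 * b + 2)) * (hi - lo) * R powr (- (2 * b + 2))"
      if \<xi>: "lo \<le> \<xi>" "\<xi> \<le> hi"
        and le: "\<bar>E \<tau> b (y, hi) - E \<tau> b (y, lo)\<bar> \<le> (hi - lo) * (C * (\<tau> + pn (y, \<xi>)) powr (- (2 * b + 2)))" for \<xi>
    proof -
      have "(\<tau> + pn (y, \<xi>)) powr (- (2 * b + 2)) \<le> 2 powr (2 * b + 2) * R powr (- (2 * b + 2))"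
        using R seg[OF \<xi>] b by (intro powr_half_le) auto
      then have "(hi - lo) * (C * (\<tau> + pn (y, \<xi>)) powr (- (2 * b + 2))) \<le> (hi - lo) * (C * (2 powr (2 * b + 2) * R powr (- (2 * b + 2))))"
        using lohi C by (intro mult_left_mono) auto
      with le show ?thesis by (simp add: algebra_simps)
    qed
    consider "hi \<le> 0" | "lo \<le> 0" "0 < hi" | "0 < lo" using lohi by linarith
    then show ?thesis
    proof cases
      case 1
      then have "E \<tau> b (y, hi) = 0" "E \<tau> b (y, lo) = 0" using lohi by (auto simp: E_def)
      then show ?thesis using C lohi by simp
    next
      \<comment> \<open>The value at \<open>lo\<close> is 0 and \<open>hi\<close> \<le>
        \<open>hi - lo\<close>, so the factor \<open>hi\<close> produced by \<open>E_shift\<close>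
        already plays the role of the time increment.\<close>
      case 2
      show ?thesis
      proof (rule fin[of hi])
        have "\<bar>E \<tau> b (y, hi) - E \<tau> b (y, lo)\<bar> = hi * E \<tau> (b + 1) (y, hi)"
          using 2 E_shift[of hi \<tau> b y] by (simp add: E_def[of _ _ "(y, lo)"])
        also have "\<dots> \<le> (hi - lo) * (C * (\<tau> + pn (y, hi)) powr (- (2 * (b + 1))))"
        proof (intro mult_mono)
          have "E \<tau> (b + 1) (y, hi) \<le> C1 * (\<tau> + pn (y, hi)) powr (- (2 * (b + 1)))" by (rule C1(2)[OF \<tau>])
          also have "\<dots> \<le> C * (\<tau> + pn (y, hi)) powr (- (2 * (b + 1)))"
            unfolding C_def using C1 C2 b by (intro mult_right_mono) (auto simp: algebra_simps)
          finally show "E \<tau> (b + 1) (y, hi) \<le> C * (\<tau> + pn (y, hi)) powr (- (2 * (b + 1)))" .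
        qed (use 2 in auto)
        finally show "\<bar>E \<tau> b (y, hi) - E \<tau> b (y, lo)\<bar> \<le> (hi - lo) * (C * (\<tau> + pn (y, hi)) powr (- (2 * b + 2)))"
          by (simp add: algebra_simps)
      qed (use lohi in auto)
    next
      case 3
      show ?thesis
      proof (cases "lo = hi")
        case False
        define Q where "Q = \<tau>\<^sup>2 + (norm y)\<^sup>2"
        define \<phi> where "\<phi> s = exp (- Q / (4 * s)) * s powr (- b)" for s
        define \<phi>' where "\<phi>' s = Q / 4 * (exp (- Q / (4 * s)) * s powr (- (b + 2))) - b * (exp (- Q / (4 * s)) * s powr (- (b + 1)))" for s
        have der: "DERIV \<phi> s :> \<phi>' s" if "0 < s" for s
        proof -
          have e: "s powr (- b - 1) = s powr (- b) / s" "s powr (- (b + 2)) = s powr (- b) / s\<^sup>2" "s powr (- (b + 1)) = s powr (- b) / s"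
            using that by (simp_all add: powr_diff powr_add powr_minus power2_eq_square field_simps)
          show ?thesis
            unfolding \<phi>_def \<phi>'_def e using that
            by (auto intro!: derivative_eq_intros simp: e power2_eq_square field_simps)
        qed
        obtain \<xi> where \<xi>: "lo < \<xi>" "\<xi> < hi" "\<phi> hi - \<phi> lo = (hi - lo) * \<phi>' \<xi>"
          using MVT2[of lo hi \<phi> \<phi>'] der 3 False lohi by force
        define P where "P = \<tau> + pn (y, \<xi>)"
        have P0: "0 < P" unfolding P_def using \<tau> by (simp add: add_pos_nonneg)
        have QP: "Q \<le> P\<^sup>2"
        proof -
          have "Q \<le> (\<tau> + norm y)\<^sup>2" unfolding Q_def using \<tau> by (simp add: power2_sum)
          also have "\<dots> \<le> P\<^sup>2" unfolding P_def pn_def using \<tau> by (intro power_mono) auto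
          finally show ?thesis .
        qed
        have Q0: "0 \<le> Q" unfolding Q_def by simp
        have "\<phi>' \<xi> = Q / 4 * E \<tau> (b + 2) (y, \<xi>) - b * E \<tau> (b + 1) (y, \<xi>)"
          using \<xi> 3 unfolding \<phi>'_def E_def Q_def by simp
        then have "\<bar>\<phi>' \<xi>\<bar> \<le> \<bar>Q / 4 * E \<tau> (b + 2) (y, \<xi>)\<bar> + \<bar>b * E \<tau> (b + 1) (y, \<xi>)\<bar>"
          by (simp only: abs_triangle_ineq4)
        also have "\<dots> \<le> P\<^sup>2 * (C2 * P powr (- (2 * (b + 2)))) + (b + 1) * (C1 * P powr (- (2 * (b + 1))))"
        proof (rule add_mono)
          show "\<bar>Q / 4 * E \<tau> (b + 2) (y, \<xi>)\<bar> \<le> P\<^sup>2 * (C2 * P powr (- (2 * (b + 2))))"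
            using mult_mono[of "Q / 4" "P\<^sup>2" "E \<tau> (b + 2) (y, \<xi>)"] C2(2)[OF \<tau>, of "(y, \<xi>)"] QP Q0
            unfolding P_def[symmetric] by (simp add: abs_mult)
          show "\<bar>b * E \<tau> (b + 1) (y, \<xi>)\<bar> \<le> (b + 1) * (C1 * P powr (- (2 * (b + 1))))"
            using mult_mono[of b "b + 1" "E \<tau> (b + 1) (y, \<xi>)"] C1(2)[OF \<tau>, of "(y, \<xi>)"] b
            unfolding P_def[symmetric] by (simp add: abs_mult)
        qed
        also have "P\<^sup>2 * (C2 * P powr (- (2 * (b + 2)))) = C2 * P powr (- (2 * b + 2))"
        proof -
          have "P\<^sup>2 * P powr (- (2 * (b + 2))) = P powr 2 * P powr (- (2 * (b + 2)))" using P0 by simp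
          also have "\<dots> = P powr (- (2 * b + 2))" by (subst powr_add[symmetric]) (simp add: algebra_simps)
          finally show ?thesis by (simp add: algebra_simps)
        qed
        finally have "\<bar>\<phi>' \<xi>\<bar> \<le> C * P powr (- (2 * b + 2))"
          unfolding C_def by (simp add: algebra_simps)
        moreover have "\<bar>E \<tau> b (y, hi) - E \<tau> b (y, lo)\<bar> = \<bar>(hi - lo) * \<phi>' \<xi>\<bar>"
          using 3 lohi \<xi>(3) unfolding E_def \<phi>_def Q_def by simp
        ultimately have "\<bar>E \<tau> b (y, hi) - E \<tau> b (y, lo)\<bar> \<le> (hi - lo) * (C * (\<tau> + pn (y, \<xi>)) powr (- (2 * b + 2)))"
          using lohi unfolding P_def[symmetric] by (simp add: abs_mult mult_left_mono)
        then show ?thesis using \<xi> by (intro fin[of \<xi>]) auto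
      qed simp
    qed
  qed
  have pos: "0 < C * 2 powr (2 * b + 2)" using C by simp
  show ?thesis by (rule that[OF pos main])
qed

text \<open>If \<open>pn w\<close> is at most half of R = \<tau> + pn z, the Lipschitz bounds apply
  and the quotient pn w / R \<le> 1 may be raised to the smaller power \<delta>. Otherwise both
  values are estimated separately, which is why both base points occur on the right.\<close>

lemma E_hoelder:
  assumes b: "0 < b" and \<delta>: "0 < \<delta>" "\<delta> \<le> 1"
  obtains C where "0 < C" "\<And>\<tau> z w :: (real ^ 'n) \<times> real. 0 < \<tau> \<Longrightarrow>
    \<bar>E \<tau> b (z - w) - E \<tau> b z\<bar> \<le> C * pn w powr \<delta> *
      ((\<tau> + pn z) powr (- (2 * b + \<delta>)) + (\<tau> + pn (z - w)) powr (- (2 * b + \<delta>)))"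
proof -
  obtain C0 where C0: "0 < C0" "\<And>\<tau> w :: (real^'n) \<times> real. 0 < \<tau> \<Longrightarrow> E \<tau> b w \<le> C0 * (\<tau> + pn w) powr (- (2 * b))"
    using E_le[OF b] by auto
  obtain C1 where C1: "0 < C1" "\<And>\<tau> R (y :: real ^ 'n) s h. 0 < \<tau> \<Longrightarrow> 0 < R \<Longrightarrow>
    (\<And>\<theta>. 0 \<le> \<theta> \<Longrightarrow> \<theta> \<le> 1 \<Longrightarrow> R / 2 \<le> \<tau> + pn (y - \<theta> *\<^sub>R h, s)) \<Longrightarrow>
    \<bar>E \<tau> b (y - h, s) - E \<tau> b (y, s)\<bar> \<le> C1 * norm h * R powr (- (2 * b + 1))"
    using E_space_step[OF b] by metis
  obtain C2 where C2: "0 < C2" "\<And>\<tau> R (y :: real ^ 'n) lo hi. 0 < \<tau> \<Longrightarrow> 0 < R \<Longrightarrow> lo \<le> hi \<Longrightarrow>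
    (\<And>\<xi>. lo \<le> \<xi> \<Longrightarrow> \<xi> \<le> hi \<Longrightarrow> R / 2 \<le> \<tau> + pn (y, \<xi>)) \<Longrightarrow>
    \<bar>E \<tau> b (y, hi) - E \<tau> b (y, lo)\<bar> \<le> C2 * (hi - lo) * R powr (- (2 * b + 2))"
    using E_time_step[OF b] by metis
  define C where "C = C1 + C2 + 3 * C0"
  have main: "\<bar>E \<tau> b (z - w) - E \<tau> b z\<bar> \<le> C * pn w powr \<delta> *
      ((\<tau> + pn z) powr (- (2 * b + \<delta>)) + (\<tau> + pn (z - w)) powr (- (2 * b + \<delta>)))"
    if \<tau>: "0 < \<tau>" for \<tau> and z w :: "(real ^ 'n) \<times> real"
  proof -
    define R where "R = \<tau> + pn z"
    define R' where "R' = \<tau> + pn (z - w)"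
    have R: "0 < R" "0 < R'" unfolding R_def R'_def using \<tau> by (auto simp: add_pos_nonneg)
    show ?thesis
    proof (cases "pn w \<le> R / 2")
      case True
      obtain y s h u where zw: "z = (y, s)" "w = (h, u)" by (cases z, cases w) auto
      have seg: "R / 2 \<le> \<tau> + pn (z - w')" if "pn w' \<le> pn w" for w'
        using pn_le_diff[of z w'] that True \<tau> unfolding R_def by (simp add: field_simps)
      have 1: "\<bar>E \<tau> b (y - h, s - u) - E \<tau> b (y, s - u)\<bar> \<le> C1 * norm h * R powr (- (2 * b + 1))"
      proof (rule C1(2)[OF \<tau> R(1)])
        fix \<theta> :: real assume "0 \<le> \<theta>" "\<theta> \<le> 1"
        then show "R / 2 \<le> \<tau> + pn (y - \<theta> *\<^sub>R h, s - u)"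
          using seg[of "(\<theta> *\<^sub>R h, u)"] zw by (simp add: pn_def mult_left_le_one_le)
      qed
      have 2: "\<bar>E \<tau> b (y, s - u) - E \<tau> b (y, s)\<bar> \<le> C2 * \<bar>u\<bar> * R powr (- (2 * b + 2))"
      proof -
        have seg2: "R / 2 \<le> \<tau> + pn (y, \<xi>)" if "\<bar>s - \<xi>\<bar> \<le> \<bar>u\<bar>" for \<xi>
          using seg[of "(0, s - \<xi>)"] zw that by (simp add: pn_def add_increasing)
        show ?thesis
        proof (cases "0 \<le> u")
          case True
          show ?thesis using C2(2)[OF \<tau> R(1), of "s - u" s y] seg2 True by (simp add: abs_minus_commute)
        next
          case False
          show ?thesis using C2(2)[OF \<tau> R(1), of s "s - u" y] seg2 False by (simp add: abs_minus_commute)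
        qed
      qed
      have h: "norm h \<le> pn w" unfolding zw pn_def by simp
      \<comment> \<open>A time increment is quadratic in the gauge; one of the two factors
        \<open>pn w\<close> is given up for \<open>R\<close>, so that time and space steps have the
        same form.\<close>
      have "\<bar>u\<bar> = (sqrt \<bar>u\<bar>)\<^sup>2" by simp
      also have "\<dots> \<le> (pn w)\<^sup>2" unfolding zw pn_def by (intro power_mono) auto
      also have "\<dots> \<le> pn w * R" unfolding power2_eq_square using True R by (intro mult_left_mono) auto
      finally have u: "\<bar>u\<bar> \<le> pn w * R" .
      have "\<bar>E \<tau> b (z - w) - E \<tau> b z\<bar> \<le> C1 * norm h * R powr (- (2 * b + 1)) + C2 * \<bar>u\<bar> * R powr (- (2 * b + 2))"
        using 1 2 unfolding zw by simp
      also have "\<dots> \<le> C1 * pn w * R powr (- (2 * b + 1)) + C2 * (pn w * R) * R powr (- (2 * b + 2))"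
        using h u C1(1) C2(1) by (intro add_mono mult_right_mono mult_left_mono) auto
      also have "C2 * (pn w * R) * R powr (- (2 * b + 2)) = C2 * pn w * (R powr 1 * R powr (- (2 * b + 2)))"
        using R by simp
      also have "R powr 1 * R powr (- (2 * b + 2)) = R powr (- (2 * b + 1))"
        by (subst powr_add[symmetric]) (simp add: algebra_simps)
      also have "C1 * pn w * R powr (- (2 * b + 1)) + C2 * pn w * R powr (- (2 * b + 1)) =
          (C1 + C2) * (pn w * R powr (- (2 * b + 1)))" by (simp add: algebra_simps)
      also have "\<dots> \<le> C * (pn w powr \<delta> * R powr (- (2 * b + \<delta>)))"
      proof (rule mult_mono)
        show "pn w * R powr (- (2 * b + 1)) \<le> pn w powr \<delta> * R powr (- (2 * b + \<delta>))"
        proof (cases "pn w = 0")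
          case False
          then have p: "0 < pn w" using pn_nonneg[of w] by linarith
          have "pn w * R powr (- (2 * b + 1)) = pn w powr \<delta> * (pn w powr (1 - \<delta>) * R powr (- (2 * b + 1)))"
            using p by (simp add: powr_diff)
          also have "\<dots> \<le> pn w powr \<delta> * (R powr (1 - \<delta>) * R powr (- (2 * b + 1)))"
            using p R True \<delta> by (intro mult_left_mono mult_right_mono powr_mono2) auto
          also have "R powr (1 - \<delta>) * R powr (- (2 * b + 1)) = R powr (- (2 * b + \<delta>))"
            by (subst powr_add[symmetric]) (simp add: algebra_simps)
          finally show ?thesis .
        qed simp
      qed (use C0 C1 C2 in \<open>auto simp: C_def\<close>)
      also have "\<dots> \<le> C * pn w powr \<delta> * (R powr (- (2 * b + \<delta>)) + R' powr (- (2 * b + \<delta>)))"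
        using C0(1) C1(1) C2(1) unfolding C_def by (simp add: algebra_simps)
      finally show ?thesis unfolding R_def R'_def .
    next
      case False
      \<comment> \<open>In the far case both distances are at most 3 \<open>pn w\<close>, so the
        missing power \<delta> of decay can be inserted at the price of
        \<open>pn w powr \<delta>\<close>.\<close>
      have big: "P powr (- (2 * b)) \<le> 3 * (pn w powr \<delta> * P powr (- (2 * b + \<delta>)))" if "0 < P" "P \<le> 3 * pn w" for P
      proof -
        have "P powr \<delta> \<le> (3 * pn w) powr \<delta>" using that \<delta> by (intro powr_mono2) auto
        also have "\<dots> = 3 powr \<delta> * pn w powr \<delta>" by (simp add: powr_mult)
        also have "\<dots> \<le> 3 powr 1 * pn w powr \<delta>" using \<delta> by (intro mult_right_mono powr_mono) auto
        finally have "P powr \<delta> \<le> 3 * pn w powr \<delta>" by simp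
        then have "P powr \<delta> * P powr (- (2 * b + \<delta>)) \<le> 3 * pn w powr \<delta> * P powr (- (2 * b + \<delta>))"
          by (intro mult_right_mono) auto
        moreover have "P powr \<delta> * P powr (- (2 * b + \<delta>)) = P powr (- (2 * b))"
          by (subst powr_add[symmetric]) (simp add: algebra_simps)
        ultimately show ?thesis by (simp add: algebra_simps)
      qed
      have "R' \<le> R + pn w" unfolding R_def R'_def using pn_diff[of z w] by simp
      then have le: "R \<le> 3 * pn w" "R' \<le> 3 * pn w" using False R by auto
      have "\<bar>E \<tau> b (z - w) - E \<tau> b z\<bar> \<le> E \<tau> b (z - w) + E \<tau> b z"
        using E_nonneg[of \<tau> b "z - w"] E_nonneg[of \<tau> b z] by linarith
      also have "\<dots> \<le> C0 * R' powr (- (2 * b)) + C0 * R powr (- (2 * b))"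
        unfolding R_def R'_def by (intro add_mono C0(2) \<tau>)
      also have "\<dots> \<le> C0 * (3 * (pn w powr \<delta> * R' powr (- (2 * b + \<delta>)))) + C0 * (3 * (pn w powr \<delta> * R powr (- (2 * b + \<delta>))))"
        using C0(1) by (intro add_mono mult_left_mono big R le) auto
      also have "\<dots> = 3 * C0 * (pn w powr \<delta> * (R powr (- (2 * b + \<delta>)) + R' powr (- (2 * b + \<delta>))))"
        by (simp add: algebra_simps)
      also have "\<dots> \<le> C * (pn w powr \<delta> * (R powr (- (2 * b + \<delta>)) + R' powr (- (2 * b + \<delta>))))"
        using C1(1) C2(1) by (intro mult_right_mono) (auto simp: C_def)
      finally show ?thesis unfolding R_def R'_def by (simp add: algebra_simps)
    qed
  qed
  have "0 < C" unfolding C_def using C0 C1 C2 by simp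
  then show ?thesis by (rule that[OF _ main])
qed

lemma nn_integral_scaleR:
  fixes f :: "'a::euclidean_space \<Rightarrow> ennreal"
  assumes [measurable]: "f \<in> borel_measurable borel" and c: "0 < c"
  shows "(\<integral>\<^sup>+x. f x \<partial>lborel) = ennreal (c ^ DIM('a)) * (\<integral>\<^sup>+x. f (c *\<^sub>R x) \<partial>lborel)"
proof -
  have "(\<integral>\<^sup>+x. f x \<partial>lborel) = (\<integral>\<^sup>+x. f x \<partial>density (distr lborel borel (\<lambda>x. 0 + c *\<^sub>R x)) (\<lambda>_. \<bar>c\<bar> ^ DIM('a)))"
    using lborel_affine[of c "0 :: 'a"] c by simp
  also have "\<dots> = ennreal (c ^ DIM('a)) * (\<integral>\<^sup>+x. f (c *\<^sub>R x) \<partial>lborel)"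
    using c by (simp add: nn_integral_density nn_integral_distr nn_integral_cmult ennreal_power)
  finally show ?thesis .
qed

lemma nn_integral_parabolic_scale:
  fixes f :: "(real ^ 'n) \<times> real \<Rightarrow> ennreal"
  assumes [measurable]: "f \<in> borel_measurable borel" and c: "0 < c"
  shows "(\<integral>\<^sup>+x. f x \<partial>lborel) = ennreal (c ^ (CARD('n) + 2)) * (\<integral>\<^sup>+x. f (c *\<^sub>R fst x, c\<^sup>2 * snd x) \<partial>lborel)"
proof -
  have [measurable]: "f \<in> borel_measurable (borel \<Otimes>\<^sub>M borel)" by (simp add: borel_prod)
  have "(\<integral>\<^sup>+x. f x \<partial>lborel) = (\<integral>\<^sup>+y. (\<integral>\<^sup>+s. f (y, s) \<partial>lborel) \<partial>lborel)"
    unfolding lborel_prod[symmetric] by (rule lborel.nn_integral_fst[symmetric]) measurable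
  also have "\<dots> = (\<integral>\<^sup>+y. ennreal (c\<^sup>2) * (\<integral>\<^sup>+s. f (y, c\<^sup>2 * s) \<partial>lborel) \<partial>lborel)"
    using c by (intro nn_integral_cong, subst nn_integral_real_affine[where c="c\<^sup>2" and t=0]) auto
  also have "\<dots> = ennreal (c\<^sup>2) * (\<integral>\<^sup>+y. (\<integral>\<^sup>+s. f (y, c\<^sup>2 * s) \<partial>lborel) \<partial>lborel)"
    by (rule nn_integral_cmult) measurable
  also have "(\<integral>\<^sup>+y. (\<integral>\<^sup>+s. f (y, c\<^sup>2 * s) \<partial>lborel) \<partial>lborel) =
      ennreal (c ^ CARD('n)) * (\<integral>\<^sup>+y. (\<integral>\<^sup>+s. f (c *\<^sub>R y, c\<^sup>2 * s) \<partial>lborel) \<partial>lborel)"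
    using c by (subst nn_integral_scaleR[of _ c]) auto
  also have "(\<integral>\<^sup>+y. (\<integral>\<^sup>+s. f (c *\<^sub>R y, c\<^sup>2 * s) \<partial>lborel) \<partial>lborel) = (\<integral>\<^sup>+x. f (c *\<^sub>R fst x, c\<^sup>2 * snd x) \<partial>lborel)"
    unfolding lborel_prod[symmetric] by (subst lborel.nn_integral_fst[symmetric]) auto
  finally show ?thesis
    using c by (simp only: mult.assoc[symmetric] ennreal_mult[symmetric] power_add zero_le_power less_imp_le mult.commute)
qed

section \<open>The kernel: mass, moment, smoothness and an even majorant\<close>

text \<open>The space-time convolution kernel of \<open>frac_poisson\<close>: the exponent 1 +
  \<alpha> + n / 2 joins s^(-n/2) from the heat kernel with s^(-1-\<alpha>) from the subordination
  integral.\<close>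

definition kern :: "real \<Rightarrow> real \<Rightarrow> (real ^ 'n) \<times> real \<Rightarrow> real" where
  "kern \<alpha> \<tau> w = \<tau> powr (2 * \<alpha>) / (4 powr \<alpha> * Gamma \<alpha> * (4 * pi) powr (real CARD('n) / 2))
    * E \<tau> (1 + \<alpha> + real CARD('n) / 2) w"

text \<open>The size bound of \<open>kern\<close> given by \<open>E_le\<close>. Unlike the kernel it
  is even in time, as \<open>maximal_kernels\<close> requires, and its integral is bounded uniformly
  in \<tau>.\<close>

definition maj :: "real \<Rightarrow> real \<Rightarrow> (real ^ 'n) \<times> real \<Rightarrow> real" where
  "maj \<alpha> \<tau> w = \<tau> powr (2 * \<alpha>) * (\<tau> + pn w) powr (- (2 + 2 * \<alpha> + real CARD('n)))"

context
  fixes \<alpha> :: real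
  assumes \<alpha>: "0 < \<alpha>" "\<alpha> < 1"
begin

lemma kern_measurable [measurable]: "kern \<alpha> \<tau> \<in> borel_measurable borel"
  unfolding kern_def[abs_def] by measurable

lemma kern_const_pos: "0 < 1 / (4 powr \<alpha> * Gamma \<alpha> * (4 * pi) powr (real CARD('n) / 2))"
  using \<alpha> by (auto intro!: divide_pos_pos mult_pos_pos Gamma_real_pos)

lemma kern_nonneg [simp]: "0 \<le> kern \<alpha> \<tau> (w :: (real ^ 'n) \<times> real)"
  unfolding kern_def using kern_const_pos[where 'n='n] by (auto intro!: mult_nonneg_nonneg divide_nonneg_nonneg)

lemma maj_measurable [measurable]: "maj \<alpha> \<tau> \<in> borel_measurable borel"
  unfolding maj_def[abs_def] by measurable

lemma maj_nonneg [simp]: "0 \<le> maj \<alpha> \<tau> w"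
  unfolding maj_def by simp

lemma maj_minus [simp]: "maj \<alpha> \<tau> (- w) = maj \<alpha> \<tau> w"
  unfolding maj_def by simp

text \<open>Common source of the integral bounds: e = 0 gives the mass of \<open>maj\<close>, e =
  \<alpha> the moment, e = -\<alpha> the smoothness and e = -2 the mass at early times. The
  condition e < 2 \<alpha> is convergence at infinity.\<close>

lemma nn_integral_weighted:
  assumes e: "e < 2 * \<alpha>"
  obtains C where "0 < C" "\<And>\<tau>. 0 < \<tau> \<Longrightarrow>
    (\<integral>\<^sup>+(w :: (real ^ 'n) \<times> real). ennreal (\<tau> powr (2 * \<alpha>) * (\<tau> + pn w) powr (e - (2 + 2 * \<alpha> + real CARD('n)))) \<partial>lborel)
      \<le> ennreal (C * \<tau> powr e)"
proof -
  obtain C where C: "0 < C" "\<And>\<tau>. 0 < \<tau> \<Longrightarrow>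
    (\<integral>\<^sup>+(w :: (real ^ 'n) \<times> real). ennreal ((\<tau> + pn w) powr (- (2 + 2 * \<alpha> + real CARD('n) - e))) \<partial>lborel)
      \<le> ennreal (C * \<tau> powr (real CARD('n) + 2 - (2 + 2 * \<alpha> + real CARD('n) - e)))"
    using nn_integral_pn_powr[where 'n='n, of "2 + 2 * \<alpha> + real CARD('n) - e"] e by (auto simp: algebra_simps)
  show ?thesis
  proof (rule that[OF C(1)])
    fix \<tau> :: real assume \<tau>: "0 < \<tau>"
    have "(\<integral>\<^sup>+(w :: (real ^ 'n) \<times> real). ennreal (\<tau> powr (2 * \<alpha>) * (\<tau> + pn w) powr (e - (2 + 2 * \<alpha> + real CARD('n)))) \<partial>lborel)
      = ennreal (\<tau> powr (2 * \<alpha>)) * (\<integral>\<^sup>+(w :: (real ^ 'n) \<times> real). ennreal ((\<tau> + pn w) powr (- (2 + 2 * \<alpha> + real CARD('n) - e))) \<partial>lborel)"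
      by (subst nn_integral_cmult[symmetric]) (auto simp: ennreal_mult algebra_simps)
    also have "\<dots> \<le> ennreal (\<tau> powr (2 * \<alpha>)) * ennreal (C * \<tau> powr (real CARD('n) + 2 - (2 + 2 * \<alpha> + real CARD('n) - e)))"
      by (intro mult_left_mono C \<tau>) simp
    also have "\<dots> = ennreal (C * (\<tau> powr (2 * \<alpha>) * \<tau> powr (e - 2 * \<alpha>)))"
      using C by (simp add: ennreal_mult[symmetric] algebra_simps)
    also have "\<tau> powr (2 * \<alpha>) * \<tau> powr (e - 2 * \<alpha>) = \<tau> powr e"
      by (subst powr_add[symmetric]) simp
    finally show "(\<integral>\<^sup>+(w :: (real ^ 'n) \<times> real). ennreal (\<tau> powr (2 * \<alpha>) * (\<tau> + pn w) powr (e - (2 + 2 * \<alpha> + real CARD('n)))) \<partial>lborel)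
      \<le> ennreal (C * \<tau> powr e)" .
  qed
qed

lemma kern_le_maj:
  obtains C where "0 < C" "\<And>\<tau> w :: (real ^ 'n) \<times> real. 0 < \<tau> \<Longrightarrow> kern \<alpha> \<tau> w \<le> C * maj \<alpha> \<tau> w"
proof -
  obtain C where C: "0 < C" "\<And>\<tau> w :: (real ^ 'n) \<times> real. 0 < \<tau> \<Longrightarrow>
      E \<tau> (1 + \<alpha> + real CARD('n) / 2) w \<le> C * (\<tau> + pn w) powr (- (2 * (1 + \<alpha> + real CARD('n) / 2)))"
    using E_le[of "1 + \<alpha> + real CARD('n) / 2"] \<alpha> by auto
  define c where "c = 1 / (4 powr \<alpha> * Gamma \<alpha> * (4 * pi) powr (real CARD('n) / 2))"
  have c: "0 < c" unfolding c_def by (rule kern_const_pos)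
  have "kern \<alpha> \<tau> w \<le> (c * C) * maj \<alpha> \<tau> w" if "0 < \<tau>" for \<tau> and w :: "(real ^ 'n) \<times> real"
  proof -
    have "kern \<alpha> \<tau> w = c * \<tau> powr (2 * \<alpha>) * E \<tau> (1 + \<alpha> + real CARD('n) / 2) w"
      unfolding kern_def c_def by simp
    also have "\<dots> \<le> c * \<tau> powr (2 * \<alpha>) * (C * (\<tau> + pn w) powr (- (2 * (1 + \<alpha> + real CARD('n) / 2))))"
      using C that c by (intro mult_left_mono) auto
    finally show ?thesis unfolding maj_def by (simp add: algebra_simps)
  qed
  then show ?thesis using that[of "c * C"] c C by auto
qed

lemma maj_bddL1: "0 < \<tau> \<Longrightarrow> (maj \<alpha> \<tau> :: (real ^ 'n) \<times> real \<Rightarrow> real) \<in> bddL1"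
proof -
  assume \<tau>: "0 < \<tau>"
  obtain C where C: "(\<integral>\<^sup>+(w :: (real ^ 'n) \<times> real). ennreal (\<tau> powr (2 * \<alpha>) * (\<tau> + pn w) powr (0 - (2 + 2 * \<alpha> + real CARD('n)))) \<partial>lborel)
      \<le> ennreal (C * \<tau> powr 0)"
    using nn_integral_weighted[where 'n='n, of 0] \<alpha> \<tau> by auto
  show ?thesis
  proof (rule bddL1I)
    show "integrable lborel (maj \<alpha> \<tau> :: (real ^ 'n) \<times> real \<Rightarrow> real)"
    proof (rule integrableI_bounded)
      have "(\<integral>\<^sup>+(w :: (real ^ 'n) \<times> real). ennreal (norm (maj \<alpha> \<tau> w)) \<partial>lborel) \<le> ennreal (C * \<tau> powr 0)"
        using C unfolding maj_def by simp
      then show "(\<integral>\<^sup>+(w :: (real ^ 'n) \<times> real). ennreal (norm (maj \<alpha> \<tau> w)) \<partial>lborel) < \<infinity>"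
        by (rule le_less_trans) simp
    qed measurable
    show "\<bar>maj \<alpha> \<tau> w\<bar> \<le> \<tau> powr (2 * \<alpha>) * \<tau> powr (- (2 + 2 * \<alpha> + real CARD('n)))" for w :: "(real ^ 'n) \<times> real"
      using \<tau> \<alpha> unfolding maj_def by (auto simp: abs_mult intro!: mult_left_mono powr_mono2')
  qed measurable
qed

lemma kern_bddL1: "0 < \<tau> \<Longrightarrow> (kern \<alpha> \<tau> :: (real ^ 'n) \<times> real \<Rightarrow> real) \<in> bddL1"
proof -
  assume \<tau>: "0 < \<tau>"
  obtain C where "\<And>w :: (real ^ 'n) \<times> real. kern \<alpha> \<tau> w \<le> C * maj \<alpha> \<tau> w"
    using kern_le_maj \<tau> by metis
  then show ?thesis
    using bddL1_cmult[OF maj_bddL1[OF \<tau>], of C] by (intro bddL1_dom[of "kern \<alpha> \<tau>" "\<lambda>w. C * maj \<alpha> \<tau> w"]) auto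
qed

lemma kern_moment:
  obtains C where "0 < C" "\<And>\<tau>. 0 < \<tau> \<Longrightarrow>
    (\<integral>\<^sup>+(w :: (real ^ 'n) \<times> real). ennreal (kern \<alpha> \<tau> w * pn w powr \<alpha>) \<partial>lborel) \<le> ennreal (C * \<tau> powr \<alpha>)"
proof -
  obtain C where C: "0 < C" "\<And>\<tau> w :: (real ^ 'n) \<times> real. 0 < \<tau> \<Longrightarrow> kern \<alpha> \<tau> w \<le> C * maj \<alpha> \<tau> w"
    using kern_le_maj by metis
  have lt: "\<alpha> < 2 * \<alpha>" using \<alpha> by simp
  obtain D where D: "0 < D" "\<And>\<tau>. 0 < \<tau> \<Longrightarrow>
    (\<integral>\<^sup>+(w :: (real ^ 'n) \<times> real). ennreal (\<tau> powr (2 * \<alpha>) * (\<tau> + pn w) powr (\<alpha> - (2 + 2 * \<alpha> + real CARD('n)))) \<partial>lborel)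
      \<le> ennreal (D * \<tau> powr \<alpha>)"
    by (rule nn_integral_weighted[where 'n='n, of "\<alpha>", OF lt]) blast
  show ?thesis
  proof (rule that[of "C * D"])
    fix \<tau> :: real assume \<tau>: "0 < \<tau>"
    have "(\<integral>\<^sup>+(w :: (real ^ 'n) \<times> real). ennreal (kern \<alpha> \<tau> w * pn w powr \<alpha>) \<partial>lborel) \<le>
      (\<integral>\<^sup>+(w :: (real ^ 'n) \<times> real). ennreal C * ennreal (\<tau> powr (2 * \<alpha>) * (\<tau> + pn w) powr (\<alpha> - (2 + 2 * \<alpha> + real CARD('n)))) \<partial>lborel)"
    proof (rule nn_integral_mono)
      fix w :: "(real ^ 'n) \<times> real"
      have "kern \<alpha> \<tau> w * pn w powr \<alpha> \<le> C * maj \<alpha> \<tau> w * (\<tau> + pn w) powr \<alpha>"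
        using C \<tau> \<alpha> by (intro mult_mono powr_mono2) auto
      also have "\<dots> = C * (\<tau> powr (2 * \<alpha>) * ((\<tau> + pn w) powr \<alpha> * (\<tau> + pn w) powr (- (2 + 2 * \<alpha> + real CARD('n)))))"
        unfolding maj_def by (simp add: algebra_simps)
      also have "(\<tau> + pn w) powr \<alpha> * (\<tau> + pn w) powr (- (2 + 2 * \<alpha> + real CARD('n))) = (\<tau> + pn w) powr (\<alpha> - (2 + 2 * \<alpha> + real CARD('n)))"
        by (subst powr_add[symmetric]) simp
      finally show "ennreal (kern \<alpha> \<tau> w * pn w powr \<alpha>) \<le> ennreal C * ennreal (\<tau> powr (2 * \<alpha>) * (\<tau> + pn w) powr (\<alpha> - (2 + 2 * \<alpha> + real CARD('n))))"
        using C by (subst ennreal_mult[symmetric]) (auto intro: ennreal_leI)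
    qed
    also have "\<dots> = ennreal C * (\<integral>\<^sup>+(w :: (real ^ 'n) \<times> real). ennreal (\<tau> powr (2 * \<alpha>) * (\<tau> + pn w) powr (\<alpha> - (2 + 2 * \<alpha> + real CARD('n)))) \<partial>lborel)"
      by (rule nn_integral_cmult) measurable
    also have "\<dots> \<le> ennreal C * ennreal (D * \<tau> powr \<alpha>)"
      by (intro mult_left_mono D \<tau>) simp
    finally show "(\<integral>\<^sup>+(w :: (real ^ 'n) \<times> real). ennreal (kern \<alpha> \<tau> w * pn w powr \<alpha>) \<partial>lborel) \<le> ennreal (C * D * \<tau> powr \<alpha>)"
      using C D by (simp add: ennreal_mult mult.assoc)
  qed (use C D in simp)
qed

text \<open>At times up to \<open>S\<close>, \<open>E_shift\<close> trades a factor of time, at most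
  \<open>S\<close>, for a larger exponent \<open>b\<close>, which improves the decay in the gauge by
  two powers.\<close>

lemma kern_early:
  obtains C where "0 < C" "\<And>\<tau> S. 0 < \<tau> \<Longrightarrow> 0 < S \<Longrightarrow>
    (\<integral>\<^sup>+(w :: (real ^ 'n) \<times> real). ennreal (kern \<alpha> \<tau> w) * indicator {w. snd w \<le> S} w \<partial>lborel) \<le> ennreal (C * S / \<tau>\<^sup>2)"
proof -
  define b where "b = 1 + \<alpha> + real CARD('n) / 2"
  obtain C where C: "0 < C" "\<And>\<tau> w :: (real ^ 'n) \<times> real. 0 < \<tau> \<Longrightarrow>
      E \<tau> (b + 1) w \<le> C * (\<tau> + pn w) powr (- (2 * (b + 1)))"
    using E_le[of "b + 1"] \<alpha> unfolding b_def by (metis add_pos_nonneg add_pos_pos zero_less_one divide_nonneg_pos of_nat_0_le_iff zero_less_numeral)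
  define c where "c = 1 / (4 powr \<alpha> * Gamma \<alpha> * (4 * pi) powr (real CARD('n) / 2))"
  have c: "0 < c" unfolding c_def by (rule kern_const_pos)
  have lt: "- 2 < 2 * \<alpha>" using \<alpha> by simp
  obtain D where D: "0 < D" "\<And>\<tau>. 0 < \<tau> \<Longrightarrow>
    (\<integral>\<^sup>+(w :: (real ^ 'n) \<times> real). ennreal (\<tau> powr (2 * \<alpha>) * (\<tau> + pn w) powr (- 2 - (2 + 2 * \<alpha> + real CARD('n)))) \<partial>lborel)
      \<le> ennreal (D * \<tau> powr (- 2))"
    by (rule nn_integral_weighted[where 'n='n, of "-2", OF lt]) blast
  show ?thesis
  proof (rule that[of "c * C * D"])
    fix \<tau> S :: real assume \<tau>: "0 < \<tau>" and S: "0 < S"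
    have "(\<integral>\<^sup>+(w :: (real ^ 'n) \<times> real). ennreal (kern \<alpha> \<tau> w) * indicator {w. snd w \<le> S} w \<partial>lborel) \<le>
      (\<integral>\<^sup>+(w :: (real ^ 'n) \<times> real). ennreal (c * C * S) * ennreal (\<tau> powr (2 * \<alpha>) * (\<tau> + pn w) powr (- 2 - (2 + 2 * \<alpha> + real CARD('n)))) \<partial>lborel)"
    proof (rule nn_integral_mono)
      fix w :: "(real ^ 'n) \<times> real"
      have "kern \<alpha> \<tau> w \<le> (c * C * S) * (\<tau> powr (2 * \<alpha>) * (\<tau> + pn w) powr (- 2 - (2 + 2 * \<alpha> + real CARD('n))))" if wS: "snd w \<le> S"
      proof (cases "0 < snd w")
        case True
        have "kern \<alpha> \<tau> w = c * \<tau> powr (2 * \<alpha>) * (snd w * E \<tau> (b + 1) w)"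
          using E_shift[OF True, of \<tau> b "fst w"] unfolding kern_def c_def b_def by simp
        also have "\<dots> \<le> c * \<tau> powr (2 * \<alpha>) * (S * (C * (\<tau> + pn w) powr (- (2 * (b + 1)))))"
          using C \<tau> c True wS by (intro mult_left_mono mult_mono) auto
        finally show ?thesis unfolding b_def by (simp add: algebra_simps)
      qed (use c C S in \<open>simp add: kern_def E_def\<close>)
      then show "ennreal (kern \<alpha> \<tau> w) * indicator {w. snd w \<le> S} w \<le> ennreal (c * C * S) * ennreal (\<tau> powr (2 * \<alpha>) * (\<tau> + pn w) powr (- 2 - (2 + 2 * \<alpha> + real CARD('n))))"
        using c C S by (subst ennreal_mult[symmetric]) (auto intro: ennreal_leI simp: indicator_def)
    qed
    also have "\<dots> = ennreal (c * C * S) * (\<integral>\<^sup>+(w :: (real ^ 'n) \<times> real). ennreal (\<tau> powr (2 * \<alpha>) * (\<tau> + pn w) powr (- 2 - (2 + 2 * \<alpha> + real CARD('n)))) \<partial>lborel)"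
      by (rule nn_integral_cmult) measurable
    also have "\<dots> \<le> ennreal (c * C * S) * ennreal (D * \<tau> powr (- 2))"
      by (intro mult_left_mono D \<tau>) simp
    also have "\<dots> = ennreal (c * C * D * S / \<tau>\<^sup>2)"
      using c C D S \<tau> by (simp add: ennreal_mult[symmetric] powr_minus field_simps)
    finally show "(\<integral>\<^sup>+(w :: (real ^ 'n) \<times> real). ennreal (kern \<alpha> \<tau> w) * indicator {w. snd w \<le> S} w \<partial>lborel) \<le> ennreal (c * C * D * S / \<tau>\<^sup>2)" .
  qed (use c C D in simp)
qed

text \<open>Integrating \<open>E_hoelder\<close> with \<delta> = \<alpha>; the two terms on its
  right have the same integral by translation invariance.\<close>

lemma kern_smooth:
  obtains C where "0 < C" "\<And>\<tau> w :: (real ^ 'n) \<times> real. 0 < \<tau> \<Longrightarrow>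
    norm1 (\<lambda>z. kern \<alpha> \<tau> (z - w) - kern \<alpha> \<tau> z) \<le> C * (pn w / \<tau>) powr \<alpha>"
proof -
  define b where "b = 1 + \<alpha> + real CARD('n) / 2"
  have b: "0 < b" unfolding b_def using \<alpha> by (simp add: add_pos_nonneg)
  obtain C where C: "0 < C" "\<And>\<tau> z w :: (real ^ 'n) \<times> real. 0 < \<tau> \<Longrightarrow>
    \<bar>E \<tau> b (z - w) - E \<tau> b z\<bar> \<le> C * pn w powr \<alpha> *
      ((\<tau> + pn z) powr (- (2 * b + \<alpha>)) + (\<tau> + pn (z - w)) powr (- (2 * b + \<alpha>)))"
    using E_hoelder[OF b, of \<alpha>] \<alpha> by auto
  define c where "c = 1 / (4 powr \<alpha> * Gamma \<alpha> * (4 * pi) powr (real CARD('n) / 2))"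
  have c: "0 < c" unfolding c_def by (rule kern_const_pos)
  have lt: "- \<alpha> < 2 * \<alpha>" using \<alpha> by simp
  obtain D where D: "0 < D" "\<And>\<tau>. 0 < \<tau> \<Longrightarrow>
    (\<integral>\<^sup>+(w :: (real ^ 'n) \<times> real). ennreal (\<tau> powr (2 * \<alpha>) * (\<tau> + pn w) powr (- \<alpha> - (2 + 2 * \<alpha> + real CARD('n)))) \<partial>lborel)
      \<le> ennreal (D * \<tau> powr (- \<alpha>))"
    by (rule nn_integral_weighted[where 'n='n, of "- \<alpha>", OF lt]) blast
  show ?thesis
  proof (rule that[of "2 * c * C * D"])
    fix \<tau> :: real and w :: "(real ^ 'n) \<times> real" assume \<tau>: "0 < \<tau>"
    define G where "G z = ennreal (\<tau> powr (2 * \<alpha>) * (\<tau> + pn z) powr (- \<alpha> - (2 + 2 * \<alpha> + real CARD('n))))" for z :: "(real ^ 'n) \<times> real"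
    have [measurable]: "G \<in> borel_measurable borel" unfolding G_def by measurable
    show "norm1 (\<lambda>z. kern \<alpha> \<tau> (z - w) - kern \<alpha> \<tau> z) \<le> 2 * c * C * D * (pn w / \<tau>) powr \<alpha>"
    proof (rule norm1_le)
      show "(\<lambda>z. kern \<alpha> \<tau> (z - w) - kern \<alpha> \<tau> z) \<in> bddL1"
        by (intro bddL1_diff bddL1_shift kern_bddL1 \<tau>)
      have "(\<integral>\<^sup>+z. ennreal \<bar>kern \<alpha> \<tau> (z - w) - kern \<alpha> \<tau> z\<bar> \<partial>lborel) \<le>
        (\<integral>\<^sup>+z. ennreal (c * C * pn w powr \<alpha>) * (G z + G (z - w)) \<partial>lborel)"
      proof (rule nn_integral_mono)
        fix z :: "(real ^ 'n) \<times> real"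
        have e: "- \<alpha> - (2 + 2 * \<alpha> + real CARD('n)) = - (2 * b + \<alpha>)" unfolding b_def by simp
        have "\<bar>kern \<alpha> \<tau> (z - w) - kern \<alpha> \<tau> z\<bar> = c * \<tau> powr (2 * \<alpha>) * \<bar>E \<tau> b (z - w) - E \<tau> b z\<bar>"
          using c unfolding kern_def b_def[symmetric] c_def
          by (simp add: abs_mult[symmetric] right_diff_distrib[symmetric] diff_divide_distrib[symmetric] del: abs_mult) (simp add: abs_mult)
        also have "\<dots> \<le> c * \<tau> powr (2 * \<alpha>) * (C * pn w powr \<alpha> *
             ((\<tau> + pn z) powr (- (2 * b + \<alpha>)) + (\<tau> + pn (z - w)) powr (- (2 * b + \<alpha>))))"
          using c by (intro mult_left_mono C \<tau>) auto
        finally have "\<bar>kern \<alpha> \<tau> (z - w) - kern \<alpha> \<tau> z\<bar> \<le> (c * C * pn w powr \<alpha>) *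
            (\<tau> powr (2 * \<alpha>) * (\<tau> + pn z) powr (- (2 * b + \<alpha>)) + \<tau> powr (2 * \<alpha>) * (\<tau> + pn (z - w)) powr (- (2 * b + \<alpha>)))"
          by (simp add: algebra_simps)
        then show "ennreal \<bar>kern \<alpha> \<tau> (z - w) - kern \<alpha> \<tau> z\<bar> \<le> ennreal (c * C * pn w powr \<alpha>) * (G z + G (z - w))"
          unfolding G_def e using c C by (subst ennreal_plus[symmetric], simp, simp, subst ennreal_mult[symmetric]) (auto intro: ennreal_leI)
      qed
      also have "\<dots> = ennreal (c * C * pn w powr \<alpha>) * ((\<integral>\<^sup>+z. G z \<partial>lborel) + (\<integral>\<^sup>+z. G z \<partial>lborel))"
        by (simp add: nn_integral_cmult nn_integral_add nn_integral_lborel_diff(2)[of G])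
      also have "\<dots> \<le> ennreal (c * C * pn w powr \<alpha>) * (ennreal (D * \<tau> powr (- \<alpha>)) + ennreal (D * \<tau> powr (- \<alpha>)))"
        unfolding G_def by (intro mult_left_mono add_mono D \<tau>) auto
      also have "\<dots> = ennreal (2 * c * C * D * (pn w / \<tau>) powr \<alpha>)"
        using c C D \<tau> by (simp add: ennreal_mult[symmetric] ennreal_plus[symmetric] powr_divide powr_minus field_simps del: ennreal_plus)
      finally show "(\<integral>\<^sup>+z. ennreal \<bar>kern \<alpha> \<tau> (z - w) - kern \<alpha> \<tau> z\<bar> \<partial>lborel) \<le> ennreal (2 * c * C * D * (pn w / \<tau>) powr \<alpha>)" .
    qed (use c C D in simp)
  qed (use c C D in simp)
qed

text \<open>One of \<open>z - w\<close> and \<open>w\<close> has gauge at least half that of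
  \<open>z\<close>, and there its majorant is at most a constant times the value at
  \<open>z\<close>. The other factor is integrated, with a bound that does not depend on its
  scale.\<close>

lemma maj_conv:
  obtains C where "0 < C" "\<And>\<tau> \<sigma> z :: (real ^ 'n) \<times> real. 0 < \<tau> \<Longrightarrow> 0 < \<sigma> \<Longrightarrow>
    (\<integral>\<^sup>+w. ennreal (maj \<alpha> \<tau> (z - w)) * ennreal (maj \<alpha> \<sigma> w) \<partial>lborel) \<le> ennreal C * (ennreal (maj \<alpha> \<tau> z) + ennreal (maj \<alpha> \<sigma> z))"
proof -
  define m where "m = 2 + 2 * \<alpha> + real CARD('n)"
  have m: "0 < m" unfolding m_def using \<alpha> by (simp add: add_pos_nonneg)
  obtain D where D: "0 < D" "\<And>\<tau>. 0 < \<tau> \<Longrightarrow> (\<integral>\<^sup>+(w :: (real ^ 'n) \<times> real). ennreal (maj \<alpha> \<tau> w) \<partial>lborel) \<le> ennreal D"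
    using nn_integral_weighted[where 'n='n, of 0] \<alpha> unfolding maj_def by auto
  have half: "maj \<alpha> \<tau> u \<le> 2 powr m * maj \<alpha> \<tau> z" if "0 < \<tau>" "pn z \<le> 2 * pn u" for \<tau> and u z :: "(real ^ 'n) \<times> real"
    using powr_half_le[of "\<tau> + pn z" "\<tau> + pn u" m] that m unfolding maj_def m_def[symmetric]
    by (simp add: add_pos_nonneg mult.left_commute mult_left_mono)
  show ?thesis
  proof (rule that[of "2 powr m * D"])
    fix \<tau> \<sigma> :: real and z :: "(real ^ 'n) \<times> real" assume \<tau>: "0 < \<tau>" and \<sigma>: "0 < \<sigma>"
    have arith: "x * y \<le> p * (c * y + d * x)"
      if "x \<le> p * c \<or> y \<le> p * d" "0 \<le> x" "0 \<le> y" "0 \<le> c" "0 \<le> d" "0 \<le> p" for x y c d p :: real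
    proof -
      have "x * y \<le> p * c * y \<or> x * y \<le> p * d * x"
        using that mult_right_mono[of x "p * c" y] mult_left_mono[of y "p * d" x] by (auto simp: mult.commute)
      moreover have "0 \<le> p * c * y" "0 \<le> p * d * x" using that by auto
      ultimately have "x * y \<le> p * c * y + p * d * x" by linarith
      then show ?thesis by (simp add: distrib_left mult.assoc)
    qed
    have pt: "maj \<alpha> \<tau> (z - w) * maj \<alpha> \<sigma> w \<le> 2 powr m * (maj \<alpha> \<tau> z * maj \<alpha> \<sigma> w + maj \<alpha> \<sigma> z * maj \<alpha> \<tau> (z - w))" for w
    proof (rule arith)
      have "pn z \<le> 2 * pn (z - w) \<or> pn z \<le> 2 * pn w" using pn_le_diff[of z w] by linarith
      then show "maj \<alpha> \<tau> (z - w) \<le> 2 powr m * maj \<alpha> \<tau> z \<or> maj \<alpha> \<sigma> w \<le> 2 powr m * maj \<alpha> \<sigma> z"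
        using half[OF \<tau>, of z "z - w"] half[OF \<sigma>, of z w] by auto
    qed auto
    have "(\<integral>\<^sup>+w. ennreal (maj \<alpha> \<tau> (z - w)) * ennreal (maj \<alpha> \<sigma> w) \<partial>lborel) \<le>
      (\<integral>\<^sup>+w. ennreal (2 powr m) * (ennreal (maj \<alpha> \<tau> z) * ennreal (maj \<alpha> \<sigma> w) + ennreal (maj \<alpha> \<sigma> z) * ennreal (maj \<alpha> \<tau> (z - w))) \<partial>lborel)"
      using pt by (intro nn_integral_mono)
        (auto simp: ennreal_mult[symmetric] ennreal_plus[symmetric] intro!: ennreal_leI simp del: ennreal_plus)
    also have "\<dots> = ennreal (2 powr m) * (ennreal (maj \<alpha> \<tau> z) * (\<integral>\<^sup>+(w :: (real ^ 'n) \<times> real). ennreal (maj \<alpha> \<sigma> w) \<partial>lborel) +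
        ennreal (maj \<alpha> \<sigma> z) * (\<integral>\<^sup>+(w :: (real ^ 'n) \<times> real). ennreal (maj \<alpha> \<tau> w) \<partial>lborel))"
      by (simp add: nn_integral_cmult nn_integral_add nn_integral_lborel_diff(1)[of "\<lambda>w. ennreal (maj \<alpha> \<tau> w)"])
    also have "\<dots> \<le> ennreal (2 powr m) * (ennreal (maj \<alpha> \<tau> z) * ennreal D + ennreal (maj \<alpha> \<sigma> z) * ennreal D)"
      by (intro mult_left_mono add_mono D \<tau> \<sigma>) auto
    finally show "(\<integral>\<^sup>+w. ennreal (maj \<alpha> \<tau> (z - w)) * ennreal (maj \<alpha> \<sigma> w) \<partial>lborel)
      \<le> ennreal (2 powr m * D) * (ennreal (maj \<alpha> \<tau> z) + ennreal (maj \<alpha> \<sigma> z))"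
      using D by (simp add: ennreal_mult distrib_left mult_ac)
  qed (use D in simp)
qed

text \<open>The parabolic dilation by \<tau> has Jacobian \<tau>^(n + 2), which exactly compensates
  the homogeneity of the kernel.\<close>

lemma kern_mass_eq:
  assumes \<tau>: "0 < \<tau>"
  shows "norm1 (kern \<alpha> \<tau> :: (real ^ 'n) \<times> real \<Rightarrow> real) = norm1 (kern \<alpha> 1 :: (real ^ 'n) \<times> real \<Rightarrow> real)"
proof -
  have sc: "\<tau> ^ (CARD('n) + 2) * kern \<alpha> \<tau> (\<tau> *\<^sub>R fst w, \<tau>\<^sup>2 * snd w) = kern \<alpha> 1 w" for w :: "(real ^ 'n) \<times> real"
  proof (cases "0 < snd w")
    case True
    define b where "b = 1 + \<alpha> + real CARD('n) / 2"
    have 1: "(\<tau>\<^sup>2 * snd w) powr (- b) = \<tau> powr (- (2 * b)) * snd w powr (- b)"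
      using True \<tau> by (simp add: powr_mult powr_powr flip: powr_numeral)
    have 2: "\<tau> powr (real CARD('n) + 2) * \<tau> powr (2 * \<alpha>) * \<tau> powr (- (2 * b)) = 1"
      using \<tau> unfolding b_def powr_add[symmetric] by simp
    have 3: "- (\<tau>\<^sup>2 + (norm (\<tau> *\<^sub>R fst w))\<^sup>2) / (4 * (\<tau>\<^sup>2 * snd w)) = - (1\<^sup>2 + (norm (fst w))\<^sup>2) / (4 * snd w)"
      using True \<tau> by (simp add: power_mult_distrib field_simps)
    have 4: "\<tau> ^ (CARD('n) + 2) = \<tau> powr (real CARD('n) + 2)" using \<tau> by (subst powr_realpow[symmetric]) (auto simp: add.commute)
    have "\<tau> ^ (CARD('n) + 2) * kern \<alpha> \<tau> (\<tau> *\<^sub>R fst w, \<tau>\<^sup>2 * snd w) =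
      (\<tau> powr (real CARD('n) + 2) * \<tau> powr (2 * \<alpha>) * \<tau> powr (- (2 * b))) / (4 powr \<alpha> * Gamma \<alpha> * (4 * pi) powr (real CARD('n) / 2)) *
      (exp (- (1\<^sup>2 + (norm (fst w))\<^sup>2) / (4 * snd w)) * snd w powr (- b))"
      using True \<tau> unfolding kern_def E_def b_def[symmetric] fst_conv snd_conv 3 4 1 by simp
    then show ?thesis unfolding 2 using True by (simp add: kern_def E_def b_def)
  qed (use \<tau> in \<open>auto simp: kern_def E_def zero_less_mult_iff\<close>)
  have g: "(\<lambda>w :: (real ^ 'n) \<times> real. (\<tau> *\<^sub>R fst w, \<tau>\<^sup>2 * snd w)) \<in> borel \<rightarrow>\<^sub>M borel"
    by (intro borel_measurable_continuous_onI continuous_intros)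
  have gm: "(\<lambda>w :: (real ^ 'n) \<times> real. ennreal \<bar>kern \<alpha> \<tau> (\<tau> *\<^sub>R fst w, \<tau>\<^sup>2 * snd w)\<bar>) \<in> borel_measurable borel"
    by (rule measurable_compose[OF g]) measurable
  have "ennreal (norm1 (kern \<alpha> \<tau> :: (real ^ 'n) \<times> real \<Rightarrow> real)) = (\<integral>\<^sup>+(w :: (real ^ 'n) \<times> real). ennreal \<bar>kern \<alpha> \<tau> w\<bar> \<partial>lborel)"
    by (rule norm1_nn[symmetric]) (rule kern_bddL1[OF \<tau>])
  also have "\<dots> = ennreal (\<tau> ^ (CARD('n) + 2)) * (\<integral>\<^sup>+(w :: (real ^ 'n) \<times> real). ennreal \<bar>kern \<alpha> \<tau> (\<tau> *\<^sub>R fst w, \<tau>\<^sup>2 * snd w)\<bar> \<partial>lborel)"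
    by (rule nn_integral_parabolic_scale) (use \<tau> in auto)
  also have "\<dots> = (\<integral>\<^sup>+(w :: (real ^ 'n) \<times> real). ennreal (\<tau> ^ (CARD('n) + 2)) * ennreal \<bar>kern \<alpha> \<tau> (\<tau> *\<^sub>R fst w, \<tau>\<^sup>2 * snd w)\<bar> \<partial>lborel)"
    by (rule nn_integral_cmult[symmetric]) (use gm in simp)
  also have "\<dots> = (\<integral>\<^sup>+(w :: (real ^ 'n) \<times> real). ennreal \<bar>kern \<alpha> 1 w\<bar> \<partial>lborel)"
    using \<tau> by (intro nn_integral_cong) (simp add: ennreal_mult[symmetric] sc[symmetric])
  also have "\<dots> = ennreal (norm1 (kern \<alpha> 1 :: (real ^ 'n) \<times> real \<Rightarrow> real))"
    by (rule norm1_nn) (rule kern_bddL1, simp)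
  finally show ?thesis by (simp add: norm1_nonneg)
qed

text \<open>The kernel is strictly positive at positive times, so mass zero would turn an open
  half-space into a null set.\<close>

lemma kern_mass_pos: "0 < norm1 (kern \<alpha> 1 :: (real ^ 'n) \<times> real \<Rightarrow> real)"
proof (rule ccontr)
  assume "\<not> ?thesis"
  then have "norm1 (kern \<alpha> 1 :: (real ^ 'n) \<times> real \<Rightarrow> real) = 0" 
    using norm1_nonneg[of "kern \<alpha> 1 :: (real ^ 'n) \<times> real \<Rightarrow> real"] by linarith
  note that = this
  have "AE w in lborel. \<bar>kern \<alpha> 1 (w :: (real ^ 'n) \<times> real)\<bar> = 0"
  proof -
    have "integrable lborel (\<lambda>w. \<bar>kern \<alpha> 1 (w :: (real ^ 'n) \<times> real)\<bar>)"
      by (intro bddL1_int bddL1_abs kern_bddL1) simp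
    then show ?thesis using integral_nonneg_eq_0_iff_AE[of lborel "\<lambda>w. \<bar>kern \<alpha> 1 (w :: (real ^ 'n) \<times> real)\<bar>"] that
      unfolding norm1_def by simp
  qed
  then have "AE (w :: (real ^ 'n) \<times> real) in lborel. \<not> 0 < snd w"
  proof (rule AE_mp, intro AE_I2 impI notI)
    fix w :: "(real ^ 'n) \<times> real" assume "\<bar>kern \<alpha> 1 w\<bar> = 0" "0 < snd w"
    then show False using kern_const_pos[where 'n='n] by (auto simp: kern_def E_def)
  qed
  moreover have "{w :: (real ^ 'n) \<times> real. 0 < snd w} \<in> sets borel"
    by (intro borel_open open_Collect_less continuous_intros)
  ultimately have "{w :: (real ^ 'n) \<times> real. 0 < snd w} \<in> null_sets lborel"
    using AE_iff_null_sets[of "{w :: (real ^ 'n) \<times> real. 0 < snd w}" lborel] by simp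
  then have "negligible {w :: (real ^ 'n) \<times> real. 0 < snd w}"
    by (simp add: negligible_iff_null_sets null_sets_completionI)
  moreover have "open {w :: (real ^ 'n) \<times> real. 0 < snd w}" by (intro open_Collect_less continuous_intros)
  moreover have "(0, 1) \<in> {w :: (real ^ 'n) \<times> real. 0 < snd w}" by simp
  ultimately show False using open_not_negligible by blast
qed

end

section \<open>Maximal tail sums\<close>

text \<open>For a kernel living at scale a, \<open>A\<close> is of order a^\<alpha> and
  \<open>B\<close> of order a^(-\<alpha>). The moment of one kernel times the Hoelder constant of
  another is then a power of the ratio of their scales.\<close>

definition atom :: "real \<Rightarrow> real \<Rightarrow> real \<Rightarrow> ((real ^ 'n) \<times> real \<Rightarrow> real) \<Rightarrow> bool" where
  "atom \<alpha> A B k \<longleftrightarrow> k \<in> bddL1 \<and> 0 \<le> A \<and> 0 \<le> B \<and>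
     (\<integral>\<^sup>+w. ennreal (\<bar>k w\<bar> * pn w powr \<alpha>) \<partial>lborel) \<le> ennreal A \<and>
     (\<forall>w. norm1 (\<lambda>z. k (z - w) - k z) \<le> B * pn w powr \<alpha>)"

lemma atom_smooth: "atom \<alpha> A B k \<Longrightarrow> norm1 (\<lambda>z. k (z - w) - k z) \<le> B * pn w powr \<alpha>"
  unfolding atom_def by blast

text \<open>The difference is the integral of q(w) (k(z - w) - k(z)) over w, so the moment of
  \<open>q\<close> meets the smoothness of \<open>k\<close>. With mean value 0 this yields almost
  orthogonality, with mean value 1 the approximation of \<open>k\<close> by its averages.\<close>

lemma norm1_conv_atom:
  assumes q: "atom \<alpha> A B q" and k: "atom \<alpha> A' B' k"
  shows "norm1 (\<lambda>z. conv q k z - (LINT w|lborel. q w) * k z) \<le> A * B'"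
proof (rule norm1_le)
  have qk: "q \<in> bddL1" "k \<in> bddL1" "0 \<le> A" "0 \<le> B'" using q k by (auto simp: atom_def)
  note [measurable] = qk(1)[THEN bddL1_meas] qk(2)[THEN bddL1_meas]
  show "(\<lambda>z. conv q k z - (LINT w|lborel. q w) * k z) \<in> bddL1"
    by (intro bddL1_diff conv_bddL1 bddL1_cmult qk)
  show "0 \<le> A * B'" using qk by simp
  have "(\<integral>\<^sup>+z. ennreal \<bar>conv q k z - (LINT w|lborel. q w) * k z\<bar> \<partial>lborel) \<le>
    (\<integral>\<^sup>+z. (\<integral>\<^sup>+w. ennreal \<bar>q w\<bar> * ennreal \<bar>k (z - w) - k z\<bar> \<partial>lborel) \<partial>lborel)"
  proof (rule nn_integral_mono)
    fix z
    have i: "integrable lborel (\<lambda>w. q w * k (z - w))" "integrable lborel (\<lambda>w. q w * k z)"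
      using qk by (auto intro: conv_int bddL1_int)
    have "conv q k z - (LINT w|lborel. q w) * k z = (LINT w|lborel. q w * (k (z - w) - k z))"
      unfolding conv_def right_diff_distrib by (subst Bochner_Integration.integral_diff[OF i]) simp
    moreover have "integrable lborel (\<lambda>w. q w * (k (z - w) - k z))"
      unfolding right_diff_distrib by (intro Bochner_Integration.integrable_diff i)
    ultimately have "ennreal (norm (conv q k z - (LINT w|lborel. q w) * k z)) \<le>
        (\<integral>\<^sup>+w. norm (q w * (k (z - w) - k z)) \<partial>lborel)"
      by (simp only: integral_norm_bound_ennreal)
    then show "ennreal \<bar>conv q k z - (LINT w|lborel. q w) * k z\<bar> \<le>
        (\<integral>\<^sup>+w. ennreal \<bar>q w\<bar> * ennreal \<bar>k (z - w) - k z\<bar> \<partial>lborel)"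
      by (simp add: abs_mult ennreal_mult)
  qed
  also have "\<dots> = (\<integral>\<^sup>+w. (\<integral>\<^sup>+z. ennreal \<bar>q w\<bar> * ennreal \<bar>k (z - w) - k z\<bar> \<partial>lborel) \<partial>lborel)"
    by (rule lborel_pair.Fubini') measurable
  also have "\<dots> \<le> (\<integral>\<^sup>+w. ennreal B' * ennreal (\<bar>q w\<bar> * pn w powr \<alpha>) \<partial>lborel)"
  proof (rule nn_integral_mono)
    fix w
    have "(\<integral>\<^sup>+z. ennreal \<bar>q w\<bar> * ennreal \<bar>k (z - w) - k z\<bar> \<partial>lborel) = ennreal \<bar>q w\<bar> * ennreal (norm1 (\<lambda>z. k (z - w) - k z))"
      using qk by (subst nn_integral_cmult) (auto simp: norm1_nn bddL1_diff bddL1_shift)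
    also have "\<dots> \<le> ennreal \<bar>q w\<bar> * ennreal (B' * pn w powr \<alpha>)"
      by (intro mult_left_mono ennreal_leI atom_smooth[OF k]) simp
    also have "\<dots> = ennreal B' * ennreal (\<bar>q w\<bar> * pn w powr \<alpha>)"
      using qk by (simp add: ennreal_mult[symmetric] mult_ac)
    finally show "(\<integral>\<^sup>+z. ennreal \<bar>q w\<bar> * ennreal \<bar>k (z - w) - k z\<bar> \<partial>lborel) \<le> ennreal B' * ennreal (\<bar>q w\<bar> * pn w powr \<alpha>)" .
  qed
  also have "\<dots> = ennreal B' * (\<integral>\<^sup>+w. ennreal (\<bar>q w\<bar> * pn w powr \<alpha>) \<partial>lborel)"
    by (rule nn_integral_cmult) measurable
  also have "\<dots> \<le> ennreal B' * ennreal A"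
    using q by (intro mult_left_mono) (auto simp: atom_def)
  finally show "(\<integral>\<^sup>+z. ennreal \<bar>conv q k z - (LINT w|lborel. q w) * k z\<bar> \<partial>lborel) \<le> ennreal (A * B')"
    using qk by (simp add: ennreal_mult mult.commute)
qed

lemma atom_cmult:
  assumes "atom \<alpha> A B k"
  shows "atom \<alpha> (\<bar>c\<bar> * A) (\<bar>c\<bar> * B) (\<lambda>z. c * k z)"
proof -
  have k: "k \<in> bddL1" "0 \<le> A" "0 \<le> B" using assms by (auto simp: atom_def)
  note [measurable] = bddL1_meas[OF k(1)]
  have "(\<integral>\<^sup>+w. ennreal (\<bar>c * k w\<bar> * pn w powr \<alpha>) \<partial>lborel) = (\<integral>\<^sup>+w. ennreal \<bar>c\<bar> * ennreal (\<bar>k w\<bar> * pn w powr \<alpha>) \<partial>lborel)"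
    by (simp add: abs_mult ennreal_mult mult_ac)
  also have "\<dots> = ennreal \<bar>c\<bar> * (\<integral>\<^sup>+w. ennreal (\<bar>k w\<bar> * pn w powr \<alpha>) \<partial>lborel)"
    by (rule nn_integral_cmult) measurable
  also have "\<dots> \<le> ennreal (\<bar>c\<bar> * A)"
    using assms by (auto simp: atom_def ennreal_mult intro!: mult_left_mono)
  finally have "(\<integral>\<^sup>+w. ennreal (\<bar>c * k w\<bar> * pn w powr \<alpha>) \<partial>lborel) \<le> ennreal (\<bar>c\<bar> * A)" .
  moreover have "norm1 (\<lambda>z. c * k (z - w) - c * k z) \<le> \<bar>c\<bar> * B * pn w powr \<alpha>" for w
    using atom_smooth[OF assms, of w] norm1_cmult[of c "\<lambda>z. k (z - w) - k z"]
    by (simp add: right_diff_distrib[symmetric] mult.assoc mult_left_mono)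
  ultimately show ?thesis using k by (auto simp: atom_def intro: bddL1_cmult)
qed

lemma atom_add:
  assumes k: "atom \<alpha> A B k" and k': "atom \<alpha> A' B' k'"
  shows "atom \<alpha> (A + A') (B + B') (\<lambda>z. k z + k' z)"
proof -
  have b: "k \<in> bddL1" "k' \<in> bddL1" "0 \<le> A" "0 \<le> B" "0 \<le> A'" "0 \<le> B'" using k k' by (auto simp: atom_def)
  note [measurable] = bddL1_meas[OF b(1)] bddL1_meas[OF b(2)]
  have "(\<integral>\<^sup>+w. ennreal (\<bar>k w + k' w\<bar> * pn w powr \<alpha>) \<partial>lborel) \<le>
      (\<integral>\<^sup>+w. ennreal (\<bar>k w\<bar> * pn w powr \<alpha>) + ennreal (\<bar>k' w\<bar> * pn w powr \<alpha>) \<partial>lborel)"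
    by (intro nn_integral_mono)
      (auto simp: distrib_right[symmetric] ennreal_plus[symmetric] simp del: ennreal_plus intro!: ennreal_leI mult_right_mono)
  also have "\<dots> = (\<integral>\<^sup>+w. ennreal (\<bar>k w\<bar> * pn w powr \<alpha>) \<partial>lborel) + (\<integral>\<^sup>+w. ennreal (\<bar>k' w\<bar> * pn w powr \<alpha>) \<partial>lborel)"
    by (rule nn_integral_add) measurable
  also have "\<dots> \<le> ennreal A + ennreal A'"
    using k k' by (intro add_mono) (auto simp: atom_def)
  finally have "(\<integral>\<^sup>+w. ennreal (\<bar>k w + k' w\<bar> * pn w powr \<alpha>) \<partial>lborel) \<le> ennreal (A + A')" using b by simp
  moreover have "norm1 (\<lambda>z. k (z - w) + k' (z - w) - (k z + k' z)) \<le> (B + B') * pn w powr \<alpha>" for w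
  proof -
    have "(\<lambda>z. k (z - w) + k' (z - w) - (k z + k' z)) = (\<lambda>z. (k (z - w) - k z) + (k' (z - w) - k' z))" by auto
    then have "norm1 (\<lambda>z. k (z - w) + k' (z - w) - (k z + k' z)) \<le> norm1 (\<lambda>z. k (z - w) - k z) + norm1 (\<lambda>z. k' (z - w) - k' z)"
      using b by (simp only:) (intro norm1_add bddL1_diff bddL1_shift)
    also have "\<dots> \<le> B * pn w powr \<alpha> + B' * pn w powr \<alpha>" by (intro add_mono atom_smooth[OF k] atom_smooth[OF k'])
    finally show ?thesis by (simp add: distrib_right)
  qed
  ultimately show ?thesis using b by (auto simp: atom_def intro: bddL1_add)
qed

lemma atom_reflect:
  assumes k: "atom \<alpha> A B k"
  shows "atom \<alpha> A B (\<lambda>z. k (- z))"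
proof -
  have b: "k \<in> bddL1" using k by (auto simp: atom_def)
  note [measurable] = bddL1_meas[OF b]
  have "(\<integral>\<^sup>+w. ennreal (\<bar>k (- w)\<bar> * pn w powr \<alpha>) \<partial>lborel) = (\<integral>\<^sup>+w. ennreal (\<bar>k w\<bar> * pn w powr \<alpha>) \<partial>lborel)"
    using nn_integral_lborel_diff(3)[of "\<lambda>w. ennreal (\<bar>k w\<bar> * pn w powr \<alpha>)"] by simp
  moreover have "norm1 (\<lambda>z. k (- (z - w)) - k (- z)) \<le> B * pn w powr \<alpha>" for w
  proof -
    have "norm1 (\<lambda>z. k (- (z - w)) - k (- z)) = norm1 (\<lambda>z. k (z - (- w)) - k z)"
      using norm1_reflect[of "\<lambda>z. k (z - (- w)) - k z"] b by (simp add: bddL1_diff bddL1_shift bddL1_shift(1)[of k "- w", simplified] add.commute)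
    also have "\<dots> \<le> B * pn (- w) powr \<alpha>" using k unfolding atom_def by blast
    finally show ?thesis by simp
  qed
  ultimately show ?thesis using k by (auto simp: atom_def intro: bddL1_reflect)
qed

lemma conv_reflect:
  assumes "f \<in> bddL1" "g \<in> bddL1"
  shows "conv f g (- z) = conv (\<lambda>w. f (- w)) (\<lambda>w. g (- w)) z"
proof -
  note [measurable] = assms[THEN bddL1_meas]
  show ?thesis
    unfolding conv_def using integral_lborel_diff(3)[of "\<lambda>w. f w * g (- z - w)"] by (simp add: algebra_simps)
qed

lemma sum_geometric_int:
  fixes \<mu> :: real and F :: "int set"
  assumes F: "finite F" and \<mu>: "0 < \<mu>" "\<mu> < 1"
  shows "(\<Sum>j\<in>F. \<mu> ^ nat \<bar>j - i\<bar>) \<le> 2 / (1 - \<mu>)"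
proof -
  have part: "(\<Sum>j\<in>G. \<mu> ^ nat \<bar>j - i\<bar>) \<le> 1 / (1 - \<mu>)" if "finite G" "inj_on (\<lambda>j. nat \<bar>j - i\<bar>) G" for G
  proof -
    have "(\<Sum>j\<in>G. \<mu> ^ nat \<bar>j - i\<bar>) = (\<Sum>n\<in>(\<lambda>j. nat \<bar>j - i\<bar>) ` G. \<mu> ^ n)"
      using that by (simp add: sum.reindex)
    also have "\<dots> \<le> (\<Sum>n. \<mu> ^ n)"
      using that \<mu> by (intro sum_le_suminf summable_geometric) auto
    also have "\<dots> = 1 / (1 - \<mu>)" using \<mu> by (intro suminf_geometric) auto
    finally show ?thesis .
  qed
  have "(\<Sum>j\<in>F. \<mu> ^ nat \<bar>j - i\<bar>) = (\<Sum>j\<in>{j\<in>F. i \<le> j}. \<mu> ^ nat \<bar>j - i\<bar>) + (\<Sum>j\<in>{j\<in>F. \<not> i \<le> j}. \<mu> ^ nat \<bar>j - i\<bar>)"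
    using F by (subst sum.union_disjoint[symmetric]) (auto intro!: sum.cong)
  also have "\<dots> \<le> 1 / (1 - \<mu>) + 1 / (1 - \<mu>)"
    using F by (intro add_mono part) (auto simp: inj_on_def)
  finally show ?thesis by simp
qed

text \<open>Duality and Schur's test. The sum X of squares equals the inner product of
  \<open>f\<close> with \<open>W\<close>, the sum of the adjoints applied to the pieces; expanding
  the square of \<open>W\<close> gives the matrix \<open>b\<close>, whose row and column sums yield
  norm2(W)^2 \<le> D X.\<close>

lemma square_function_bound:
  fixes R :: "'i \<Rightarrow> 'a::euclidean_space \<Rightarrow> real"
  assumes I: "finite I" and R: "\<And>N. N \<in> I \<Longrightarrow> R N \<in> bddL1" and f: "f \<in> bddL1"
    and b: "\<And>N M. N \<in> I \<Longrightarrow> M \<in> I \<Longrightarrow> norm1 (conv (R N) (\<lambda>w. R M (- w))) \<le> b N M"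
    and D: "\<And>N. N \<in> I \<Longrightarrow> (\<Sum>M\<in>I. b N M) \<le> D" "\<And>M. M \<in> I \<Longrightarrow> (\<Sum>N\<in>I. b N M) \<le> D" "0 \<le> D"
  shows "(\<Sum>N\<in>I. (norm2 (conv (R N) f))\<^sup>2) \<le> D * (norm2 f)\<^sup>2"
proof -
  define u where "u N = conv (R N) f" for N
  have u: "N \<in> I \<Longrightarrow> u N \<in> bddL1" for N unfolding u_def by (intro conv_bddL1 R f)
  define g where "g N = conv (\<lambda>w. R N (- w)) (u N)" for N
  have g: "N \<in> I \<Longrightarrow> g N \<in> bddL1" for N unfolding g_def by (intro conv_bddL1 bddL1_reflect R u)
  define W where "W z = (\<Sum>N\<in>I. g N z)" for z
  have W: "W \<in> bddL1" unfolding W_def by (intro bddL1_sum g)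
  define X where "X = (\<Sum>N\<in>I. (norm2 (u N))\<^sup>2)"
  have X0: "0 \<le> X" unfolding X_def by (simp add: sum_nonneg)
  have "X = (\<Sum>N\<in>I. LINT z|lborel. f z * g N z)"
    unfolding X_def
  proof (rule sum.cong[OF refl])
    fix N assume N: "N \<in> I"
    have "(norm2 (u N))\<^sup>2 = (LINT z|lborel. conv (R N) f z * u N z)"
      unfolding norm2_sq u_def by (simp add: power2_eq_square)
    also have "\<dots> = (LINT z|lborel. f z * g N z)" unfolding g_def by (rule conv_adjoint[OF R[OF N] f u[OF N]])
    finally show "(norm2 (u N))\<^sup>2 = (LINT z|lborel. f z * g N z)" .
  qed
  also have "\<dots> = (LINT z|lborel. f z * W z)"
    unfolding W_def sum_distrib_left using f g by (subst Bochner_Integration.integral_sum) (auto intro: bddL1_int_mult)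
  also have "\<dots> \<le> norm2 f * norm2 W" using Cauchy_Schwarz_norm2'[OF f W] by linarith
  finally have 1: "X \<le> norm2 f * norm2 W" .
  have "(norm2 W)\<^sup>2 = (LINT z|lborel. (\<Sum>N\<in>I. \<Sum>M\<in>I. g N z * g M z))"
    unfolding norm2_sq W_def by (simp add: power2_eq_square sum_product)
  also have "\<dots> = (\<Sum>N\<in>I. \<Sum>M\<in>I. LINT z|lborel. g N z * g M z)"
    using g by (subst Bochner_Integration.integral_sum, fastforce intro: bddL1_int_mult Bochner_Integration.integrable_sum)
      (auto intro!: sum.cong Bochner_Integration.integral_sum bddL1_int_mult)
  also have "\<dots> \<le> (\<Sum>N\<in>I. \<Sum>M\<in>I. b N M * ((norm2 (u N))\<^sup>2 + (norm2 (u M))\<^sup>2) / 2)"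
  proof (intro sum_mono)
    fix N M assume NM: "N \<in> I" "M \<in> I"
    have "(LINT z|lborel. g N z * g M z) = (LINT z|lborel. u N z * conv (R N) (g M) z)"
      unfolding g_def[of N] using conv_adjoint[OF bddL1_reflect[OF R[OF NM(1)]] u[OF NM(1)] g[OF NM(2)]] by simp
    also have "\<dots> \<le> norm2 (u N) * norm2 (conv (R N) (g M))"
      using Cauchy_Schwarz_norm2'[OF u[OF NM(1)] conv_bddL1[OF R[OF NM(1)] g[OF NM(2)]]] by linarith
    also have "conv (R N) (g M) = conv (conv (R N) (\<lambda>w. R M (- w))) (u M)"
      unfolding g_def by (rule conv_assoc) (intro R NM bddL1_reflect u)+
    also have "norm2 \<dots> \<le> norm1 (conv (R N) (\<lambda>w. R M (- w))) * norm2 (u M)"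
      by (intro norm2_conv conv_bddL1 bddL1_reflect R u NM)
    also have "\<dots> \<le> b N M * norm2 (u M)" by (intro mult_right_mono b NM norm2_nonneg)
    finally have "(LINT z|lborel. g N z * g M z) \<le> norm2 (u N) * (b N M * norm2 (u M))"
      by (simp add: mult_left_mono norm2_nonneg)
    also have "\<dots> = b N M * (norm2 (u N) * norm2 (u M))" by (simp add: mult_ac)
    also have "\<dots> \<le> b N M * (((norm2 (u N))\<^sup>2 + (norm2 (u M))\<^sup>2) / 2)"
    proof (rule mult_left_mono)
      show "norm2 (u N) * norm2 (u M) \<le> ((norm2 (u N))\<^sup>2 + (norm2 (u M))\<^sup>2) / 2"
        using sum_squares_bound[of "norm2 (u N)" "norm2 (u M)"] by simp
      show "0 \<le> b N M" using b[OF NM] norm1_nonneg order_trans by blast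
    qed
    finally show "(LINT z|lborel. g N z * g M z) \<le> b N M * ((norm2 (u N))\<^sup>2 + (norm2 (u M))\<^sup>2) / 2" by simp
  qed
  also have "\<dots> = ((\<Sum>N\<in>I. (\<Sum>M\<in>I. b N M) * (norm2 (u N))\<^sup>2) + (\<Sum>M\<in>I. (\<Sum>N\<in>I. b N M) * (norm2 (u M))\<^sup>2)) / 2"
  proof -
    have "(\<Sum>N\<in>I. \<Sum>M\<in>I. b N M * (norm2 (u M))\<^sup>2) = (\<Sum>M\<in>I. (\<Sum>N\<in>I. b N M) * (norm2 (u M))\<^sup>2)"
      by (subst sum.swap) (simp add: sum_distrib_right)
    then show ?thesis
      by (simp add: distrib_left sum.distrib sum_distrib_right add_divide_distrib sum_divide_distrib[symmetric])
  qed
  also have "\<dots> \<le> ((\<Sum>N\<in>I. D * (norm2 (u N))\<^sup>2) + (\<Sum>M\<in>I. D * (norm2 (u M))\<^sup>2)) / 2"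
    by (intro divide_right_mono add_mono sum_mono mult_right_mono D) auto
  also have "\<dots> = D * X" unfolding X_def by (simp add: sum_distrib_left[symmetric])
  finally have 2: "(norm2 W)\<^sup>2 \<le> D * X" .
  \<comment> \<open>X \<le> norm2 f * norm2 W and norm2(W)^2 \<le> D X combine to X^2 \<le> D
    norm2(f)^2 X, from which X is cancelled.\<close>
  have "X\<^sup>2 \<le> (norm2 f * norm2 W)\<^sup>2" using 1 X0 by (intro power_mono)
  also have "\<dots> \<le> (norm2 f)\<^sup>2 * (D * X)" unfolding power_mult_distrib by (intro mult_left_mono 2) auto
  finally have "X * X \<le> (D * (norm2 f)\<^sup>2) * X" by (simp add: power2_eq_square mult_ac)
  then have "X \<le> D * (norm2 f)\<^sup>2"
    using X0 D(3) by (cases "X = 0") (auto simp: mult_le_cancel_right)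
  then show ?thesis unfolding X_def u_def .
qed

lemma bddL1_sqrt_sum:
  assumes I: "finite I" and u: "\<And>N. N \<in> I \<Longrightarrow> u N \<in> bddL1"
  shows "(\<lambda>z. sqrt (\<Sum>N\<in>I. (u N z)\<^sup>2)) \<in> bddL1"
    and "(norm2 (\<lambda>z. sqrt (\<Sum>N\<in>I. (u N z)\<^sup>2)))\<^sup>2 = (\<Sum>N\<in>I. (norm2 (u N))\<^sup>2)"
proof -
  note [measurable] = bddL1_meas[OF u]
  show "(\<lambda>z. sqrt (\<Sum>N\<in>I. (u N z)\<^sup>2)) \<in> bddL1"
  proof (rule bddL1_dom)
    show "(\<lambda>z. \<Sum>N\<in>I. \<bar>u N z\<bar>) \<in> bddL1" by (intro bddL1_sum bddL1_abs u)
    show "\<bar>sqrt (\<Sum>N\<in>I. (u N z)\<^sup>2)\<bar> \<le> (\<Sum>N\<in>I. \<bar>u N z\<bar>)" for z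
      using L2_set_le_sum_abs[of "\<lambda>N. u N z" I] by (simp add: L2_set_def sum_nonneg)
  qed measurable
  show "(norm2 (\<lambda>z. sqrt (\<Sum>N\<in>I. (u N z)\<^sup>2)))\<^sup>2 = (\<Sum>N\<in>I. (norm2 (u N))\<^sup>2)"
    unfolding norm2_sq by (simp add: sum_nonneg) (intro Bochner_Integration.integral_sum bddL1_int_sq u)
qed

section \<open>Almost orthogonality at lacunary scales\<close>

text \<open>Isolates what the L2 theory uses about the kernels: common mass, moment and smoothness
  matched to the scale, and the maximal bound for the kernels themselves. \<open>\<Lambda>\<close>
  is the gain per step of the sequence; for a \<rho>-lacunary one it becomes
  \<rho>^(-\<alpha>).\<close>

locale poisson_family =
  fixes \<alpha> \<Lambda> cm cs c0 cx :: real and k :: "int \<Rightarrow> (real ^ 'n) \<times> real \<Rightarrow> real" and a :: "int \<Rightarrow> real"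
  assumes \<alpha>: "0 < \<alpha>" and \<Lambda>: "0 < \<Lambda>" "\<Lambda> < 1"
    and cpos: "0 < cm" "0 < cs" "0 < c0" "0 < cx"
    and a_pos: "\<And>j. 0 < a j"
    and lac: "\<And>i j. i \<le> j \<Longrightarrow> (a i / a j) powr \<alpha> \<le> \<Lambda> ^ nat (j - i)"
    and k: "\<And>j. k j \<in> bddL1" and k_nonneg: "\<And>j z. 0 \<le> k j z"
    and mass: "\<And>j. (LINT w|lborel. k j w) = c0"
    and moment: "\<And>j. (\<integral>\<^sup>+w. ennreal (k j w * pn w powr \<alpha>) \<partial>lborel) \<le> ennreal (cm * a j powr \<alpha>)"
    and smooth: "\<And>j w. norm1 (\<lambda>z. k j (z - w) - k j z) \<le> cs * (pn w / a j) powr \<alpha>"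
    and maximal: "\<And>I g. finite I \<Longrightarrow> g \<in> bddL1 \<Longrightarrow>
      \<exists>U\<in>bddL1. norm2 U \<le> cx * norm2 g \<and> (\<forall>N\<in>I. \<forall>z. \<bar>conv (k N) g z\<bar> \<le> U z)"
begin

definition q :: "int \<Rightarrow> (real ^ 'n) \<times> real \<Rightarrow> real" where
  "q j z = k (j + 1) z - k j z"

lemma q: "q j \<in> bddL1"
  unfolding q_def by (intro bddL1_diff k)

lemma norm1_k: "norm1 (k j) = c0"
  unfolding norm1_def using k_nonneg mass by simp

lemma norm1_q: "norm1 (q j) \<le> 2 * c0"
  unfolding q_def using norm1_diff[OF k k, of "j + 1" j] norm1_k by simp

lemma mass_q: "(LINT w|lborel. q j w) = 0"
  unfolding q_def using bddL1_int[OF k] mass by simp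

lemma atom_k: "atom \<alpha> (cm * a j powr \<alpha>) (cs * a j powr - \<alpha>) (k j)"
proof -
  have e: "cs * (pn w / a j) powr \<alpha> = cs * a j powr - \<alpha> * pn w powr \<alpha>" for w
    using a_pos[of j] by (simp add: powr_divide powr_minus field_simps)
  have "norm1 (\<lambda>z. k j (z - w) - k j z) \<le> cs * a j powr - \<alpha> * pn w powr \<alpha>" for w
    using smooth[of j w] unfolding e[of w] .
  moreover have "(\<integral>\<^sup>+w. ennreal (\<bar>k j w\<bar> * pn w powr \<alpha>) \<partial>lborel) \<le> ennreal (cm * a j powr \<alpha>)"
    using moment[of j] k_nonneg[of j] by simp
  ultimately show ?thesis
    using k[of j] cpos unfolding atom_def by simp
qed

lemma a_mono: "i \<le> j \<Longrightarrow> a i \<le> a j"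
proof -
  assume ij: "i \<le> j"
  have "(a i / a j) powr \<alpha> \<le> 1" using lac[OF ij] \<Lambda> by (meson order.trans power_le_one less_imp_le)
  then have "a i / a j \<le> 1" using \<alpha> a_pos[of i] a_pos[of j]
    by (meson divide_pos_pos gr_one_powr not_le)
  then show ?thesis using a_pos[of j] by simp
qed

text \<open>Each constant is that of the worse of the two heights: the larger one governs the
  moment, the smaller one the smoothness. Lacunarity bounds their ratio only from below, so the two
  cannot be merged, and comparing two differences loses one step.\<close>

lemma atom_q: "atom \<alpha> (2 * cm * a (j + 1) powr \<alpha>) (2 * cs * a j powr - \<alpha>) (q j)"
proof -
  have at: "atom \<alpha> (cm * a (j + 1) powr \<alpha> + \<bar>- 1\<bar> * (cm * a j powr \<alpha>)) (cs * a (j + 1) powr - \<alpha> + \<bar>- 1\<bar> * (cs * a j powr - \<alpha>)) (q j)"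
    using atom_add[OF atom_k[of "j + 1"] atom_cmult[OF atom_k[of j], of "- 1"]] by (simp add: q_def[abs_def])
  have 1: "a j powr \<alpha> \<le> a (j + 1) powr \<alpha>" using a_mono[of j "j + 1"] a_pos[of j] \<alpha> by (intro powr_mono2) auto
  have 2: "a (j + 1) powr - \<alpha> \<le> a j powr - \<alpha>" using a_mono[of j "j + 1"] a_pos[of j] \<alpha> by (intro powr_mono2') auto
  have A: "cm * a (j + 1) powr \<alpha> + \<bar>- 1\<bar> * (cm * a j powr \<alpha>) \<le> 2 * cm * a (j + 1) powr \<alpha>"
    using 1 cpos by simp
  have B: "cs * a (j + 1) powr - \<alpha> + \<bar>- 1\<bar> * (cs * a j powr - \<alpha>) \<le> 2 * cs * a j powr - \<alpha>"
    using 2 cpos by simp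
  show ?thesis
    unfolding atom_def
  proof (intro conjI allI)
    show "(\<integral>\<^sup>+w. ennreal (\<bar>q j w\<bar> * pn w powr \<alpha>) \<partial>lborel) \<le> ennreal (2 * cm * a (j + 1) powr \<alpha>)"
      using at ennreal_leI[OF A] unfolding atom_def by (meson order.trans)
    show "norm1 (\<lambda>z. q j (z - w) - q j z) \<le> 2 * cs * a j powr - \<alpha> * pn w powr \<alpha>" for w
    proof -
      have "norm1 (\<lambda>z. q j (z - w) - q j z) \<le> (cs * a (j + 1) powr - \<alpha> + \<bar>- 1\<bar> * (cs * a j powr - \<alpha>)) * pn w powr \<alpha>"
        using at unfolding atom_def by blast
      also have "\<dots> \<le> 2 * cs * a j powr - \<alpha> * pn w powr \<alpha>" using B by (rule mult_right_mono) simp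
      finally show ?thesis .
    qed
  qed (use q cpos in auto)
qed

lemma lac': "i \<le> j \<Longrightarrow> a i powr \<alpha> * a j powr - \<alpha> \<le> \<Lambda> ^ nat (j - i)"
  using lac[of i j] a_pos[of i] a_pos[of j] by (simp add: powr_divide powr_minus field_simps)

text \<open>The first summand serves distinct indices, with division by \<Lambda> for the step lost
  between \<open>a i\<close> and \<open>a (i + 1)\<close>; the second serves equal indices, where
  only the L1 norms are used.\<close>

definition cq where "cq = 4 * cm * cs / \<Lambda> + 4 * c0\<^sup>2"

lemma cq: "0 < cq"
  unfolding cq_def using cpos \<Lambda> by (auto intro!: add_pos_pos)

lemma step_power: "i < j \<Longrightarrow> \<Lambda> ^ nat (j - (i + 1)) = \<Lambda> ^ nat (j - i) / \<Lambda>"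
proof -
  assume "i < j"
  then have "nat (j - i) = Suc (nat (j - (i + 1)))" by simp
  then show ?thesis using \<Lambda> by simp
qed

text \<open>Almost orthogonality, stated for all kernels having the size, mean value and regularity
  of \<open>q i\<close> and \<open>q j\<close>, so that it also covers reflected and symmetrised kernels.\<close>

lemma almost_orth:
  fixes p r :: "(real ^ 'n) \<times> real \<Rightarrow> real"
  assumes p: "atom \<alpha> (2 * cm * a (i + 1) powr \<alpha>) (2 * cs * a i powr - \<alpha>) p" "norm1 p \<le> 2 * c0" "(LINT w|lborel. p w) = 0"
    and r: "atom \<alpha> (2 * cm * a (j + 1) powr \<alpha>) (2 * cs * a j powr - \<alpha>) r" "norm1 r \<le> 2 * c0" "(LINT w|lborel. r w) = 0"
  shows "norm1 (conv p r) \<le> cq * \<Lambda> ^ nat \<bar>i - j\<bar>"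
proof -
  have b: "p \<in> bddL1" "r \<in> bddL1" using p r by (auto simp: atom_def)
  \<comment> \<open>Convolution commutes, so the finer kernel may be assumed to come first: its mean
    vanishes and its moment is paired with the smoothness of the coarser one.\<close>
  have lt: "norm1 (conv p r) \<le> cq * \<Lambda> ^ nat \<bar>i - j\<bar>"
    if ij: "i < j" and p: "atom \<alpha> (2 * cm * a (i + 1) powr \<alpha>) (2 * cs * a i powr - \<alpha>) p" "(LINT w|lborel. p w) = 0"
    and r: "atom \<alpha> (2 * cm * a (j + 1) powr \<alpha>) (2 * cs * a j powr - \<alpha>) r" for i j and p r :: "(real ^ 'n) \<times> real \<Rightarrow> real"
  proof -
    have "norm1 (conv p r) \<le> (2 * cm * a (i + 1) powr \<alpha>) * (2 * cs * a j powr - \<alpha>)"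
      using norm1_conv_atom[OF p(1) r] p(2) by simp
    also have "\<dots> = 4 * cm * cs * (a (i + 1) powr \<alpha> * a j powr - \<alpha>)" by simp
    also have "\<dots> \<le> 4 * cm * cs * \<Lambda> ^ nat (j - (i + 1))"
      using cpos ij by (intro mult_left_mono lac') auto
    also have "\<dots> = 4 * cm * cs / \<Lambda> * \<Lambda> ^ nat \<bar>i - j\<bar>" using ij by (simp add: step_power abs_if)
    also have "\<dots> \<le> cq * \<Lambda> ^ nat \<bar>i - j\<bar>" unfolding cq_def using \<Lambda> by (intro mult_right_mono) auto
    finally show ?thesis .
  qed
  consider "i < j" | "j < i" | "i = j" by linarith
  then show ?thesis
  proof cases
    case 1
    show ?thesis by (rule lt[OF 1 p(1,3) r(1)])
  next
    case 2
    then show ?thesis using lt[OF 2 r(1,3) p(1)] conv_commute[OF b] by (simp add: abs_minus_commute)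
  next
    case 3
    have "norm1 (conv p r) \<le> norm1 p * norm1 r" by (rule norm1_conv[OF b])
    also have "\<dots> \<le> (2 * c0) * (2 * c0)" using p r cpos by (intro mult_mono) (auto simp: norm1_nonneg)
    also have "\<dots> \<le> cq" unfolding cq_def using cpos \<Lambda> by (simp add: power2_eq_square)
    finally show ?thesis using 3 by simp
  qed
qed

lemma q_reflect:
  "atom \<alpha> (2 * cm * a (j + 1) powr \<alpha>) (2 * cs * a j powr - \<alpha>) (\<lambda>z. q j (- z))"
  "norm1 (\<lambda>z. q j (- z)) \<le> 2 * c0" "(LINT w|lborel. q j (- w)) = 0"
  using atom_reflect[OF atom_q] norm1_reflect[OF q, of j] norm1_q[of j]
    integral_lborel_diff(3)[OF bddL1_meas[OF q], of j] mass_q[of j] by auto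

text \<open>Cotlar-Stein sums square roots of the norms of products, so the decay per index is only
  the square root of \<Lambda>.\<close>

definition \<mu> where "\<mu> = sqrt \<Lambda>"

lemma \<mu>: "0 < \<mu>" "\<mu> < 1" "\<mu> ^ i * \<mu> ^ i = \<Lambda> ^ i"
  unfolding \<mu>_def using \<Lambda> by (auto simp: power_mult_distrib[symmetric])

definition ct where "ct = 2 * (sqrt cq * (2 / (1 - \<mu>)))"

lemma ct: "0 < ct"
  unfolding ct_def using cq \<mu> by simp

text \<open>Averaging with the reflected kernel keeps the mean zero and all constants of
  \<open>q j\<close>, hence \<open>almost_orth\<close> applies to the even part
  (\<open>\<sigma>\<close> = 1) and the odd part (\<open>\<sigma>\<close> = -1) alike.\<close>

lemma sym_part_bound:
  assumes F: "finite F" and v: "\<And>j. j \<in> F \<Longrightarrow> \<bar>v j\<bar> \<le> 1" and f: "f \<in> bddL1" and \<sigma>: "\<bar>\<sigma>\<bar> = 1"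
  shows "norm2 (conv (\<lambda>z. \<Sum>j\<in>F. v j * ((1/2) * (q j z + \<sigma> * q j (- z)))) f) \<le> (sqrt cq * (2 / (1 - \<mu>))) * norm2 f"
proof -
  define p where "p j z = (1/2) * (q j z + \<sigma> * q j (- z))" for j z
  have p: "p j \<in> bddL1" for j
    unfolding p_def by (intro bddL1_cmult bddL1_add q bddL1_reflect)
  have at: "atom \<alpha> (2 * cm * a (j + 1) powr \<alpha>) (2 * cs * a j powr - \<alpha>) (p j)" for j
    using atom_cmult[OF atom_add[OF atom_q[of j] atom_cmult[OF q_reflect(1)[of j], of \<sigma>]], of "1/2"] \<sigma>
    by (simp add: p_def[abs_def] mult.assoc)
  have n1: "norm1 (p j) \<le> 2 * c0" for j
  proof -
    have "norm1 (p j) \<le> (1/2) * (norm1 (q j) + norm1 (\<lambda>z. \<sigma> * q j (- z)))"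
      unfolding p_def[abs_def] norm1_cmult[of "1/2"]
      using norm1_add[OF q[of j] bddL1_cmult[OF bddL1_reflect[OF q[of j]], of \<sigma>]] by simp
    then show ?thesis using norm1_q[of j] q_reflect(2)[of j] \<sigma> by (simp add: norm1_cmult)
  qed
  have m0: "(LINT w|lborel. p j w) = 0" for j
    unfolding p_def using bddL1_int[OF q[of j]] bddL1_int[OF bddL1_reflect[OF q[of j]]] mass_q[of j] q_reflect(3)[of j] by simp
  interpret almost_orthogonal F p \<sigma> "2 * c0" "sqrt cq * (2 / (1 - \<mu>))" "\<lambda>i j. sqrt cq * \<mu> ^ nat \<bar>i - j\<bar>" v
  proof
    fix i z show "p i (- z) = \<sigma> * p i z"
      using \<sigma> unfolding p_def by (auto simp: abs_if algebra_simps split: if_splits)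
  next
    fix i j assume "i \<in> F" "j \<in> F"
    have "norm1 (conv (p i) (p j)) \<le> cq * \<Lambda> ^ nat \<bar>i - j\<bar>"
      by (intro almost_orth at n1 m0)
    also have "\<dots> = (sqrt cq * \<mu> ^ nat \<bar>i - j\<bar>)\<^sup>2"
      using cq by (simp add: power_mult_distrib power2_eq_square[of "\<mu> ^ _"] \<mu>)
    finally show "norm1 (conv (p i) (p j)) \<le> (sqrt cq * \<mu> ^ nat \<bar>i - j\<bar>)\<^sup>2" .
  next
    fix i assume "i \<in> F"
    show "(\<Sum>j\<in>F. sqrt cq * \<mu> ^ nat \<bar>j - i\<bar>) \<le> sqrt cq * (2 / (1 - \<mu>))"
      unfolding sum_distrib_left[symmetric] using cq \<mu> by (intro mult_left_mono sum_geometric_int F) auto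
  qed (use F v p n1 cpos \<sigma> cq \<mu> in auto)
  show ?thesis using cotlar_stein[OF f] unfolding K_def p_def .
qed

theorem uniform_L2_bound:
  assumes F: "finite F" and v: "\<And>j. j \<in> F \<Longrightarrow> \<bar>v j\<bar> \<le> 1" and f: "f \<in> bddL1"
  shows "norm2 (conv (\<lambda>z. \<Sum>j\<in>F. v j * q j z) f) \<le> ct * norm2 f"
proof -
  let ?S = "\<lambda>\<sigma> z. \<Sum>j\<in>F. v j * ((1/2) * (q j z + \<sigma> * q j (- z)))"
  have S: "?S \<sigma> \<in> bddL1" for \<sigma> by (intro bddL1_sum bddL1_cmult bddL1_add q bddL1_reflect)
  have "(\<lambda>z. \<Sum>j\<in>F. v j * q j z) = (\<lambda>z. ?S 1 z + ?S (- 1) z)"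
    by (auto simp: sum.distrib[symmetric] algebra_simps)
  then have "conv (\<lambda>z. \<Sum>j\<in>F. v j * q j z) f = (\<lambda>z. conv (?S 1) f z + conv (?S (- 1)) f z)"
    using conv_add_left[OF S[of 1] S[of "- 1"] f] by auto
  then have "norm2 (conv (\<lambda>z. \<Sum>j\<in>F. v j * q j z) f) \<le> norm2 (conv (?S 1) f) + norm2 (conv (?S (- 1)) f)"
    using norm2_add[OF conv_bddL1[OF S[of 1] f] conv_bddL1[OF S[of "- 1"] f]] by simp
  also have "norm2 (conv (?S 1) f) \<le> (sqrt cq * (2 / (1 - \<mu>))) * norm2 f"
    by (rule sym_part_bound[OF F _ f]) (use v in auto)
  also have "norm2 (conv (?S (- 1)) f) \<le> (sqrt cq * (2 / (1 - \<mu>))) * norm2 f"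
    by (rule sym_part_bound[OF F _ f]) (use v in auto)
  finally show ?thesis unfolding ct_def by (simp add: algebra_simps)
qed

section \<open>Comparison of tail sums with averages of the full sum\<close>

definition A :: "int \<Rightarrow> (real ^ 'n) \<times> real \<Rightarrow> real" where
  "A N z = (1 / c0) * k N z"

lemma A: "A N \<in> bddL1" "norm1 (A N) = 1" "(LINT w|lborel. A N w) = 1"
    "atom \<alpha> (cm / c0 * a N powr \<alpha>) (cs / c0 * a N powr - \<alpha>) (A N)"
proof -
  show "A N \<in> bddL1" unfolding A_def by (intro bddL1_cmult k)
  show "norm1 (A N) = 1" unfolding A_def[abs_def] using norm1_cmult[of "1 / c0" "k N"] norm1_k cpos by simp
  show "(LINT w|lborel. A N w) = 1" unfolding A_def using mass cpos by simp
  show "atom \<alpha> (cm / c0 * a N powr \<alpha>) (cs / c0 * a N powr - \<alpha>) (A N)"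
    using atom_cmult[OF atom_k[of N], of "1 / c0"] cpos by (simp add: A_def[abs_def])
qed

text \<open>The error in replacing the sharp cut-off j \<ge> N by smoothing with \<open>A N\<close>,
  seen on the single piece \<open>q j\<close>.\<close>

definition R :: "int \<Rightarrow> int \<Rightarrow> (real ^ 'n) \<times> real \<Rightarrow> real" where
  "R N j z = (if N \<le> j then 1 else 0) * q j z - conv (A N) (q j) z"

lemma R: "R N j \<in> bddL1"
  unfolding R_def[abs_def] by (intro bddL1_diff bddL1_cmult conv_bddL1 A q)

lemma conv_R:
  assumes "h \<in> bddL1"
  shows "conv (R N j) h z = (if N \<le> j then 1 else 0) * conv (q j) h z - conv (A N) (conv (q j) h) z"
  using assms unfolding R_def[abs_def]
  by (subst conv_diff_left) (auto intro!: bddL1_cmult conv_bddL1 bddL1_zero A q simp: conv_cmult_left conv_assoc A q)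

definition cr where "cr = 2 * cm * cs / c0 / \<Lambda>"

lemma cr: "0 < cr"
  unfolding cr_def using cpos \<Lambda> by simp

text \<open>For j \<ge> N the kernel \<open>A N\<close> has mass one and a finer scale than
  \<open>q j\<close>, which it hardly changes; for j < N it is smooth at the scale of
  \<open>q j\<close> and nearly annihilates it because \<open>q j\<close> has mean zero.\<close>

lemma norm1_R: "norm1 (R N j) \<le> cr * \<Lambda> ^ nat \<bar>j - N\<bar>"
proof (cases "N \<le> j")
  case True
  have "norm1 (\<lambda>z. conv (A N) (q j) z - q j z) \<le> (cm / c0 * a N powr \<alpha>) * (2 * cs * a j powr - \<alpha>)"
    using norm1_conv_atom[OF A(4)[of N] atom_q[of j]] A(3)[of N] by simp
  also have "\<dots> = 2 * cm * cs / c0 * (a N powr \<alpha> * a j powr - \<alpha>)" by simp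
  also have "\<dots> \<le> 2 * cm * cs / c0 * \<Lambda> ^ nat (j - N)" using cpos True by (intro mult_left_mono lac') auto
  also have "\<dots> \<le> cr * \<Lambda> ^ nat (j - N)"
  proof (rule mult_right_mono)
    have "2 * cm * cs / c0 * 1 \<le> 2 * cm * cs / c0 * (1 / \<Lambda>)" using cpos \<Lambda> by (intro mult_left_mono) auto
    then show "2 * cm * cs / c0 \<le> cr" unfolding cr_def by simp
  qed (use \<Lambda> in simp)
  finally have "norm1 (\<lambda>z. conv (A N) (q j) z - q j z) \<le> cr * \<Lambda> ^ nat \<bar>j - N\<bar>" using True by simp
  moreover have "norm1 (R N j) = norm1 (\<lambda>z. conv (A N) (q j) z - q j z)"
    unfolding norm1_def R_def using True by (simp add: abs_minus_commute)
  ultimately show ?thesis by simp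
next
  case False
  have "norm1 (conv (A N) (q j)) = norm1 (conv (q j) (A N))" using conv_commute[OF A(1) q, of N j] by simp
  also have "\<dots> \<le> (2 * cm * a (j + 1) powr \<alpha>) * (cs / c0 * a N powr - \<alpha>)"
    using norm1_conv_atom[OF atom_q[of j] A(4)[of N]] mass_q[of j] by simp
  also have "\<dots> = 2 * cm * cs / c0 * (a (j + 1) powr \<alpha> * a N powr - \<alpha>)" by simp
  also have "\<dots> \<le> 2 * cm * cs / c0 * \<Lambda> ^ nat (N - (j + 1))" using cpos False by (intro mult_left_mono lac') auto
  also have "\<dots> = cr * \<Lambda> ^ nat \<bar>j - N\<bar>" using False by (simp add: step_power cr_def abs_if)
  finally have "norm1 (conv (A N) (q j)) \<le> cr * \<Lambda> ^ nat \<bar>j - N\<bar>" .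
  moreover have "norm1 (R N j) = norm1 (conv (A N) (q j))"
    unfolding norm1_def R_def using False by simp
  ultimately show ?thesis by simp
qed

lemma norm1_conv_R_left:
  assumes h: "h \<in> bddL1"
  shows "norm1 (conv (R N j) h) \<le> 2 * norm1 (conv (q j) h)"
proof -
  have qh: "conv (q j) h \<in> bddL1" by (intro conv_bddL1 q h)
  have "norm1 (conv (R N j) h) = norm1 (\<lambda>z. (if N \<le> j then 1 else 0) * conv (q j) h z - conv (A N) (conv (q j) h) z)"
    using conv_R[OF h] by presburger
  also have "\<dots> \<le> norm1 (\<lambda>z. (if N \<le> j then 1 else 0) * conv (q j) h z) + norm1 (conv (A N) (conv (q j) h))"
    by (intro norm1_diff bddL1_cmult conv_bddL1 A qh q h)
  also have "norm1 (\<lambda>z. (if N \<le> j then 1 else 0) * conv (q j) h z) \<le> norm1 (conv (q j) h)"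
    by (subst norm1_cmult) (auto simp: norm1_nonneg)
  also have "norm1 (conv (A N) (conv (q j) h)) \<le> norm1 (conv (q j) h)"
    using norm1_conv[OF A(1) qh, of N] A(2)[of N] by simp
  finally show ?thesis by simp
qed

text \<open>\<open>R N i\<close> acts on a function as a combination of \<open>q i\<close> and its
  smoothing by a kernel of norm one. Each of the two \<open>R\<close> can therefore be exchanged for
  its \<open>q\<close> at the price of a factor 2, and the orthogonality of the \<open>q\<close> is
  inherited.\<close>

lemma norm1_conv_R_R:
  "norm1 (conv (R N i) (\<lambda>w. R M j (- w))) \<le> 4 * cq * \<Lambda> ^ nat \<bar>i - j\<bar>"
proof -
  have rq: "(\<lambda>w. q i (- w)) \<in> bddL1" for i by (rule bddL1_reflect[OF q])
  have rR: "(\<lambda>w. R M j (- w)) \<in> bddL1" by (rule bddL1_reflect[OF R])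
  have "norm1 (conv (R N i) (\<lambda>w. R M j (- w))) \<le> 2 * norm1 (conv (q i) (\<lambda>w. R M j (- w)))"
    by (rule norm1_conv_R_left[OF rR])
  also have "norm1 (conv (q i) (\<lambda>w. R M j (- w))) = norm1 (conv (R M j) (\<lambda>w. q i (- w)))"
  proof -
    have "conv (q i) (\<lambda>w. R M j (- w)) z = conv (R M j) (\<lambda>w. q i (- w)) (- z)" for z
      using conv_reflect[OF R[of M j] rq[of i], of z] conv_commute[OF q[of i] rR] by simp
    then have "norm1 (conv (q i) (\<lambda>w. R M j (- w))) = norm1 (\<lambda>z. conv (R M j) (\<lambda>w. q i (- w)) (- z))"
      by presburger
    then show ?thesis using norm1_reflect[OF conv_bddL1[OF R rq]] by simp
  qed
  also have "\<dots> \<le> 2 * norm1 (conv (q j) (\<lambda>w. q i (- w)))" by (rule norm1_conv_R_left[OF rq])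
  also have "norm1 (conv (q j) (\<lambda>w. q i (- w))) \<le> cq * \<Lambda> ^ nat \<bar>j - i\<bar>"
    by (intro almost_orth atom_q norm1_q mass_q q_reflect)
  finally show ?thesis by (simp add: abs_minus_commute)
qed

text \<open>First summand: the maximal bound for the normalised kernels applied to the full sum.
  Second summand: the square functions of the diagonals, geometric in the distance to the main
  diagonal and summed.\<close>

definition cu where "cu = cx / c0 * ct + sqrt (2 * cr * sqrt cq * (2 / (1 - \<mu>))) * (2 / (1 - \<mu>))"

lemma cu: "0 < cu"
  unfolding cu_def using cpos ct cr cq \<mu> by (intro add_pos_pos mult_pos_pos) auto

text \<open>Comparison of the tail sums with \<open>A N\<close> applied to the full sum: on each diagonal
  \<open>j - N = l\<close> the errors form a square function whose norm decays geometrically in \<open>l\<close>.\<close>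

theorem maximal_tail_sums:
  assumes v: "\<And>j. \<bar>v j\<bar> \<le> 1" and f: "f \<in> bddL1"
  shows "\<exists>U\<in>bddL1. norm2 U \<le> cu * norm2 f \<and>
    (\<forall>N\<in>{- m..m + 1}. \<forall>z. \<bar>\<Sum>j = N..m. v j * conv (q j) f z\<bar> \<le> U z)"
proof -
  define I where "I = {- m..m + 1}"
  define J where "J = {- m..m}"
  \<comment> \<open>All values of j - N for N in \<open>I\<close> and j in \<open>J\<close>.\<close>
  define LL where "LL = {- 2 * m - 1..2 * m}"
  have fin: "finite I" "finite J" "finite LL" unfolding I_def J_def LL_def by auto
  define K where "K z = (\<Sum>j\<in>J. v j * q j z)" for z
  have K: "K \<in> bddL1" unfolding K_def by (intro bddL1_sum bddL1_cmult q)
  define g where "g = conv K f"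
  have g: "g \<in> bddL1" unfolding g_def by (intro conv_bddL1 K f)
  have ng: "norm2 g \<le> ct * norm2 f"
    unfolding g_def K_def[abs_def] by (rule uniform_L2_bound[OF fin(2) _ f]) (use v in auto)
  obtain U0 where U0: "U0 \<in> bddL1" "norm2 U0 \<le> cx * norm2 g" "\<And>N z. N \<in> I \<Longrightarrow> \<bar>conv (k N) g z\<bar> \<le> U0 z"
    using maximal[OF fin(1) g] by blast
  define Il where "Il l = {N\<in>I. N + l \<in> J}" for l
  have finl: "finite (Il l)" for l unfolding Il_def using fin by simp
  define w where "w l N z = v (N + l) * conv (R N (N + l)) f z" for l N z
  have w: "w l N \<in> bddL1" for l N unfolding w_def[abs_def] by (intro bddL1_cmult conv_bddL1 R f)
  define u where "u l z = sqrt (\<Sum>N\<in>Il l. (w l N z)\<^sup>2)" for l z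
  have u: "u l \<in> bddL1" for l unfolding u_def[abs_def] by (rule bddL1_sqrt_sum(1)) (use finl w in auto)
  define d where "d = 2 * cr * sqrt cq * (2 / (1 - \<mu>))"
  have d: "0 < d" unfolding d_def using cr cq \<mu> by simp
  have nu: "norm2 (u l) \<le> sqrt d * norm2 f * \<mu> ^ nat \<bar>l - 0\<bar>" for l
  proof -
    define b where "b N M = 2 * cr * sqrt cq * \<Lambda> ^ nat \<bar>l\<bar> * \<mu> ^ nat \<bar>N - M\<bar>" for N M :: int
    have bnd: "norm1 (conv (R N (N + l)) (\<lambda>w. R M (M + l) (- w))) \<le> b N M" for N M
    proof (rule power2_le_imp_le)
      let ?x = "norm1 (conv (R N (N + l)) (\<lambda>w. R M (M + l) (- w)))"
      have "?x \<le> norm1 (R N (N + l)) * norm1 (\<lambda>w. R M (M + l) (- w))"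
        by (intro norm1_conv R bddL1_reflect)
      also have "\<dots> \<le> (cr * \<Lambda> ^ nat \<bar>l\<bar>) * (cr * \<Lambda> ^ nat \<bar>l\<bar>)"
        using norm1_R[of N "N + l"] norm1_R[of M "M + l"] norm1_reflect[OF R] cr \<Lambda>
        by (intro mult_mono) (auto simp: norm1_nonneg)
      finally have 1: "?x \<le> (cr * \<Lambda> ^ nat \<bar>l\<bar>) * (cr * \<Lambda> ^ nat \<bar>l\<bar>)" .
      have 2: "?x \<le> 4 * cq * \<Lambda> ^ nat \<bar>N - M\<bar>" using norm1_conv_R_R[of N "N + l" M "M + l"] by simp
      \<comment> \<open>The first bound decays in \<open>l\<close> but not in N - M, the second one
        the other way round; their geometric mean decays in both.\<close>
      have "?x\<^sup>2 \<le> ((cr * \<Lambda> ^ nat \<bar>l\<bar>) * (cr * \<Lambda> ^ nat \<bar>l\<bar>)) * (4 * cq * \<Lambda> ^ nat \<bar>N - M\<bar>)"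
        unfolding power2_eq_square using 1 2 cr \<Lambda> by (intro mult_mono) (auto simp: norm1_nonneg)
      also have "\<dots> = (2 * cr * sqrt cq * \<Lambda> ^ nat \<bar>l\<bar> * \<mu> ^ nat \<bar>N - M\<bar>)\<^sup>2"
        using cq \<mu>(3)[of "nat \<bar>N - M\<bar>"] by (simp add: power_mult_distrib power2_eq_square mult_ac)
      finally show "?x\<^sup>2 \<le> (b N M)\<^sup>2" unfolding b_def .
      show "0 \<le> b N M" unfolding b_def using cr cq \<Lambda> \<mu> by simp
    qed
    define D where "D = d * \<Lambda> ^ nat \<bar>l\<bar>"
    have col: "(\<Sum>N\<in>Il l. b N M) \<le> D" for M
    proof -
      have "(\<Sum>N\<in>Il l. b N M) = 2 * cr * sqrt cq * \<Lambda> ^ nat \<bar>l\<bar> * (\<Sum>N\<in>Il l. \<mu> ^ nat \<bar>N - M\<bar>)"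
        unfolding b_def by (simp add: sum_distrib_left)
      also have "\<dots> \<le> 2 * cr * sqrt cq * \<Lambda> ^ nat \<bar>l\<bar> * (2 / (1 - \<mu>))"
        using cr cq \<Lambda> \<mu> by (intro mult_left_mono sum_geometric_int finl) auto
      finally show ?thesis unfolding D_def d_def by (simp add: mult_ac)
    qed
    have bsym: "b N M = b M N" for N M unfolding b_def by (simp add: abs_minus_commute)
    have "(norm2 (u l))\<^sup>2 = (\<Sum>N\<in>Il l. (norm2 (w l N))\<^sup>2)"
      unfolding u_def[abs_def] by (rule bddL1_sqrt_sum(2)) (use finl w in auto)
    also have "\<dots> \<le> (\<Sum>N\<in>Il l. (norm2 (conv (R N (N + l)) f))\<^sup>2)"
    proof (intro sum_mono power_mono norm2_nonneg)
      fix N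
      show "norm2 (w l N) \<le> norm2 (conv (R N (N + l)) f)"
        unfolding w_def[abs_def] norm2_cmult using v[of "N + l"] norm2_nonneg[of "conv (R N (N + l)) f"]
        by (simp add: mult_left_le_one_le)
    qed
    also have "\<dots> \<le> D * (norm2 f)\<^sup>2"
    proof (rule square_function_bound[OF finl R f])
      show "norm1 (conv (R N (N + l)) (\<lambda>w. R M (M + l) (- w))) \<le> b N M" for N M by (rule bnd)
      show "(\<Sum>N\<in>Il l. b N M) \<le> D" for M by (rule col)
      show "(\<Sum>M\<in>Il l. b N M) \<le> D" for N using col[of N] bsym[of N] by simp
      show "0 \<le> D" unfolding D_def using d \<Lambda> by simp
    qed
    also have "\<dots> = (sqrt d * norm2 f * \<mu> ^ nat \<bar>l - 0\<bar>)\<^sup>2"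
      unfolding D_def using d \<mu>(3)[of "nat \<bar>l\<bar>"] by (simp add: power_mult_distrib power2_eq_square mult_ac)
    finally show ?thesis
      by (rule power2_le_imp_le) (use d \<mu> norm2_nonneg[of f] in auto)
  qed
  define U where "U z = (1 / c0) * U0 z + (\<Sum>l\<in>LL. u l z)" for z
  have U: "U \<in> bddL1" unfolding U_def[abs_def] by (intro bddL1_add bddL1_cmult bddL1_sum U0 u)
  have "norm2 U \<le> norm2 (\<lambda>z. (1 / c0) * U0 z) + norm2 (\<lambda>z. \<Sum>l\<in>LL. u l z)"
    unfolding U_def[abs_def] by (intro norm2_add bddL1_cmult bddL1_sum U0 u)
  also have "norm2 (\<lambda>z. (1 / c0) * U0 z) \<le> (1 / c0) * (cx * (ct * norm2 f))"
  proof -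
    have "norm2 U0 \<le> cx * (ct * norm2 f)" using U0(2) mult_left_mono[OF ng, of cx] cpos by linarith
    then have "(1 / c0) * norm2 U0 \<le> (1 / c0) * (cx * (ct * norm2 f))" using cpos by (intro mult_left_mono) auto
    then show ?thesis using norm2_cmult[of "1 / c0" U0] cpos by simp
  qed
  also have "norm2 (\<lambda>z. \<Sum>l\<in>LL. u l z) \<le> (\<Sum>l\<in>LL. sqrt d * norm2 f * \<mu> ^ nat \<bar>l - 0\<bar>)"
    by (rule order.trans[OF norm2_sum sum_mono]) (use u nu in auto)
  also have "\<dots> \<le> sqrt d * norm2 f * (2 / (1 - \<mu>))"
    unfolding sum_distrib_left[symmetric] using d \<mu> norm2_nonneg[of f]
    by (intro mult_left_mono sum_geometric_int fin) auto
  finally have nU: "norm2 U \<le> cu * norm2 f" unfolding cu_def d_def by (simp add: algebra_simps)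
  have main: "\<bar>\<Sum>j = N..m. v j * conv (q j) f z\<bar> \<le> U z" if N: "N \<in> I" for N z
  proof -
    have cA: "conv (A N) g z = (\<Sum>j\<in>J. v j * conv (A N) (conv (q j) f) z)"
    proof -
      have "g = (\<lambda>z. \<Sum>j\<in>J. v j * conv (q j) f z)"
        unfolding g_def K_def[abs_def]
        by (rule ext, subst conv_sum_left) (auto intro!: bddL1_cmult q f simp: conv_cmult_left)
      then have "conv g (A N) z = (\<Sum>j\<in>J. v j * conv (conv (q j) f) (A N) z)"
        by (simp only:, subst conv_sum_left) (auto intro!: bddL1_cmult conv_bddL1 q f A simp: conv_cmult_left)
      then show ?thesis using conv_commute[OF g A(1), of N] conv_commute[OF conv_bddL1[OF q f] A(1)] by simp
    qed
    have sumN: "(\<Sum>j = N..m. v j * conv (q j) f z) = (\<Sum>j\<in>J. v j * ((if N \<le> j then 1 else 0) * conv (q j) f z))"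
      using N fin unfolding I_def J_def by (intro sum.mono_neutral_cong_left) auto
    have "(\<Sum>j = N..m. v j * conv (q j) f z) = conv (A N) g z + (\<Sum>j\<in>J. v j * conv (R N j) f z)"
      unfolding sumN cA sum.distrib[symmetric] conv_R[OF f] by (intro sum.cong) (auto simp: algebra_simps)
    moreover have "\<bar>conv (A N) g z\<bar> \<le> (1 / c0) * U0 z"
    proof -
      have "conv (A N) g z = (1 / c0) * conv (k N) g z"
        unfolding A_def[abs_def] by (rule conv_cmult_left)
      then show ?thesis using U0(3)[OF N, of z] cpos by (simp add: abs_mult divide_right_mono)
    qed
    moreover have "\<bar>\<Sum>j\<in>J. v j * conv (R N j) f z\<bar> \<le> (\<Sum>l\<in>LL. u l z)"
    proof -
      have "\<bar>\<Sum>j\<in>J. v j * conv (R N j) f z\<bar> \<le> (\<Sum>j\<in>J. \<bar>v j * conv (R N j) f z\<bar>)" by (rule sum_abs)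
      also have "\<dots> \<le> (\<Sum>j\<in>J. u (j - N) z)"
      proof (rule sum_mono)
        fix j assume j: "j \<in> J"
        have "N \<in> Il (j - N)" unfolding Il_def using N j by simp
        then have "(w (j - N) N z)\<^sup>2 \<le> (\<Sum>N'\<in>Il (j - N). (w (j - N) N' z)\<^sup>2)"
          using member_le_sum[of N "Il (j - N)" "\<lambda>N'. (w (j - N) N' z)\<^sup>2"] finl[of "j - N"] by simp
        then have "sqrt ((w (j - N) N z)\<^sup>2) \<le> u (j - N) z" unfolding u_def by (simp only: real_sqrt_le_iff)
        then show "\<bar>v j * conv (R N j) f z\<bar> \<le> u (j - N) z" by (simp add: w_def)
      qed
      also have "\<dots> = (\<Sum>l\<in>(\<lambda>j. j - N) ` J. u l z)" by (subst sum.reindex) (auto simp: inj_on_def)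
      also have "\<dots> \<le> (\<Sum>l\<in>LL. u l z)"
        using N by (intro sum_mono2 fin) (auto simp: I_def J_def LL_def u_def sum_nonneg)
      finally show ?thesis .
    qed
    ultimately show ?thesis unfolding U_def by linarith
  qed
  show ?thesis using U nU main unfolding I_def by blast
qed

end

section \<open>Averages over cylinders\<close>

lemma lebesgue_measurable_AE_eq:
  fixes f g :: "'a::euclidean_space \<Rightarrow> real"
  assumes g: "g \<in> borel_measurable lebesgue" and eq: "AE x in lebesgue. f x = g x"
  shows "f \<in> borel_measurable lebesgue"
proof (rule measurableI)
  fix A :: "real set" assume A: "A \<in> sets borel"
  show "f -` A \<inter> space lebesgue \<in> sets lebesgue"
  proof (rule completion.in_sets_AE)
    show "AE x in lebesgue. (x \<in> g -` A \<inter> space lebesgue) = (x \<in> f -` A \<inter> space lebesgue)"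
      using eq by eventually_elim auto
    show "g -` A \<inter> space lebesgue \<in> sets lebesgue" using g A by (rule measurable_sets)
  qed auto
qed simp

text \<open>Completeness of Lebesgue measure transfers measurability from \<open>g\<close> to
  \<open>f\<close>. This is made for time slices of a function, which are known only through their
  agreement almost everywhere with slices of a Borel function.\<close>

lemma lebesgue_integral_AE_cong:
  fixes f g :: "'a::euclidean_space \<Rightarrow> real"
  assumes [measurable]: "g \<in> borel_measurable borel" and eq: "AE x in lborel. f x = g x"
  shows "(LINT x|lebesgue. f x) = (LINT x|lborel. g x)"
proof -
  have g: "g \<in> borel_measurable lebesgue" by (rule measurable_completion) simp
  have eq': "AE x in lebesgue. f x = g x" using eq by (rule AE_completion)
  have "(LINT x|lebesgue. f x) = (LINT x|lebesgue. g x)"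
    by (rule integral_cong_AE[OF lebesgue_measurable_AE_eq[OF g eq'] g eq'])
  also have "\<dots> = (LINT x|lborel. g x)" by (rule integral_completion) simp
  finally show ?thesis .
qed

text \<open>The exceptional null set, pulled back by w -> z - w, is again null, so almost every time
  slice of it is null and the iterated integral sees only \<open>F\<close>. Since this works for
  each fixed \<open>z\<close>, the equality holds at every point.\<close>

lemma frac_poisson_eq_conv:
  fixes f F :: "(real ^ 'n) \<times> real \<Rightarrow> real"
  assumes \<alpha>: "0 < \<alpha>" "\<alpha> < 1" and \<tau>: "0 < \<tau>" and F: "F \<in> bddL1" and eq: "AE z in lborel. f z = F z"
  shows "frac_poisson \<alpha> \<tau> f z = conv (kern \<alpha> \<tau>) F z"
proof -
  obtain x t where z: "z = (x, t)" by (cases z)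
  obtain N where N: "N \<in> null_sets lborel" "{w. f w \<noteq> F w} \<subseteq> N"
  proof -
    obtain N where "\<And>w. w \<in> space lborel - N \<Longrightarrow> f w = F w" "N \<in> null_sets lborel" using AE_E3[OF eq] by blast
    then show ?thesis
      by (intro that[of N] subsetI) (assumption, metis (mono_tags, lifting) Diff_iff UNIV_I mem_Collect_eq space_borel space_lborel)
  qed
  have Ns: "N \<in> sets borel" using N by auto
  then have [measurable]: "N \<in> sets (borel \<Otimes>\<^sub>M borel)" by (simp only: borel_prod)
  note [measurable] = bddL1_meas[OF F] bddL1_meas[OF kern_bddL1[OF \<alpha> \<tau>]]
  have [measurable]: "F \<in> borel_measurable (borel \<Otimes>\<^sub>M borel)" "kern \<alpha> \<tau> \<in> borel_measurable (borel \<Otimes>\<^sub>M borel :: ((real ^ 'n) \<times> real) measure)"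
    using bddL1_meas[OF F] bddL1_meas[OF kern_bddL1[OF \<alpha> \<tau>]] by (auto simp: borel_prod)
  have "AE w in lborel. w \<notin> N" by (rule AE_not_in[OF N(1)])
  then have "AE w in distr lborel borel (\<lambda>w. z - w). w \<notin> N" by (simp only: distr_lborel_diff)
  then have "AE w in lborel. z - w \<notin> N" using Ns by (subst (asm) AE_distr_iff) auto
  then have "AE w in lborel \<Otimes>\<^sub>M lborel. z - w \<notin> N" by (simp only: lborel_prod)
  then have "AE y in lborel. AE s in lborel. z - (y, s) \<notin> N" by (rule lborel_pair.AE_pair)
  \<comment> \<open>The product measure gives slices at fixed y first; they are exchanged because
    the operator integrates over space at fixed time.\<close>
  then have good: "AE s in lborel. AE y in lborel. z - (y, s) \<notin> N"
  proof (subst (asm) lborel_pair.AE_commute)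
    have "{w. z - w \<notin> N} \<in> sets borel" using Ns by measurable
    then show "{w \<in> space (lborel \<Otimes>\<^sub>M lborel). z - (fst w, snd w) \<notin> N} \<in> sets (lborel \<Otimes>\<^sub>M lborel)"
      unfolding lborel_prod by simp
  qed
  define c where "c = \<tau> powr (2 * \<alpha>) / (4 powr \<alpha> * Gamma \<alpha>)"
  define H where "H s = (LINT y|lborel. kern \<alpha> \<tau> (y, s) * F (x - y, t - s))" for s
  have [measurable]: "H \<in> borel_measurable borel" unfolding H_def by measurable
  have kern_eq: "kern \<alpha> \<tau> (y, s) = c * (exp (- (\<tau>\<^sup>2 + (norm y)\<^sup>2) / (4 * s)) / (4 * pi * s) powr (real CARD('n) / 2)) / s powr (1 + \<alpha>)"
    if "0 < s" for y :: "real ^ 'n" and s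
  proof -
    have "s powr - (1 + \<alpha> + real CARD('n) / 2) = 1 / (s powr (1 + \<alpha>) * s powr (real CARD('n) / 2))"
      by (simp only: powr_add[symmetric] powr_minus_divide[symmetric])
    then show ?thesis
      using that unfolding kern_def E_def c_def by (simp add: powr_mult)
  qed
  have "frac_poisson \<alpha> \<tau> f z = c * (LINT s|lebesgue. indicator {0<..} s *\<^sub>R
      ((LINT y|lebesgue. exp (- (\<tau>\<^sup>2 + (norm y)\<^sup>2) / (4 * s)) / (4 * pi * s) powr (real CARD('n) / 2) * f (x - y, t - s)) / s powr (1 + \<alpha>)))"
    unfolding frac_poisson_def z c_def set_lebesgue_integral_def by simp
  also have "\<dots> = (LINT s|lebesgue. c * (indicator {0<..} s *\<^sub>R
      ((LINT y|lebesgue. exp (- (\<tau>\<^sup>2 + (norm y)\<^sup>2) / (4 * s)) / (4 * pi * s) powr (real CARD('n) / 2) * f (x - y, t - s)) / s powr (1 + \<alpha>))))"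
    by (rule integral_mult_right_zero[symmetric])
  also have "\<dots> = (LINT s|lborel. H s)"
  proof (rule lebesgue_integral_AE_cong)
    show "AE s in lborel. c * (indicator {0<..} s *\<^sub>R
      ((LINT y|lebesgue. exp (- (\<tau>\<^sup>2 + (norm y)\<^sup>2) / (4 * s)) / (4 * pi * s) powr (real CARD('n) / 2) * f (x - y, t - s)) / s powr (1 + \<alpha>))) = H s"
      using good
    proof eventually_elim
      case (elim s)
      show ?case
      proof (cases "0 < s")
        case True
        have "(LINT y|lebesgue. exp (- (\<tau>\<^sup>2 + (norm y)\<^sup>2) / (4 * s)) / (4 * pi * s) powr (real CARD('n) / 2) * f (x - y, t - s))
          = (LINT y|lborel. exp (- (\<tau>\<^sup>2 + (norm y)\<^sup>2) / (4 * s)) / (4 * pi * s) powr (real CARD('n) / 2) * F (x - y, t - s))"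
        proof (rule lebesgue_integral_AE_cong)
          show "AE y in lborel. exp (- (\<tau>\<^sup>2 + (norm y)\<^sup>2) / (4 * s)) / (4 * pi * s) powr (real CARD('n) / 2) * f (x - y, t - s)
             = exp (- (\<tau>\<^sup>2 + (norm y)\<^sup>2) / (4 * s)) / (4 * pi * s) powr (real CARD('n) / 2) * F (x - y, t - s)"
            using elim unfolding z
          proof eventually_elim
            case (elim y)
            then have "f (x - y, t - s) = F (x - y, t - s)" using N(2) by auto
            then show ?case by simp
          qed
        qed measurable
        then show ?thesis
          using True unfolding H_def
          by (simp only: kern_eq) (simp add: mult.assoc flip: integral_mult_right_zero integral_divide_zero)
      next
        case False
        then show ?thesis unfolding H_def by (simp add: kern_def E_def)
      qed
    qed
  qed measurable
  also have "\<dots> = (LINT w|(lborel \<Otimes>\<^sub>M lborel). (case w of (y, s) \<Rightarrow> kern \<alpha> \<tau> (y, s) * F (x - y, t - s)))"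
    unfolding H_def
  proof (rule lborel_pair.integral_snd)
    have "integrable (lborel \<Otimes>\<^sub>M lborel) (\<lambda>w. kern \<alpha> \<tau> w * F (z - w))"
      unfolding lborel_prod by (rule conv_int[OF kern_bddL1[OF \<alpha> \<tau>] F])
    moreover have "(\<lambda>(y, s). kern \<alpha> \<tau> (y, s) * F (x - y, t - s)) = (\<lambda>w. kern \<alpha> \<tau> w * F (z - w))"
      by (auto simp: z)
    ultimately show "integrable (lborel \<Otimes>\<^sub>M lborel) (\<lambda>(y, s). kern \<alpha> \<tau> (y, s) * F (x - y, t - s))"
      by simp
  qed
  also have "(\<lambda>w. case w of (y, s) \<Rightarrow> kern \<alpha> \<tau> (y, s) * F (x - y, t - s)) = (\<lambda>w. kern \<alpha> \<tau> w * F (z - w))"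
    by (auto simp: z)
  also have "(LINT w|(lborel \<Otimes>\<^sub>M lborel). kern \<alpha> \<tau> w * F (z - w)) = conv (kern \<alpha> \<tau>) F z"
    unfolding conv_def lborel_prod ..
  finally show ?thesis .
qed

lemma Linfty_norm_nonneg: "0 \<le> Linfty_norm (f :: (real ^ 'n) \<times> real \<Rightarrow> real)"
proof (rule ccontr)
  assume "\<not> ?thesis"
  then have neg: "esssup lebesgue (\<lambda>z. ereal \<bar>f z\<bar>) < 0"
    unfolding Linfty_norm_def by (cases "esssup lebesgue (\<lambda>z. ereal \<bar>f z\<bar>)") auto
  have "AE z in lebesgue. ereal \<bar>f z\<bar> \<le> esssup lebesgue (\<lambda>z. ereal \<bar>f z\<bar>)" by (rule esssup_AE)
  then have "AE z in (lebesgue :: ((real ^ 'n) \<times> real) measure). False"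
  proof eventually_elim
    case (elim z)
    then have "ereal \<bar>f z\<bar> < 0" using neg by (rule le_less_trans)
    then show ?case by simp
  qed
  then have "AE z in (lebesgue :: ((real ^ 'n) \<times> real) measure). z \<notin> UNIV" by simp
  then have "(UNIV :: ((real ^ 'n) \<times> real) set) \<in> null_sets lebesgue"
    by (subst AE_iff_null_sets) auto
  then show False by (simp add: null_sets_def)
qed

lemma Linfty_AE_bound:
  assumes "f \<in> Linfty"
  shows "AE z in lebesgue. \<bar>f z\<bar> \<le> Linfty_norm f"
proof -
  have fin: "esssup lebesgue (\<lambda>z. ereal \<bar>f z\<bar>) < \<infinity>" using assms unfolding Linfty_def by simp
  have "AE z in lebesgue. ereal \<bar>f z\<bar> \<le> esssup lebesgue (\<lambda>z. ereal \<bar>f z\<bar>)" by (rule esssup_AE)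
  then show ?thesis
  proof eventually_elim
    case (elim z)
    then show ?case using fin unfolding Linfty_norm_def by (cases "esssup lebesgue (\<lambda>z. ereal \<bar>f z\<bar>)") auto
  qed
qed

lemma cylinder_sets [measurable]: "cylinder r \<in> sets borel"
proof -
  have "(ball 0 r :: (real ^ 'n) set) \<times> {- r..r} \<in> sets (borel \<Otimes>\<^sub>M borel)" by (intro pair_measureI) auto
  then show ?thesis unfolding cylinder_def by (simp only: borel_prod)
qed

text \<open>The volume of the unit cylinder. Volumes scale with the exponent n + 1 and not n + 2,
  because the time interval has length 2 r.\<close>

definition cvol :: "'n::finite itself \<Rightarrow> real" where
  "cvol _ = 2 * unit_ball_vol (real CARD('n))"

lemma cvol_pos: "0 < cvol TYPE('n::finite)"
  unfolding cvol_def by simp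

lemma emeasure_cylinder:
  assumes "0 < r"
  shows "emeasure lborel (cylinder r :: ((real ^ 'n) \<times> real) set) = ennreal (cvol TYPE('n) * r ^ (CARD('n) + 1))"
proof -
  have "emeasure lborel (cylinder r :: ((real ^ 'n) \<times> real) set) = emeasure lborel (ball 0 r :: (real ^ 'n) set) * emeasure lborel {- r..r}"
    unfolding cylinder_def lborel_prod[symmetric] by (rule lborel.emeasure_pair_measure_Times) auto
  then show ?thesis
    using assms by (simp add: emeasure_ball cvol_def ennreal_mult[symmetric] algebra_simps)
qed

text \<open>The later estimates are pointwise, so the essential bound and the support have to hold
  everywhere; setting a Borel version to zero where either fails alters it on a null set
  only.\<close>

lemma bounded_representative:
  fixes f :: "(real ^ 'n) \<times> real \<Rightarrow> real"
  assumes f: "f \<in> Linfty" and supp: "supported_in f (cylinder 1)"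
  obtains F where "F \<in> bddL1" "AE z in lborel. f z = F z" "\<And>z. \<bar>F z\<bar> \<le> Linfty_norm f" "\<And>z. z \<notin> cylinder 1 \<Longrightarrow> F z = 0"
proof -
  obtain g where g [measurable]: "g \<in> borel_measurable borel" and eq: "AE z in lborel. f z = g z"
    using completion_ex_borel_measurable_real[of f lborel] f unfolding Linfty_def by auto
  define F where "F z = g z * indicator {z. \<bar>g z\<bar> \<le> Linfty_norm f} z * indicator (cylinder 1) z" for z
  have Fm [measurable]: "F \<in> borel_measurable borel" unfolding F_def by measurable
  have bd: "\<bar>F z\<bar> \<le> Linfty_norm f" for z
    using Linfty_norm_nonneg[of f] by (auto simp: F_def indicator_def)
  show ?thesis
  proof
    show "F z = 0" if "z \<notin> cylinder 1" for z using that by (simp add: F_def)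
    show "\<bar>F z\<bar> \<le> Linfty_norm f" for z by (rule bd)
    have "AE z in lborel. \<bar>f z\<bar> \<le> Linfty_norm f" "AE z in lborel. z \<notin> cylinder 1 \<longrightarrow> f z = 0"
      using Linfty_AE_bound[OF f] supp unfolding supported_in_def AE_completion_iff by auto
    with eq show "AE z in lborel. f z = F z"
      by eventually_elim (auto simp: F_def indicator_def)
    show "F \<in> bddL1"
    proof (rule bddL1I[OF Fm _ bd])
      have fin: "emeasure lborel (cylinder 1 :: ((real ^ 'n) \<times> real) set) < \<infinity>"
        by (subst emeasure_cylinder) auto
      have "integrable lborel (\<lambda>z. Linfty_norm f * indicator (cylinder 1) (z :: (real ^ 'n) \<times> real))"
        using fin by (intro integrable_mult_right integrable_real_indicator) auto
      then show "integrable lborel F"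
        by (rule Bochner_Integration.integrable_bound) 
          (use bd Linfty_norm_nonneg[of f] in \<open>auto simp: F_def indicator_def abs_mult intro!: AE_I2\<close>)
    qed
  qed
qed

text \<open>The exponent 1 / p' as a real number. The formula 1 - 1 / p continues to hold for 0 < p
  < 1, where it is negative; such exponents occur in the sharpness statement when p - \<epsilon> <
  1.\<close>

definition hexp :: "ereal \<Rightarrow> real" where
  "hexp p = real_of_ereal (1 / conj_exp p)"

lemma hexp_simps:
  "hexp \<infinity> = 1" "p \<noteq> 0 \<Longrightarrow> hexp (ereal p) = 1 - 1 / p"
proof -
  show "hexp \<infinity> = 1" unfolding hexp_def conj_exp_def by (simp flip: one_ereal_def)
  show "hexp (ereal p) = 1 - 1 / p" if "p \<noteq> 0"
  proof (cases "p = 1")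
    case False
    then have "conj_exp (ereal p) = ereal (p / (p - 1))"
      unfolding conj_exp_def by (simp add: one_ereal_def)
    then show ?thesis
      unfolding hexp_def using False that by (simp add: one_ereal_def field_simps)
  qed (simp add: hexp_def conj_exp_def flip: one_ereal_def)
qed

lemma lp_nonneg_bound:
  assumes "1 \<le> p" "v \<in> lp p"
  shows "0 \<le> hexp p" "hexp p \<le> 1" "0 \<le> lp_norm p v" "\<bar>v j\<bar> \<le> lp_norm p v"
    and "finite G \<Longrightarrow> (\<Sum>j\<in>G. \<bar>v j\<bar>) \<le> real (card G) powr hexp p * lp_norm p v"
proof -
  consider (inf) "p = \<infinity>" | (real) r where "p = ereal r" "1 \<le> r" using assms(1) by (cases p) auto
  then have *: "0 \<le> hexp p \<and> hexp p \<le> 1 \<and> 0 \<le> lp_norm p v \<and> (\<forall>j. \<bar>v j\<bar> \<le> lp_norm p v) \<and>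
     (\<forall>G. finite G \<longrightarrow> (\<Sum>j\<in>G. \<bar>v j\<bar>) \<le> real (card G) powr hexp p * lp_norm p v)"
  proof cases
    case inf
    then have "bounded (range v)" using assms(2) by (simp add: lp_def)
    then have "bdd_above (range (\<lambda>j. \<bar>v j\<bar>))" unfolding bounded_iff bdd_above_def by auto
    then have le: "\<bar>v j\<bar> \<le> lp_norm p v" for j
      unfolding lp_norm_def using inf by (auto intro!: cSUP_upper)
    have "(\<Sum>j\<in>G. \<bar>v j\<bar>) \<le> real (card G) * lp_norm p v" for G :: "int set"
      using sum_bounded_above[of G "\<lambda>j. \<bar>v j\<bar>" "lp_norm p v"] le by simp
    moreover have "0 \<le> lp_norm p v" using le[of 0] by linarith
    ultimately show ?thesis using le inf by (auto simp: hexp_simps)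
  next
    case real
    define S where "S = (\<Sum>\<^sub>\<infinity>j. \<bar>v j\<bar> powr r)"
    have sm: "(\<lambda>j. \<bar>v j\<bar> powr r) summable_on UNIV" using assms(2) real by (simp add: lp_def)
    have nrm: "lp_norm p v = S powr (1 / r)" unfolding lp_norm_def S_def real by simp
    have fin: "(\<Sum>j\<in>G. \<bar>v j\<bar> powr r) \<le> S" if "finite G" for G
      unfolding S_def by (rule finite_sum_le_infsum[OF sm that]) auto
    have S0: "0 \<le> S" using fin[of "{}"] by simp
    have le: "\<bar>v j\<bar> \<le> lp_norm p v" for j
    proof -
      have "\<bar>v j\<bar> = (\<bar>v j\<bar> powr r) powr (1 / r)" using real by (simp add: powr_powr)
      also have "\<dots> \<le> S powr (1 / r)" using fin[of "{j}"] real by (intro powr_mono2) auto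
      finally show ?thesis unfolding nrm .
    qed
    have h: "hexp p = 1 - 1 / r" using real by (simp add: hexp_simps)
    have holder: "(\<Sum>j\<in>G. \<bar>v j\<bar>) \<le> real (card G) powr hexp p * lp_norm p v" if G: "finite G" for G
    proof -
      \<comment> \<open>Dropping the zero coefficients keeps the arguments of the convex function x
        powr r positive. Hoelder's inequality is then Jensen's inequality with equal weights 1 /
        n.\<close>
      define G' where "G' = {j\<in>G. v j \<noteq> 0}"
      have G': "finite G'" "G' \<subseteq> G" using G unfolding G'_def by auto
      have eq: "(\<Sum>j\<in>G. \<bar>v j\<bar>) = (\<Sum>j\<in>G'. \<bar>v j\<bar>)"
        unfolding G'_def using G by (intro sum.mono_neutral_right) auto
      show ?thesis
      proof (cases "G' = {}")
        case True
        then show ?thesis unfolding eq nrm by simp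
      next
        case False
        define n where "n = real (card G')"
        have n: "0 < n" unfolding n_def using False G' by (simp add: card_gt_0_iff)
        have "(\<Sum>j\<in>G'. (1 / n) *\<^sub>R \<bar>v j\<bar>) powr r \<le> (\<Sum>j\<in>G'. (1 / n) * \<bar>v j\<bar> powr r)"
        proof (rule convex_on_sum[OF G'(1) False powr_convex[OF real(2)]])
          show "(\<Sum>i\<in>G'. 1 / n) = 1" using n unfolding n_def by simp
        qed (use n in \<open>auto simp: G'_def\<close>)
        also have "\<dots> \<le> (1 / n) * S"
          unfolding sum_distrib_left[symmetric] using n fin[OF G'(1)] by (intro mult_left_mono) auto
        finally have "((\<Sum>j\<in>G'. \<bar>v j\<bar>) / n) powr r \<le> S / n" by (simp add: sum_divide_distrib)
        then have "(((\<Sum>j\<in>G'. \<bar>v j\<bar>) / n) powr r) powr (1 / r) \<le> (S / n) powr (1 / r)"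
          using real by (intro powr_mono2) auto
        moreover have "(((\<Sum>j\<in>G'. \<bar>v j\<bar>) / n) powr r) powr (1 / r) = (\<Sum>j\<in>G'. \<bar>v j\<bar>) / n"
          using real n by (simp add: powr_powr sum_nonneg)
        ultimately have "(\<Sum>j\<in>G'. \<bar>v j\<bar>) \<le> n * (S / n) powr (1 / r)" using n by (simp add: field_simps)
        also have "\<dots> = n powr hexp p * lp_norm p v"
          using n S0 unfolding h nrm by (simp add: powr_divide powr_diff field_simps)
        also have "\<dots> \<le> real (card G) powr hexp p * lp_norm p v"
          using real G' G n le[of 0] unfolding n_def h
          by (intro mult_right_mono powr_mono2) (auto simp: card_mono)
        finally show ?thesis unfolding eq .
      qed
    qed
    have "0 \<le> lp_norm p v" using le[of 0] by linarith
    moreover have "0 \<le> hexp p" "hexp p \<le> 1" unfolding h using real by auto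
    ultimately show ?thesis using le holder by blast
  qed
  show "0 \<le> hexp p" "hexp p \<le> 1" "0 \<le> lp_norm p v" "\<bar>v j\<bar> \<le> lp_norm p v"
    "finite G \<Longrightarrow> (\<Sum>j\<in>G. \<bar>v j\<bar>) \<le> real (card G) powr hexp p * lp_norm p v" using * by auto
qed

text \<open>The weight \<open>h\<close> records where \<open>F (z - w)\<close> can be nonzero: a
  constant for the plain bound, a power of the gauge for the part of \<open>F\<close> far from
  \<open>z\<close>, an indicator of early times for large scales.\<close>

lemma conv_abs_le:
  assumes g: "g \<in> bddL1" and F: "F \<in> bddL1" and h [measurable]: "h \<in> borel_measurable borel"
    and le: "\<And>w. \<bar>F (z - w)\<bar> \<le> M * h w" and h0: "\<And>w. 0 \<le> h w" and M: "0 \<le> M" and x: "0 \<le> x"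
    and int: "(\<integral>\<^sup>+w. ennreal (\<bar>g w\<bar> * h w) \<partial>lborel) \<le> ennreal x"
  shows "\<bar>conv g F z\<bar> \<le> M * x"
proof -
  note [measurable] = bddL1_meas[OF g] bddL1_meas[OF F]
  have "ennreal (norm (conv g F z)) \<le> (\<integral>\<^sup>+w. norm (g w * F (z - w)) \<partial>lborel)"
    unfolding conv_def by (rule integral_norm_bound_ennreal[OF conv_int[OF g F]])
  also have "\<dots> \<le> (\<integral>\<^sup>+w. ennreal M * ennreal (\<bar>g w\<bar> * h w) \<partial>lborel)"
  proof (rule nn_integral_mono)
    fix w
    have "norm (g w * F (z - w)) \<le> M * (\<bar>g w\<bar> * h w)"
      using mult_left_mono[OF le[of w], of "\<bar>g w\<bar>"] by (simp add: abs_mult mult_ac)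
    then show "ennreal (norm (g w * F (z - w))) \<le> ennreal M * ennreal (\<bar>g w\<bar> * h w)"
      using M h0 by (simp add: ennreal_mult[symmetric] ennreal_leI)
  qed
  also have "\<dots> = ennreal M * (\<integral>\<^sup>+w. ennreal (\<bar>g w\<bar> * h w) \<partial>lborel)" by (rule nn_integral_cmult) measurable
  also have "\<dots> \<le> ennreal M * ennreal x" by (intro mult_left_mono int) simp
  finally have "ennreal \<bar>conv g F z\<bar> \<le> ennreal (M * x)" using M x by (simp add: ennreal_mult)
  then show ?thesis using M x by simp
qed

lemma conv_abs_le_norm1:
  assumes g: "g \<in> bddL1" and F: "F \<in> bddL1" and le: "\<And>w. \<bar>F w\<bar> \<le> M"
  shows "\<bar>conv g F z\<bar> \<le> M * norm1 g"
proof (rule conv_abs_le[OF g F, of "\<lambda>_. 1"])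
  show "0 \<le> M" using le[of 0] by linarith
  show "(\<integral>\<^sup>+w. ennreal (\<bar>g w\<bar> * 1) \<partial>lborel) \<le> ennreal (norm1 g)" using norm1_nn[OF g] by simp
qed (use le norm1_nonneg in auto)

lemma indicator_cylinder_bddL1:
  assumes r: "0 < r"
  shows "(indicator (cylinder r) :: (real ^ 'n) \<times> real \<Rightarrow> real) \<in> bddL1"
  by (rule bddL1I[where B=1]) (auto simp: emeasure_cylinder[OF r] indicator_def[of _ "_"] intro!: integrable_real_indicator)

lemma norm2_indicator_cylinder:
  assumes r: "0 < r"
  shows "norm2 (indicator (cylinder r) :: (real ^ 'n) \<times> real \<Rightarrow> real) = sqrt (cvol TYPE('n) * r ^ (CARD('n) + 1))"
proof -
  have "(LINT w|lborel. (indicator (cylinder r) (w :: (real ^ 'n) \<times> real) :: real)\<^sup>2) = measure lborel (cylinder r :: ((real ^ 'n) \<times> real) set)"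
  proof -
    have "(\<lambda>w. (indicator (cylinder r) (w :: (real ^ 'n) \<times> real) :: real)\<^sup>2) = indicator (cylinder r)"
      by (auto simp: indicator_def)
    then show ?thesis by simp
  qed
  then show ?thesis unfolding norm2_def using emeasure_cylinder[OF r, where 'n='n] r cvol_pos[where 'n='n] by (simp add: measure_def)
qed

text \<open>Leaving the doubled cylinder requires a step of size \<open>r\<close> in space or in
  time. The latter has gauge at least the square root of \<open>r\<close>, which exceeds
  \<open>r\<close> since r < 1.\<close>

lemma cylinder_diff_pn:
  assumes r: "0 < r" "2 * r < 1" and z: "z \<in> cylinder r" and zw: "z - w \<notin> cylinder (2 * r)"
  shows "r \<le> pn w"
proof -
  obtain x t y s where e: "z = (x, t)" "w = (y, s)" by (cases z, cases w) auto
  have xt: "norm x < r" "\<bar>t\<bar> \<le> r" using z by (auto simp: e cylinder_def abs_le_iff)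
  have "2 * r \<le> norm (x - y) \<or> 2 * r < \<bar>t - s\<bar>" using zw by (auto simp: e cylinder_def abs_le_iff)
  then have "r \<le> norm y \<or> r \<le> \<bar>s\<bar>" using xt norm_triangle_ineq4[of x y] by linarith
  then show ?thesis
  proof
    assume "r \<le> \<bar>s\<bar>"
    have "r * r \<le> 1 * r" using r by (intro mult_right_mono) auto
    also have "\<dots> \<le> \<bar>s\<bar>" using \<open>r \<le> \<bar>s\<bar>\<close> by simp
    finally have "r \<le> sqrt \<bar>s\<bar>" by (intro real_le_rsqrt) (simp add: power2_eq_square)
    then show ?thesis by (simp add: e pn_def add_increasing)
  next
    assume "r \<le> norm y"
    then show ?thesis unfolding e pn_def by (simp add: add_increasing2)
  qed
qed

lemma ln_two_div: "0 < (r :: real) \<Longrightarrow> 2 * r < 1 \<Longrightarrow> 1 \<le> ln (2 / r)"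
proof -
  assume r: "0 < r" "2 * r < 1"
  have "exp 1 \<le> (3 :: real)" by (rule exp_le)
  also have "\<dots> \<le> 2 / r" using r by (simp add: field_simps)
  finally show ?thesis using r by (subst ln_ge_iff) auto
qed

section \<open>Averages of the maximal operator, split by scale\<close>

context poisson_family
begin

lemma conv_q_le:
  assumes F: "F \<in> bddL1" and le: "\<And>w. \<bar>F w\<bar> \<le> M"
  shows "\<bar>conv (q j) F z\<bar> \<le> 2 * c0 * M"
proof -
  have "\<bar>conv (q j) F z\<bar> \<le> M * norm1 (q j)" by (rule conv_abs_le_norm1[OF q F le])
  also have "\<dots> \<le> M * (2 * c0)" using le[of 0] by (intro mult_left_mono norm1_q) linarith
  finally show ?thesis by (simp add: mult_ac)
qed

text \<open>Where \<open>F (z - w)\<close> does not vanish, 1 \<le> (pn w / r)^\<alpha>, so the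
  \<alpha>-moment of \<open>q j\<close> bounds the convolution.\<close>

lemma conv_q_far:
  assumes F: "F \<in> bddL1" and le: "\<And>w. \<bar>F w\<bar> \<le> M" and F0: "\<And>w. w \<in> cylinder (2 * r) \<Longrightarrow> F w = 0"
    and r: "0 < r" "2 * r < 1" and z: "z \<in> cylinder r"
  shows "\<bar>conv (q j) F z\<bar> \<le> M * (2 * cm * (a (j + 1) / r) powr \<alpha>)"
proof (rule conv_abs_le[OF q F, of "\<lambda>w. (pn w / r) powr \<alpha>"])
  show M: "0 \<le> M" using le[of 0] by linarith
  show "\<bar>F (z - w)\<bar> \<le> M * (pn w / r) powr \<alpha>" for w
  proof (cases "z - w \<in> cylinder (2 * r)")
    case False
    then have "r \<le> pn w" using cylinder_diff_pn[OF r z] by blast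
    then have "1 \<le> (pn w / r) powr \<alpha>" using r \<alpha> by (intro ge_one_powr_ge_zero) auto
    then have "M * 1 \<le> M * (pn w / r) powr \<alpha>" using M by (intro mult_left_mono)
    then show ?thesis using le[of "z - w"] by linarith
  qed (use F0 M in simp)
  note [measurable] = bddL1_meas[OF q]
  have "(\<integral>\<^sup>+w. ennreal (\<bar>q j w\<bar> * (pn w / r) powr \<alpha>) \<partial>lborel) =
      (\<integral>\<^sup>+w. ennreal (r powr - \<alpha>) * ennreal (\<bar>q j w\<bar> * pn w powr \<alpha>) \<partial>lborel)"
    using r by (intro nn_integral_cong) (simp add: ennreal_mult[symmetric] powr_divide powr_minus field_simps)
  also have "\<dots> = ennreal (r powr - \<alpha>) * (\<integral>\<^sup>+w. ennreal (\<bar>q j w\<bar> * pn w powr \<alpha>) \<partial>lborel)"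
    by (rule nn_integral_cmult) measurable
  also have "\<dots> \<le> ennreal (r powr - \<alpha>) * ennreal (2 * cm * a (j + 1) powr \<alpha>)"
    using atom_q[of j] by (intro mult_left_mono) (auto simp: atom_def)
  also have "\<dots> = ennreal (2 * cm * (a (j + 1) / r) powr \<alpha>)"
    using r cpos a_pos[of "j + 1"] by (simp add: ennreal_mult[symmetric] powr_divide powr_minus field_simps)
  finally show "(\<integral>\<^sup>+w. ennreal (\<bar>q j w\<bar> * (pn w / r) powr \<alpha>) \<partial>lborel) \<le> ennreal (2 * cm * (a (j + 1) / r) powr \<alpha>)" .
qed (use cpos in auto)

text \<open>For \<open>z\<close> in the small cylinder and \<open>F\<close> supported in the unit
  cylinder only times up to 2 contribute, and a kernel of large height has little mass there. The
  two kernels of the difference are estimated separately.\<close>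

lemma conv_q_large_scale:
  assumes ce: "0 < ce" and early: "\<And>j. (\<integral>\<^sup>+w. ennreal (k j w) * indicator {w. snd w \<le> 2} w \<partial>lborel) \<le> ennreal (ce / (a j)\<^sup>2)"
    and F: "F \<in> bddL1" and le: "\<And>w. \<bar>F w\<bar> \<le> M" and F0: "\<And>w. w \<notin> cylinder 1 \<Longrightarrow> F w = 0"
    and r: "2 * r < 1" and z: "z \<in> cylinder r"
  shows "\<bar>conv (q j) F z\<bar> \<le> M * (2 * ce / (a j)\<^sup>2)"
proof -
  have M: "0 \<le> M" using le[of 0] by linarith
  have [measurable]: "{w :: (real ^ 'n) \<times> real. snd w \<le> 2} \<in> sets borel"
    by (intro borel_closed closed_Collect_le continuous_intros)
  have k1: "\<bar>conv (k j) F z\<bar> \<le> M * (ce / (a j)\<^sup>2)" for j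
  proof (rule conv_abs_le[OF k F, of "indicator {w. snd w \<le> 2}"])
    show "\<bar>F (z - w)\<bar> \<le> M * indicator {w. snd w \<le> 2} w" for w
    proof (cases "snd w \<le> 2")
      case False
      then have "z - w \<notin> cylinder 1" using z r by (cases z, cases w) (auto simp: cylinder_def)
      then show ?thesis using F0 M by simp
    qed (use le in simp)
    show "(\<integral>\<^sup>+w. ennreal (\<bar>k j w\<bar> * indicator {w. snd w \<le> 2} w) \<partial>lborel) \<le> ennreal (ce / (a j)\<^sup>2)"
      using early[of j] k_nonneg[of j] by (simp add: ennreal_mult ennreal_indicator)
  qed (use M ce in auto)
  have "\<bar>conv (q j) F z\<bar> \<le> \<bar>conv (k (j + 1)) F z\<bar> + \<bar>conv (k j) F z\<bar>"
    using conv_diff_left[OF k k F, of "j + 1" j z] unfolding q_def[abs_def] by simp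
  also have "\<dots> \<le> M * (ce / (a (j + 1))\<^sup>2) + M * (ce / (a j)\<^sup>2)" by (intro add_mono k1)
  also have "M * (ce / (a (j + 1))\<^sup>2) \<le> M * (ce / (a j)\<^sup>2)"
    using M ce a_mono[of j "j + 1"] a_pos[of j] by (intro mult_left_mono divide_left_mono power_mono mult_pos_pos) auto
  finally show ?thesis by (simp add: mult_ac)
qed

lemma sum_small_scales:
  assumes G: "finite G" "\<And>j. j \<in> G \<Longrightarrow> a (j + 1) \<le> r"
  shows "(\<Sum>j\<in>G. (a (j + 1) / r) powr \<alpha>) \<le> 2 / (1 - \<Lambda>)"
proof (cases "G = {}")
  case False
  define i where "i = Max G"
  have i: "i \<in> G" "\<And>j. j \<in> G \<Longrightarrow> j \<le> i" unfolding i_def using G False by auto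
  have "(\<Sum>j\<in>G. (a (j + 1) / r) powr \<alpha>) \<le> (\<Sum>j\<in>G. \<Lambda> ^ nat \<bar>j - i\<bar>)"
  proof (rule sum_mono)
    fix j assume j: "j \<in> G"
    have "(a (j + 1) / r) powr \<alpha> \<le> (a (j + 1) / a (i + 1)) powr \<alpha>"
      using G(2)[OF i(1)] a_pos[of "j + 1"] a_pos[of "i + 1"] \<alpha> by (intro powr_mono2 divide_left_mono) auto
    also have "\<dots> \<le> \<Lambda> ^ nat (i + 1 - (j + 1))" using i(2)[OF j] by (intro lac) simp
    finally show "(a (j + 1) / r) powr \<alpha> \<le> \<Lambda> ^ nat \<bar>j - i\<bar>" using i(2)[OF j] by simp
  qed
  also have "\<dots> \<le> 2 / (1 - \<Lambda>)" by (rule sum_geometric_int[OF G(1) \<Lambda>])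
  finally show ?thesis .
qed (use \<Lambda> in simp)

text \<open>As \<open>a j\<close> \<ge> 1 and \<alpha> \<le> 2, the inverse square is at most the
  power -\<alpha>, which decays geometrically from the least index on.\<close>

lemma sum_large_scales:
  assumes \<alpha>2: "\<alpha> \<le> 2" and G: "finite G" "\<And>j. j \<in> G \<Longrightarrow> 1 \<le> a j"
  shows "(\<Sum>j\<in>G. 1 / (a j)\<^sup>2) \<le> 2 / (1 - \<Lambda>)"
proof (cases "G = {}")
  case False
  define i where "i = Min G"
  have i: "i \<in> G" "\<And>j. j \<in> G \<Longrightarrow> i \<le> j" unfolding i_def using G False by auto
  have "(\<Sum>j\<in>G. 1 / (a j)\<^sup>2) \<le> (\<Sum>j\<in>G. \<Lambda> ^ nat \<bar>j - i\<bar>)"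
  proof (rule sum_mono)
    fix j assume j: "j \<in> G"
    have "1 / (a j)\<^sup>2 = (1 / a j) powr 2" using a_pos[of j] by (simp add: power_divide)
    also have "\<dots> \<le> (1 / a j) powr \<alpha>" using G(2)[OF j] \<alpha>2 by (intro powr_mono') auto
    also have "\<dots> \<le> (a i / a j) powr \<alpha>"
      using G(2)[OF i(1)] a_pos[of j] \<alpha> by (intro powr_mono2 divide_right_mono) auto
    also have "\<dots> \<le> \<Lambda> ^ nat (j - i)" using i(2)[OF j] by (intro lac) simp
    finally show "1 / (a j)\<^sup>2 \<le> \<Lambda> ^ nat \<bar>j - i\<bar>" using i(2)[OF j] by simp
  qed
  also have "\<dots> \<le> 2 / (1 - \<Lambda>)" by (rule sum_geometric_int[OF G(1) \<Lambda>])
  finally show ?thesis .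
qed (use \<Lambda> in simp)

text \<open>If i and i' are the extreme middle indices, the ratio of \<open>a (i + 1)\<close> to
  \<open>a i'\<close> is at least r, so \<Lambda>^(i' - i - 1) \<ge> r^\<alpha> bounds i' - i - 1 by
  \<alpha> ln (1 / r) / ln (1 / \<Lambda>). The 2 pays for the two ends.\<close>

definition ck where "ck = 2 + \<alpha> / ln (1 / \<Lambda>)"

lemma ck: "1 \<le> ck"
  unfolding ck_def using \<alpha> \<Lambda> by simp

lemma card_middle_scales:
  assumes G: "finite G" "\<And>j. j \<in> G \<Longrightarrow> r < a (j + 1) \<and> a j < 1" and r: "0 < r" "2 * r < 1"
  shows "real (card G) \<le> ck * ln (2 / r)"
proof (cases "G = {}")
  case True
  then show ?thesis using ck ln_two_div[OF r] by simp
next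
  case False
  define i where "i = Min G"
  define i' where "i' = Max G"
  have i: "i \<in> G" "i' \<in> G" "G \<subseteq> {i..i'}" unfolding i_def i'_def using G False by auto
  then have "i \<le> i'" by auto
  have "card G \<le> card {i..i'}" using i by (intro card_mono) auto
  then have c: "real (card G) \<le> real_of_int (i' - i) + 1" using \<open>i \<le> i'\<close> by simp
  have l: "0 < ln (1 / \<Lambda>)" using \<Lambda> by simp
  have L: "1 \<le> ln (2 / r)" by (rule ln_two_div[OF r])
  have "real_of_int (i' - i) \<le> 1 + \<alpha> / ln (1 / \<Lambda>) * ln (2 / r)"
  proof (cases "i = i'")
    case True
    then show ?thesis using \<alpha> l L by simp
  next
    case False
    then have lt: "i + 1 \<le> i'" using \<open>i \<le> i'\<close> by simp
    have "r powr \<alpha> \<le> (a (i + 1) / a i') powr \<alpha>"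
    proof (rule powr_mono2)
      have "r * a i' \<le> r * 1" using G(2)[OF i(2)] r by (intro mult_left_mono) auto
      also have "\<dots> \<le> a (i + 1)" using G(2)[OF i(1)] by simp
      finally show "r \<le> a (i + 1) / a i'" using a_pos[of i'] by (simp add: field_simps)
    qed (use r \<alpha> in auto)
    also have "\<dots> \<le> \<Lambda> ^ nat (i' - (i + 1))" by (rule lac[OF lt])
    finally have "ln (r powr \<alpha>) \<le> ln (\<Lambda> ^ nat (i' - (i + 1)))" using r \<Lambda> by (subst ln_le_cancel_iff) auto
    then have "\<alpha> * ln r \<le> real (nat (i' - (i + 1))) * ln \<Lambda>" using r \<Lambda> by (simp add: ln_powr ln_realpow)
    then have "real (nat (i' - (i + 1))) * ln (1 / \<Lambda>) \<le> \<alpha> * (- ln r)" using \<Lambda> by (simp add: ln_div)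
    also have "\<dots> \<le> \<alpha> * ln (2 / r)" using \<alpha> r by (intro mult_left_mono) (auto simp: ln_div)
    finally have "real (nat (i' - (i + 1))) \<le> \<alpha> * ln (2 / r) / ln (1 / \<Lambda>)" using l by (simp add: pos_le_divide_eq)
    then show ?thesis using lt by simp
  qed
  then have "real (card G) \<le> 2 + \<alpha> / ln (1 / \<Lambda>) * ln (2 / r)" using c by linarith
  also have "\<dots> \<le> ck * ln (2 / r)" unfolding ck_def using L by (simp add: distrib_right)
  finally show ?thesis .
qed

definition Tmax :: "(int \<Rightarrow> real) \<Rightarrow> ((real ^ 'n) \<times> real \<Rightarrow> real) \<Rightarrow> (real ^ 'n) \<times> real \<Rightarrow> ennreal" where
  "Tmax v f z = (SUP m :: nat. SUP (N1, N2)\<in>{- int m..int m} \<times> {- int m..int m}. ennreal \<bar>\<Sum>j = N1..N2. v j * conv (q j) f z\<bar>)"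

lemma Tmax_upper: "ennreal \<bar>\<Sum>j = N1..N2. v j * conv (q j) f z\<bar> \<le> Tmax v f z"
  unfolding Tmax_def
  by (rule SUP_upper2[where i="nat (max \<bar>N1\<bar> \<bar>N2\<bar>)"], simp, rule SUP_upper2[where i="(N1, N2)"]) auto

lemma Tmax_measurable [measurable]:
  assumes f: "f \<in> bddL1"
  shows "Tmax v f \<in> borel_measurable borel"
proof -
  note [measurable] = bddL1_meas[OF conv_bddL1[OF q f]]
  show ?thesis unfolding Tmax_def split_beta by measurable
qed

text \<open>A block is the difference of two tails, both dominated by the function \<open>U\<close>
  of \<open>maximal_tail_sums\<close>. Cauchy-Schwarz against the indicator gives a bound
  independent of the truncation \<open>m\<close>.\<close>

lemma Tmax_cylinder:
  assumes v: "\<And>j. \<bar>v j\<bar> \<le> 1" and f: "f \<in> bddL1" and r: "0 < r"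
  shows "(\<integral>\<^sup>+z. Tmax v f z * indicator (cylinder r) z \<partial>lborel)
    \<le> ennreal (2 * cu * norm2 f * sqrt (cvol TYPE('n) * r ^ (CARD('n) + 1)))"
proof -
  define W where "W m z = (SUP (N1, N2)\<in>{- int m..int m} \<times> {- int m..int m}. ennreal \<bar>\<Sum>j = N1..N2. v j * conv (q j) f z\<bar>)" for m z
  note [measurable] = bddL1_meas[OF conv_bddL1[OF q f]]
  have W [measurable]: "W m \<in> borel_measurable borel" for m unfolding W_def split_beta by measurable
  note cyl = indicator_cylinder_bddL1[OF r, where 'n='n] and ncyl = norm2_indicator_cylinder[OF r, where 'n='n]
  have "(\<integral>\<^sup>+z. Tmax v f z * indicator (cylinder r) z \<partial>lborel) = (\<integral>\<^sup>+z. (SUP m. W m z * indicator (cylinder r) z) \<partial>lborel)"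
    unfolding Tmax_def W_def by (simp add: SUP_mult_right_ennreal)
  also have "\<dots> = (SUP m. \<integral>\<^sup>+z. W m z * indicator (cylinder r) z \<partial>lborel)"
  proof (rule nn_integral_monotone_convergence_SUP)
    show "incseq (\<lambda>m z. W m z * indicator (cylinder r) z)"
      by (intro incseq_SucI le_funI mult_right_mono) (auto simp: W_def intro!: SUP_subset_mono)
  qed measurable
  also have "\<dots> \<le> ennreal (2 * cu * norm2 f * sqrt (cvol TYPE('n) * r ^ (CARD('n) + 1)))"
  proof (rule SUP_least)
    fix m :: nat
    obtain U where U: "U \<in> bddL1" "norm2 U \<le> cu * norm2 f"
      "\<And>N z. N \<in> {- int m..int m + 1} \<Longrightarrow> \<bar>\<Sum>j = N..int m. v j * conv (q j) f z\<bar> \<le> U z"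
      using maximal_tail_sums[where v=v, OF v f, of "int m"] by blast
    note [measurable] = bddL1_meas[OF U(1)]
    have U0: "0 \<le> U z" for z using U(3)[of "int m + 1" z] by simp
    have WU: "W m z \<le> ennreal (2 * U z)" for z
      unfolding W_def
    proof (rule SUP_least, clarify)
      fix N1 N2 assume N: "N1 \<in> {- int m..int m}" "N2 \<in> {- int m..int m}"
      have "\<bar>\<Sum>j = N1..N2. v j * conv (q j) f z\<bar> \<le> 2 * U z"
      proof (cases "N1 \<le> N2")
        case True
        have "{N1..int m} = {N1..N2} \<union> {N2 + 1..int m}" using True N by auto
        then have "(\<Sum>j = N1..int m. v j * conv (q j) f z) = (\<Sum>j = N1..N2. v j * conv (q j) f z) + (\<Sum>j = N2 + 1..int m. v j * conv (q j) f z)"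
          by (simp add: sum.union_disjoint)
        then show ?thesis using U(3)[of N1 z] U(3)[of "N2 + 1" z] N by simp
      qed (use U0 in simp)
      then show "ennreal \<bar>\<Sum>j = N1..N2. v j * conv (q j) f z\<bar> \<le> ennreal (2 * U z)" by (rule ennreal_leI)
    qed
    have "(\<integral>\<^sup>+z. W m z * indicator (cylinder r) z \<partial>lborel) \<le> (\<integral>\<^sup>+z. ennreal (2 * (U z * indicator (cylinder r) z)) \<partial>lborel)"
    proof (rule nn_integral_mono)
      fix z show "W m z * indicator (cylinder r) z \<le> ennreal (2 * (U z * indicator (cylinder r) z))"
        using WU[of z] by (auto simp: indicator_def)
    qed
    also have "\<dots> = ennreal (2 * (LINT z|lborel. U z * indicator (cylinder r) z))"
      using U0 by (subst nn_integral_eq_integral) (auto intro!: integrable_mult_right bddL1_int_mult U cyl)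
    also have "\<dots> \<le> ennreal (2 * cu * norm2 f * sqrt (cvol TYPE('n) * r ^ (CARD('n) + 1)))"
    proof (rule ennreal_leI)
      have "(LINT z|lborel. U z * indicator (cylinder r) z) \<le> norm2 U * sqrt (cvol TYPE('n) * r ^ (CARD('n) + 1))"
        using Cauchy_Schwarz_norm2'[OF U(1) cyl] unfolding ncyl by linarith
      also have "\<dots> \<le> cu * norm2 f * sqrt (cvol TYPE('n) * r ^ (CARD('n) + 1))"
        using r cvol_pos[where 'n='n] by (intro mult_right_mono U(2)) auto
      finally show "2 * (LINT z|lborel. U z * indicator (cylinder r) z) \<le> 2 * cu * norm2 f * sqrt (cvol TYPE('n) * r ^ (CARD('n) + 1))" by simp
    qed
    finally show "(\<integral>\<^sup>+z. W m z * indicator (cylinder r) z \<partial>lborel) \<le> ennreal (2 * cu * norm2 f * sqrt (cvol TYPE('n) * r ^ (CARD('n) + 1)))" .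
  qed
  finally show ?thesis .
qed

text \<open>Small and large scales use only that every coefficient is at most the norm of
  \<open>v\<close>. Hoelder's inequality is spent on the middle scales alone, whose number produces
  the logarithm. The constant is chosen before \<open>p\<close>, \<open>v\<close>, \<open>F\<close>
  and \<open>r\<close>.\<close>

theorem local_maximal_bound:
  assumes \<alpha>2: "\<alpha> \<le> 2" and ce: "0 < ce"
    and early: "\<And>j. (\<integral>\<^sup>+w. ennreal (k j w) * indicator {w. snd w \<le> 2} w \<partial>lborel) \<le> ennreal (ce / (a j)\<^sup>2)"
  obtains C where "0 < C" "\<And>p v F M r. 1 \<le> p \<Longrightarrow> v \<in> lp p \<Longrightarrow> F \<in> bddL1 \<Longrightarrow> (\<And>w. \<bar>F w\<bar> \<le> M) \<Longrightarrow>
    (\<And>w. w \<notin> cylinder 1 \<Longrightarrow> F w = 0) \<Longrightarrow> 0 < r \<Longrightarrow> 2 * r < 1 \<Longrightarrow>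
    (\<integral>\<^sup>+z. (SUP (N1, N2)\<in>{(N1, N2). N1 < N2}. ennreal \<bar>\<Sum>j = N1..N2. v j * conv (q j) F z\<bar>) * indicator (cylinder r) z \<partial>lborel)
      \<le> ennreal (C * ln (2 / r) powr hexp p * lp_norm p v * M) * emeasure lborel (cylinder r :: ((real ^ 'n) \<times> real) set)"
proof -
  define G where "G = 2 / (1 - \<Lambda>)"
  have G: "0 < G" unfolding G_def using \<Lambda> by simp
  define d where "d = sqrt (2 ^ (CARD('n) + 1))"
  define C where "C = 2 * cm * G + 2 * c0 * ck + 2 * ce * G + 2 * cu * d"
  have C: "0 < C" unfolding C_def d_def using cpos G ck cu ce by (intro add_pos_pos) auto
  have main: "(\<integral>\<^sup>+z. (SUP (N1, N2)\<in>{(N1, N2). N1 < N2}. ennreal \<bar>\<Sum>j = N1..N2. v j * conv (q j) F z\<bar>) * indicator (cylinder r) z \<partial>lborel)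
      \<le> ennreal (C * ln (2 / r) powr hexp p * lp_norm p v * M) * emeasure lborel (cylinder r :: ((real ^ 'n) \<times> real) set)"
    if p: "1 \<le> p" and v: "v \<in> lp p" and F: "F \<in> bddL1" and FM: "\<And>w. \<bar>F w\<bar> \<le> M" and F0: "\<And>w. w \<notin> cylinder 1 \<Longrightarrow> F w = 0"
      and r: "0 < r" "2 * r < 1" for p v F M r
  proof -
    define V where "V = lp_norm p v"
    define \<theta> where "\<theta> = hexp p"
    define L where "L = ln (2 / r)"
    have L: "1 \<le> L" unfolding L_def by (rule ln_two_div[OF r])
    have \<theta>: "0 \<le> \<theta>" "\<theta> \<le> 1" and V0: "0 \<le> V" and vV: "\<bar>v j\<bar> \<le> V" for j
      using lp_nonneg_bound(1-4)[OF p v] unfolding V_def \<theta>_def by auto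
    have L\<theta>: "1 \<le> L powr \<theta>" using L \<theta>(1) by (rule ge_one_powr_ge_zero)
    have M: "0 \<le> M" using FM[of 0] by linarith
    define vol where "vol = cvol TYPE('n) * r ^ (CARD('n) + 1)"
    have vol: "0 < vol" "emeasure lborel (cylinder r :: ((real ^ 'n) \<times> real) set) = ennreal vol"
      unfolding vol_def using emeasure_cylinder[OF r(1), where 'n='n] cvol_pos[where 'n='n] r by auto
    show ?thesis
    proof (cases "V = 0")
      case True
      then have "v j = 0" for j using vV[of j] by simp
      moreover have "(SUP x\<in>{(N1 :: int, N2). N1 < N2}. (0 :: ennreal)) = 0"
        by (intro antisym SUP_least) auto
      ultimately show ?thesis by (simp add: split_beta)
    next
      case False
      then have V: "0 < V" using V0 by simp
      \<comment> \<open>The near part, whose L2 norm is of the order of the square root of the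
        volume of the small cylinder times \<open>M\<close>; the far part \<open>f2\<close> is
        summable over the small scales.\<close>
      define f1 where "f1 z = F z * indicator (cylinder (2 * r)) z" for z
      define f2 where "f2 z = F z - f1 z" for z
      have f1: "f1 \<in> bddL1" unfolding f1_def[abs_def] by (rule bddL1_mult[OF F, of _ 1]) auto
      have f2: "f2 \<in> bddL1" unfolding f2_def[abs_def] by (intro bddL1_diff F f1)
      have f2M: "\<bar>f2 w\<bar> \<le> M" "w \<in> cylinder (2 * r) \<Longrightarrow> f2 w = 0" for w
        using FM[of w] M by (auto simp: f2_def f1_def indicator_def)
      \<comment> \<open>The L2 theory is applied only to the small scales and needs coefficients
        bounded by one. Blocks stay blocks, since the other coefficients are set to zero instead of
        being removed.\<close>
      define v' where "v' j = (if a (j + 1) \<le> r then v j / V else 0)" for j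
      have v'1: "\<bar>v' j\<bar> \<le> 1" for j using vV[of j] V by (auto simp: v'_def)
      define Kc where "Kc = (2 * cm * G + 2 * c0 * ck * L powr \<theta> + 2 * ce * G) * V * M"
      have Kc: "0 \<le> Kc" unfolding Kc_def using cpos G ck ce V M by (intro mult_nonneg_nonneg add_nonneg_nonneg) auto
      have pt: "\<bar>\<Sum>j = N1..N2. v j * conv (q j) F z\<bar> \<le> Kc + V * \<bar>\<Sum>j = N1..N2. v' j * conv (q j) f1 z\<bar>"
        if z: "z \<in> cylinder r" for N1 N2 z
      proof -
        define S where "S = {j\<in>{N1..N2}. a (j + 1) \<le> r}"
        define B where "B = {j\<in>{N1..N2}. \<not> a (j + 1) \<le> r \<and> 1 \<le> a j}"
        define D where "D = {j\<in>{N1..N2}. \<not> a (j + 1) \<le> r \<and> a j < 1}"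
        have fin: "finite S" "finite B" "finite D" unfolding S_def B_def D_def by (rule finite_subset[of _ "{N1..N2}"], auto)+
        have un: "{N1..N2} = S \<union> (B \<union> D)" "S \<inter> (B \<union> D) = {}" "B \<inter> D = {}" unfolding S_def B_def D_def by auto
        define x where "x j = v j * conv (q j) F z" for j
        have split: "(\<Sum>j = N1..N2. x j) = (\<Sum>j\<in>S. x j) + ((\<Sum>j\<in>B. x j) + (\<Sum>j\<in>D. x j))"
          unfolding un(1) using fin un(2,3) by (simp add: sum.union_disjoint)
        have sB: "\<bar>\<Sum>j\<in>B. x j\<bar> \<le> 2 * ce * G * V * M"
        proof -
          have "\<bar>\<Sum>j\<in>B. x j\<bar> \<le> (\<Sum>j\<in>B. (2 * ce * V * M) * (1 / (a j)\<^sup>2))"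
          proof (rule order.trans[OF sum_abs sum_mono])
            fix j
            have "\<bar>x j\<bar> \<le> V * (M * (2 * ce / (a j)\<^sup>2))"
              unfolding x_def abs_mult
              using conv_q_large_scale[OF ce early F FM F0 r(2) z, of j] vV[of j] V by (intro mult_mono) auto
            then show "\<bar>x j\<bar> \<le> (2 * ce * V * M) * (1 / (a j)\<^sup>2)" by (simp add: mult_ac)
          qed
          also have "\<dots> \<le> (2 * ce * V * M) * G"
            unfolding sum_distrib_left[symmetric] G_def using ce V M fin
            by (intro mult_left_mono sum_large_scales \<alpha>2) (auto simp: B_def)
          finally show ?thesis by (simp add: mult_ac)
        qed
        have sD: "\<bar>\<Sum>j\<in>D. x j\<bar> \<le> 2 * c0 * ck * L powr \<theta> * V * M"
        proof -
          have "\<bar>\<Sum>j\<in>D. x j\<bar> \<le> (\<Sum>j\<in>D. \<bar>v j\<bar> * (2 * c0 * M))"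
            by (rule order.trans[OF sum_abs sum_mono])
              (auto simp: x_def abs_mult intro!: mult_left_mono conv_q_le F FM)
          also have "\<dots> \<le> (real (card D) powr \<theta> * V) * (2 * c0 * M)"
            unfolding sum_distrib_right[symmetric] V_def \<theta>_def using cpos M
            by (intro mult_right_mono lp_nonneg_bound(5)[OF p v fin(3)]) auto
          also have "\<dots> \<le> (ck * L powr \<theta> * V) * (2 * c0 * M)"
          proof (intro mult_right_mono)
            have "real (card D) powr \<theta> \<le> (ck * L) powr \<theta>"
              unfolding L_def using \<theta> fin r by (intro powr_mono2 card_middle_scales) (auto simp: D_def)
            also have "\<dots> = ck powr \<theta> * L powr \<theta>" using ck L by (simp add: powr_mult)
            also have "\<dots> \<le> ck powr 1 * L powr \<theta>" using ck \<theta> by (intro mult_right_mono powr_mono) auto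
            finally show "real (card D) powr \<theta> \<le> ck * L powr \<theta>" using ck by simp
          qed (use V cpos M in auto)
          finally show ?thesis by (simp add: mult_ac)
        qed
        have sS: "\<bar>\<Sum>j\<in>S. x j\<bar> \<le> V * \<bar>\<Sum>j = N1..N2. v' j * conv (q j) f1 z\<bar> + 2 * cm * G * V * M"
        proof -
          have e: "x j = V * (v' j * conv (q j) f1 z) + v j * conv (q j) f2 z" if "j \<in> S" for j
          proof -
            have "conv (q j) F z = conv (q j) f1 z + conv (q j) f2 z"
              using conv_add_right[OF f1 f2 q[of j], of z] by (simp add: f2_def)
            then show ?thesis using that V by (simp add: x_def v'_def S_def distrib_left)
          qed
          have "(\<Sum>j\<in>S. x j) = V * (\<Sum>j\<in>S. v' j * conv (q j) f1 z) + (\<Sum>j\<in>S. v j * conv (q j) f2 z)"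
            by (simp add: e sum.distrib sum_distrib_left cong: sum.cong)
          also have "(\<Sum>j\<in>S. v' j * conv (q j) f1 z) = (\<Sum>j = N1..N2. v' j * conv (q j) f1 z)"
            by (intro sum.mono_neutral_left) (auto simp: S_def v'_def)
          finally have "\<bar>\<Sum>j\<in>S. x j\<bar> \<le> \<bar>V * (\<Sum>j = N1..N2. v' j * conv (q j) f1 z)\<bar> + \<bar>\<Sum>j\<in>S. v j * conv (q j) f2 z\<bar>"
            by (simp only: abs_triangle_ineq)
          also have "\<bar>\<Sum>j\<in>S. v j * conv (q j) f2 z\<bar> \<le> (\<Sum>j\<in>S. (2 * cm * V * M) * (a (j + 1) / r) powr \<alpha>)"
          proof (rule order.trans[OF sum_abs sum_mono])
            fix j
            have "\<bar>v j * conv (q j) f2 z\<bar> \<le> V * (M * (2 * cm * (a (j + 1) / r) powr \<alpha>))"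
              unfolding abs_mult
              using conv_q_far[OF f2 f2M(1) f2M(2) r z, of j] vV[of j] V by (intro mult_mono) auto
            then show "\<bar>v j * conv (q j) f2 z\<bar> \<le> (2 * cm * V * M) * (a (j + 1) / r) powr \<alpha>" by (simp add: mult_ac)
          qed
          also have "\<dots> \<le> (2 * cm * V * M) * G"
            unfolding sum_distrib_left[symmetric] G_def using cpos V M fin
            by (intro mult_left_mono sum_small_scales) (auto simp: S_def)
          finally show ?thesis using V by (simp add: abs_mult mult_ac)
        qed
        have "\<bar>\<Sum>j = N1..N2. x j\<bar> \<le> \<bar>\<Sum>j\<in>S. x j\<bar> + (\<bar>\<Sum>j\<in>B. x j\<bar> + \<bar>\<Sum>j\<in>D. x j\<bar>)"
          unfolding split by linarith
        also have "\<dots> \<le> (V * \<bar>\<Sum>j = N1..N2. v' j * conv (q j) f1 z\<bar> + 2 * cm * G * V * M) + (2 * ce * G * V * M + 2 * c0 * ck * L powr \<theta> * V * M)"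
          by (intro add_mono sS sB sD)
        finally show ?thesis unfolding x_def Kc_def by (simp add: distrib_right)
      qed
      have "(\<integral>\<^sup>+z. (SUP (N1, N2)\<in>{(N1, N2). N1 < N2}. ennreal \<bar>\<Sum>j = N1..N2. v j * conv (q j) F z\<bar>) * indicator (cylinder r) z \<partial>lborel)
        \<le> (\<integral>\<^sup>+z. ennreal Kc * indicator (cylinder r) z + ennreal V * (Tmax v' f1 z * indicator (cylinder r) z) \<partial>lborel)"
      proof (rule nn_integral_mono)
        fix z :: "(real ^ 'n) \<times> real"
        show "(SUP (N1, N2)\<in>{(N1, N2). N1 < N2}. ennreal \<bar>\<Sum>j = N1..N2. v j * conv (q j) F z\<bar>) * indicator (cylinder r) z
          \<le> ennreal Kc * indicator (cylinder r) z + ennreal V * (Tmax v' f1 z * indicator (cylinder r) z)"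
        proof (cases "z \<in> cylinder r")
          case True
          have "(SUP (N1, N2)\<in>{(N1, N2). N1 < N2}. ennreal \<bar>\<Sum>j = N1..N2. v j * conv (q j) F z\<bar>) \<le> ennreal Kc + ennreal V * Tmax v' f1 z"
          proof (rule SUP_least, clarify)
            fix N1 N2 :: int
            have "ennreal \<bar>\<Sum>j = N1..N2. v j * conv (q j) F z\<bar> \<le> ennreal (Kc + V * \<bar>\<Sum>j = N1..N2. v' j * conv (q j) f1 z\<bar>)"
              by (intro ennreal_leI pt True)
            also have "\<dots> = ennreal Kc + ennreal V * ennreal \<bar>\<Sum>j = N1..N2. v' j * conv (q j) f1 z\<bar>"
              using Kc V by (simp add: ennreal_mult)
            also have "\<dots> \<le> ennreal Kc + ennreal V * Tmax v' f1 z" by (intro add_left_mono mult_left_mono Tmax_upper) simp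
            finally show "ennreal \<bar>\<Sum>j = N1..N2. v j * conv (q j) F z\<bar> \<le> ennreal Kc + ennreal V * Tmax v' f1 z" .
          qed
          then show ?thesis using True by simp
        qed simp
      qed
      also have "\<dots> = ennreal Kc * emeasure lborel (cylinder r :: ((real ^ 'n) \<times> real) set) + ennreal V * (\<integral>\<^sup>+z. Tmax v' f1 z * indicator (cylinder r) z \<partial>lborel)"
        using Tmax_measurable[OF f1, of v'] by (simp add: nn_integral_add nn_integral_cmult nn_integral_cmult_indicator)
      also have "\<dots> \<le> ennreal Kc * emeasure lborel (cylinder r :: ((real ^ 'n) \<times> real) set) + ennreal V * ennreal (2 * cu * d * M * vol)"
      proof (intro add_left_mono mult_left_mono)
        have cyl: "(indicator (cylinder (2 * r)) :: (real ^ 'n) \<times> real \<Rightarrow> real) \<in> bddL1"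
          using r by (intro indicator_cylinder_bddL1) simp
        have "norm2 f1 \<le> norm2 (\<lambda>z :: (real ^ 'n) \<times> real. M * indicator (cylinder (2 * r)) z)"
          by (intro norm2_mono f1 bddL1_cmult cyl) (use FM M in \<open>auto simp: f1_def indicator_def\<close>)
        also have "\<dots> = M * norm2 (indicator (cylinder (2 * r)) :: (real ^ 'n) \<times> real \<Rightarrow> real)"
          using M by (simp add: norm2_cmult)
        also have "norm2 (indicator (cylinder (2 * r)) :: (real ^ 'n) \<times> real \<Rightarrow> real) = sqrt (cvol TYPE('n) * (2 * r) ^ (CARD('n) + 1))"
          using r by (intro norm2_indicator_cylinder) simp
        also have "\<dots> = d * sqrt vol" unfolding d_def vol_def power_mult_distrib by (simp add: real_sqrt_mult[symmetric] mult_ac)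
        finally have n1: "norm2 f1 \<le> M * (d * sqrt vol)" .
        have "(\<integral>\<^sup>+z. Tmax v' f1 z * indicator (cylinder r) z \<partial>lborel) \<le> ennreal (2 * cu * norm2 f1 * sqrt vol)"
          unfolding vol_def by (rule Tmax_cylinder[OF v'1 f1 r(1)])
        also have "\<dots> \<le> ennreal (2 * cu * (M * (d * sqrt vol)) * sqrt vol)"
          using cu vol by (intro ennreal_leI mult_right_mono mult_left_mono n1) auto
        also have "2 * cu * (M * (d * sqrt vol)) * sqrt vol = 2 * cu * d * M * vol" using vol by (simp add: mult_ac)
        finally show "(\<integral>\<^sup>+z. Tmax v' f1 z * indicator (cylinder r) z \<partial>lborel) \<le> ennreal (2 * cu * d * M * vol)" .
      qed simp
      also have "ennreal Kc * emeasure lborel (cylinder r :: ((real ^ 'n) \<times> real) set) + ennreal V * ennreal (2 * cu * d * M * vol) = ennreal ((Kc + 2 * cu * d * V * M) * vol)"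
        using Kc V cu M vol unfolding d_def by (simp add: ennreal_mult[symmetric] ennreal_plus[symmetric] algebra_simps del: ennreal_plus)
      also have "\<dots> \<le> ennreal (C * L powr \<theta> * V * M * vol)"
      proof (intro ennreal_leI mult_right_mono)
        \<comment> \<open>All terms without a logarithm may be multiplied by
          \<open>L powr \<theta>\<close> \<ge> 1.\<close>
        have "2 * cm * G + 2 * c0 * ck * L powr \<theta> + 2 * ce * G + 2 * cu * d \<le> C * L powr \<theta>"
        proof -
          have d0: "0 \<le> d" unfolding d_def by simp
          have "2 * cm * G * 1 \<le> 2 * cm * G * L powr \<theta>" "2 * ce * G * 1 \<le> 2 * ce * G * L powr \<theta>" "2 * cu * d * 1 \<le> 2 * cu * d * L powr \<theta>"
            by (intro mult_left_mono L\<theta>; use cpos G ce cu d0 in simp)+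
          then show ?thesis unfolding C_def by (simp add: distrib_right)
        qed
        then have "(2 * cm * G + 2 * c0 * ck * L powr \<theta> + 2 * ce * G + 2 * cu * d) * (V * M) \<le> C * L powr \<theta> * (V * M)"
          using V M by (intro mult_right_mono) auto
        then show "Kc + 2 * cu * d * V * M \<le> C * L powr \<theta> * V * M" unfolding Kc_def by (simp add: distrib_right mult.assoc)
      qed (use vol in simp)
      also have "\<dots> = ennreal (C * L powr \<theta> * V * M) * emeasure lborel (cylinder r :: ((real ^ 'n) \<times> real) set)"
        using C V M vol by (simp add: ennreal_mult)
      finally show ?thesis unfolding L_def V_def \<theta>_def .
    qed
  qed
  show ?thesis by (rule that[OF C main])
qed

end

section \<open>Maximal transforms of lacunary sequences\<close>

lemma lacunary_power:
  assumes "lacunary \<rho> a" "1 < \<rho>"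
  shows "a i * \<rho> ^ n \<le> a (i + int n)"
proof (induction n)
  case (Suc n)
  have "a i * \<rho> ^ Suc n = (a i * \<rho> ^ n) * \<rho>" by simp
  also have "\<dots> \<le> a (i + int n) * \<rho>" using Suc assms(2) by (intro mult_right_mono) auto
  also have "\<dots> \<le> a (i + int n + 1)"
  proof -
    have "0 < a (i + int n)" "\<rho> \<le> a (i + int n + 1) / a (i + int n)" using assms(1) by (auto simp: lacunary_def)
    then show ?thesis by (simp add: field_simps)
  qed
  finally show ?case by (simp add: algebra_simps)
qed simp

text \<open>The kernels are replaced by their even majorants. The constant comes from
  \<open>maj_conv\<close> and \<open>kern_le_maj\<close> and does not depend on the finite index
  set.\<close>

lemma kern_maximal:
  assumes \<alpha>: "0 < \<alpha>" "\<alpha> < 1" and a: "\<And>j. 0 < a j"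
  obtains cx where "0 < cx" "\<And>I (g :: (real ^ 'n) \<times> real \<Rightarrow> real). finite (I :: int set) \<Longrightarrow> g \<in> bddL1 \<Longrightarrow>
      \<exists>U\<in>bddL1. norm2 U \<le> cx * norm2 g \<and> (\<forall>N\<in>I. \<forall>z. \<bar>conv (kern \<alpha> (a N)) g z\<bar> \<le> U z)"
proof -
  obtain C where C: "0 < C" "\<And>\<tau> \<sigma> z :: (real ^ 'n) \<times> real. 0 < \<tau> \<Longrightarrow> 0 < \<sigma> \<Longrightarrow>
    (\<integral>\<^sup>+w. ennreal (maj \<alpha> \<tau> (z - w)) * ennreal (maj \<alpha> \<sigma> w) \<partial>lborel) \<le> ennreal C * (ennreal (maj \<alpha> \<tau> z) + ennreal (maj \<alpha> \<sigma> z))"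
    by (rule maj_conv[OF \<alpha>, where 'n='n]) blast
  obtain D where D: "0 < D" "\<And>\<tau> w :: (real ^ 'n) \<times> real. 0 < \<tau> \<Longrightarrow> kern \<alpha> \<tau> w \<le> D * maj \<alpha> \<tau> w"
    by (rule kern_le_maj[OF \<alpha>, where 'n='n]) blast
  have main: "\<exists>U\<in>bddL1. norm2 U \<le> (D * sqrt (4 * C\<^sup>2 + 1)) * norm2 g \<and> (\<forall>N\<in>I. \<forall>z. \<bar>conv (kern \<alpha> (a N)) g z\<bar> \<le> U z)"
    if I: "finite I" and g: "g \<in> bddL1" for I :: "int set" and g :: "(real ^ 'n) \<times> real \<Rightarrow> real"
  proof -
    obtain m where m: "\<And>N. N \<in> I \<Longrightarrow> \<bar>N\<bar> \<le> int m"
    proof -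
      have "finite ((\<lambda>N. nat \<bar>N\<bar>) ` I)" using I by simp
      then obtain m where "\<forall>x\<in>(\<lambda>N. nat \<bar>N\<bar>) ` I. x \<le> m" using finite_nat_set_iff_bounded_le by blast
      then have "\<bar>N\<bar> \<le> int m" if "N \<in> I" for N using that by auto
      then show ?thesis by (rule that)
    qed
    \<comment> \<open>The integer indices from -m to m are shifted to the naturals from 0 to 2 m
      expected by \<open>maximal_kernels\<close>.\<close>
    define L where "L i = (maj \<alpha> (a (int i - int m)) :: (real ^ 'n) \<times> real \<Rightarrow> real)" for i
    have Lb: "L i \<in> bddL1" for i unfolding L_def by (rule maj_bddL1[OF \<alpha> a])
    define ga where "ga z = \<bar>g z\<bar>" for z
    have ga: "ga \<in> bddL1" unfolding ga_def by (rule bddL1_abs[OF g])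
    note [measurable] = bddL1_meas[OF Lb] bddL1_meas[OF ga]
    interpret mk: maximal_kernels "2 * m + 1" L C
    proof
      show "(\<integral>\<^sup>+z. ennreal (L i z) \<partial>lborel) < \<infinity>" for i
        using norm1_nn[OF Lb, of i] \<alpha> by (simp add: L_def)
      show "(\<integral>\<^sup>+w. ennreal (L i (z - w)) * ennreal (L j w) \<partial>lborel) \<le> ennreal C * (ennreal (L i z) + ennreal (L j z))" for i j z
        unfolding L_def by (rule C(2)[OF a a])
    qed (use C(1) \<alpha> in \<open>auto simp: L_def maj_minus\<close>)
    have Aeq: "mk.A (\<lambda>z. ennreal (ga z)) i z = ennreal (conv ga (L i) z)" for i z
    proof -
      have "mk.A (\<lambda>z. ennreal (ga z)) i z = (\<integral>\<^sup>+w. ennreal (ga w * L i (z - w)) \<partial>lborel)"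
        unfolding mk.A_def by (intro nn_integral_cong) (simp add: ga_def L_def maj_nonneg[OF \<alpha>] ennreal_mult mult.commute)
      also have "\<dots> = ennreal (conv ga (L i) z)"
        unfolding conv_def by (rule nn_integral_eq_integral[OF conv_int[OF ga Lb]]) (simp add: ga_def L_def maj_nonneg[OF \<alpha>])
      finally show ?thesis .
    qed
    have cpos: "0 \<le> conv ga (L i) z" for i z
      unfolding conv_def by (rule integral_nonneg_AE) (simp add: ga_def L_def maj_nonneg[OF \<alpha>])
    define S where "S z = enn2real (mk.M (\<lambda>z. ennreal (ga z)) z)" for z
    have SM: "ennreal (S z) = mk.M (\<lambda>z. ennreal (ga z)) z" for z
      using mk.M_attained[of "\<lambda>z. ennreal (ga z)" z] unfolding S_def Aeq by auto
    have S0: "0 \<le> S z" for z unfolding S_def by simp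
    have up: "conv ga (L i) z \<le> S z" if "i < 2 * m + 1" for i z
      using mk.A_le_M[OF that, of "\<lambda>z. ennreal (ga z)" z] S0 unfolding Aeq SM[symmetric] by simp
    have S: "S \<in> bddL1"
    proof (rule bddL1_dom)
      show "S \<in> borel_measurable borel" unfolding S_def by measurable
      show "(\<lambda>z. \<Sum>i<2 * m + 1. conv ga (L i) z) \<in> bddL1" by (intro bddL1_sum conv_bddL1 ga Lb)
      show "\<bar>S z\<bar> \<le> (\<Sum>i<2 * m + 1. conv ga (L i) z)" for z
      proof -
        obtain i where i: "i < 2 * m + 1" "mk.M (\<lambda>z. ennreal (ga z)) z = mk.A (\<lambda>z. ennreal (ga z)) i z"
          using mk.M_attained by blast
        then have "S z = conv ga (L i) z" unfolding S_def Aeq using cpos by simp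
        also have "\<dots> \<le> (\<Sum>i<2 * m + 1. conv ga (L i) z)" using i cpos by (intro member_le_sum) auto
        finally show ?thesis using S0 by simp
      qed
    qed
    have nS: "norm2 S \<le> sqrt (4 * C\<^sup>2 + 1) * norm2 g"
    proof (rule power2_le_imp_le)
      have "ennreal ((norm2 S)\<^sup>2) = (\<integral>\<^sup>+z. (mk.M (\<lambda>z. ennreal (ga z)) z)\<^sup>2 \<partial>lborel)"
        unfolding norm2_nn[OF S, symmetric] SM[symmetric]
        by (intro nn_integral_cong) (simp add: ennreal_power S0)
      also have "\<dots> \<le> ennreal (4 * C\<^sup>2 + 1) * (\<integral>\<^sup>+z. (ennreal (ga z))\<^sup>2 \<partial>lborel)"
        by (rule mk.maximal_bound) measurable
      also have "(\<integral>\<^sup>+z. (ennreal (ga z))\<^sup>2 \<partial>lborel) = ennreal ((norm2 g)\<^sup>2)"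
        by (simp add: ga_def ennreal_power norm2_nn[OF g])
      also have "ennreal (4 * C\<^sup>2 + 1) * ennreal ((norm2 g)\<^sup>2) = ennreal ((sqrt (4 * C\<^sup>2 + 1) * norm2 g)\<^sup>2)"
        by (simp add: ennreal_mult[symmetric] power_mult_distrib del: ennreal_plus)
      finally show "(norm2 S)\<^sup>2 \<le> (sqrt (4 * C\<^sup>2 + 1) * norm2 g)\<^sup>2" by simp
      show "0 \<le> sqrt (4 * C\<^sup>2 + 1) * norm2 g" by (intro mult_nonneg_nonneg norm2_nonneg) simp
    qed
    show ?thesis
    proof (intro bexI conjI ballI allI)
      show "(\<lambda>z. D * S z) \<in> bddL1" by (rule bddL1_cmult[OF S])
      show "norm2 (\<lambda>z. D * S z) \<le> D * sqrt (4 * C\<^sup>2 + 1) * norm2 g"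
        using mult_left_mono[OF nS, of D] D(1) by (simp add: norm2_cmult mult.assoc)
      fix N z assume N: "N \<in> I"
      define i where "i = nat (N + int m)"
      have i: "i < 2 * m + 1" "L i = maj \<alpha> (a N)" using m[OF N] unfolding i_def L_def by (auto simp: abs_le_iff)
      have "\<bar>conv (kern \<alpha> (a N)) g z\<bar> = \<bar>conv g (kern \<alpha> (a N)) z\<bar>"
        using conv_commute[OF kern_bddL1[OF \<alpha> a] g, of N] by simp
      also have "\<dots> \<le> (LINT w|lborel. D * (ga w * L i (z - w)))"
      proof -
        have "\<bar>conv g (kern \<alpha> (a N)) z\<bar> \<le> (LINT w|lborel. \<bar>g w * kern \<alpha> (a N) (z - w)\<bar>)"
          unfolding conv_def by (rule integral_abs_bound)
        also have "\<dots> \<le> (LINT w|lborel. D * (ga w * L i (z - w)))"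
        proof (rule integral_mono)
          show "integrable lborel (\<lambda>w. \<bar>g w * kern \<alpha> (a N) (z - w)\<bar>)"
            by (intro integrable_abs conv_int g kern_bddL1[OF \<alpha> a])
          show "integrable lborel (\<lambda>w. D * (ga w * L i (z - w)))"
            by (intro integrable_mult_right conv_int ga Lb)
          show "\<bar>g w * kern \<alpha> (a N) (z - w)\<bar> \<le> D * (ga w * L i (z - w))" for w
            using mult_left_mono[OF D(2)[OF a, of N "z - w"], of "\<bar>g w\<bar>"] kern_nonneg[OF \<alpha>, of "a N" "z - w"]
            by (simp add: abs_mult ga_def i(2) mult_ac)
        qed
        finally show ?thesis .
      qed
      also have "\<dots> = D * conv ga (L i) z" unfolding conv_def by simp
      also have "\<dots> \<le> D * S z" using up[OF i(1), of z] D(1) by (intro mult_left_mono) auto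
      finally show "\<bar>conv (kern \<alpha> (a N)) g z\<bar> \<le> D * S z" .
    qed
  qed
  have pos: "0 < D * sqrt (4 * C\<^sup>2 + 1)" using D(1) by (simp add: add_nonneg_pos)
  show ?thesis by (rule that[OF pos main])
qed

lemma kern_mass:
  assumes \<alpha>: "0 < \<alpha>" "\<alpha> < 1" and \<tau>: "0 < \<tau>"
  shows "(LINT w|lborel. kern \<alpha> \<tau> (w :: (real ^ 'n) \<times> real)) = norm1 (kern \<alpha> 1 :: (real ^ 'n) \<times> real \<Rightarrow> real)"
  using kern_mass_eq[OF \<alpha> \<tau>, where 'n='n] kern_nonneg[OF \<alpha>, where 'n='n, of \<tau>] by (simp add: norm1_def)

lemma poisson_family_kern:
  assumes \<alpha>: "0 < \<alpha>" "\<alpha> < 1" and \<rho>: "1 < \<rho>" and a: "lacunary \<rho> a"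
  obtains \<Lambda> cm cs c0 cx where
    "poisson_family \<alpha> \<Lambda> cm cs c0 cx (\<lambda>j. kern \<alpha> (a j) :: (real ^ 'n) \<times> real \<Rightarrow> real) a"
proof -
  have apos: "0 < a j" for j using a by (simp add: lacunary_def)
  obtain cm where cm: "0 < cm" "\<And>\<tau>. 0 < \<tau> \<Longrightarrow>
    (\<integral>\<^sup>+(w :: (real ^ 'n) \<times> real). ennreal (kern \<alpha> \<tau> w * pn w powr \<alpha>) \<partial>lborel) \<le> ennreal (cm * \<tau> powr \<alpha>)"
    by (rule kern_moment[OF \<alpha>, where 'n='n]) blast
  obtain cs where cs: "0 < cs" "\<And>\<tau> w :: (real ^ 'n) \<times> real. 0 < \<tau> \<Longrightarrow>
    norm1 (\<lambda>z. kern \<alpha> \<tau> (z - w) - kern \<alpha> \<tau> z) \<le> cs * (pn w / \<tau>) powr \<alpha>"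
    by (rule kern_smooth[OF \<alpha>, where 'n='n]) blast
  obtain cx where cx: "0 < cx" "\<And>I (g :: (real ^ 'n) \<times> real \<Rightarrow> real). finite (I :: int set) \<Longrightarrow> g \<in> bddL1 \<Longrightarrow>
      \<exists>U\<in>bddL1. norm2 U \<le> cx * norm2 g \<and> (\<forall>N\<in>I. \<forall>z. \<bar>conv (kern \<alpha> (a N)) g z\<bar> \<le> U z)"
    by (rule kern_maximal[OF \<alpha>, of a, where 'n='n]) (use apos in auto)
  have "poisson_family \<alpha> (\<rho> powr - \<alpha>) cm cs (norm1 (kern \<alpha> 1 :: (real ^ 'n) \<times> real \<Rightarrow> real)) cx
      (\<lambda>j. kern \<alpha> (a j) :: (real ^ 'n) \<times> real \<Rightarrow> real) a"
  proof
    show "0 < \<rho> powr - \<alpha>" using \<rho> by simp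
    show "\<rho> powr - \<alpha> < 1" using \<rho> \<alpha> by (intro powr_less_one) auto
    show "(a i / a j) powr \<alpha> \<le> (\<rho> powr - \<alpha>) ^ nat (j - i)" if ij: "i \<le> j" for i j
    proof -
      define n where "n = nat (j - i)"
      have j: "j = i + int n" unfolding n_def using ij by simp
      have "a i / a j \<le> 1 / \<rho> ^ n"
        using lacunary_power[OF a \<rho>, of i n] apos[of j] \<rho> unfolding j[symmetric] by (simp add: field_simps)
      then have "(a i / a j) powr \<alpha> \<le> (1 / \<rho> ^ n) powr \<alpha>" using apos[of i] apos[of j] \<alpha> by (intro powr_mono2) auto
      also have "\<dots> = (\<rho> powr - \<alpha>) ^ n"
        using \<rho> by (simp add: powr_divide powr_minus powr_power powr_powr powr_realpow[symmetric] mult.commute field_simps)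
      finally show ?thesis unfolding n_def .
    qed
    show "norm1 (\<lambda>z. kern \<alpha> (a j) (z - w) - kern \<alpha> (a j) z) \<le> cs * (pn w / a j) powr \<alpha>" for j and w :: "(real ^ 'n) \<times> real"
      by (rule cs(2)[OF apos])
    show "(LINT w|lborel. kern \<alpha> (a j) (w :: (real ^ 'n) \<times> real)) = norm1 (kern \<alpha> 1 :: (real ^ 'n) \<times> real \<Rightarrow> real)" for j
      by (rule kern_mass[OF \<alpha> apos])
    show "(kern \<alpha> (a j) :: (real ^ 'n) \<times> real \<Rightarrow> real) \<in> bddL1" for j by (rule kern_bddL1[OF \<alpha> apos])
    show "0 < norm1 (kern \<alpha> 1 :: (real ^ 'n) \<times> real \<Rightarrow> real)" by (rule kern_mass_pos[OF \<alpha>])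
    show "\<exists>U\<in>bddL1. norm2 U \<le> cx * norm2 g \<and> (\<forall>N\<in>I. \<forall>z. \<bar>conv (kern \<alpha> (a N)) g z\<bar> \<le> U z)"
      if "finite I" "g \<in> bddL1" for I and g :: "(real ^ 'n) \<times> real \<Rightarrow> real" by (rule cx(2)[OF that])
    show "(\<integral>\<^sup>+(w :: (real ^ 'n) \<times> real). ennreal (kern \<alpha> (a j) w * pn w powr \<alpha>) \<partial>lborel) \<le> ennreal (cm * a j powr \<alpha>)" for j
      by (rule cm(2)[OF apos])
    show "0 \<le> kern \<alpha> (a j) z" for j and z :: "(real ^ 'n) \<times> real" by (rule kern_nonneg[OF \<alpha>])
  qed (use \<alpha> cm(1) cs(1) cx(1) apos in auto)
  then show ?thesis by (rule that)
qed

lemma max_transform_conv: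
  fixes f F :: "(real ^ 'n) \<times> real \<Rightarrow> real"
  assumes \<alpha>: "0 < \<alpha>" "\<alpha> < 1" and a: "\<And>j. 0 < a j" and F: "F \<in> bddL1" and eq: "AE z in lborel. f z = F z"
  shows "max_transform \<alpha> a v f z = (SUP (N1, N2)\<in>{(N1, N2). N1 < N2}.
    ennreal \<bar>\<Sum>j = N1..N2. v j * (conv (kern \<alpha> (a (j + 1))) F z - conv (kern \<alpha> (a j)) F z)\<bar>)"
  unfolding max_transform_def diff_transform_def by (simp add: frac_poisson_eq_conv[OF \<alpha> a F eq])

lemma average_eq:
  fixes g :: "(real ^ 'n) \<times> real \<Rightarrow> ennreal"
  shows "average (cylinder r) g = (\<integral>\<^sup>+z. g z * indicator (cylinder r) z \<partial>lborel) / emeasure lborel (cylinder r :: ((real ^ 'n) \<times> real) set)"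
  unfolding average_def by (simp add: nn_integral_completion)

lemma average_max_transform_le:
  fixes a :: "int \<Rightarrow> real"
  assumes \<alpha>: "0 < \<alpha>" "\<alpha> < 1" and \<rho>: "1 < \<rho>" and a: "lacunary \<rho> a" and p: "1 \<le> p"
  shows "\<exists>C>0. \<forall>v \<in> lp p. \<forall>f :: (real ^ 'n) \<times> real \<Rightarrow> real. \<forall>r.
           f \<in> Linfty \<longrightarrow> supported_in f (cylinder 1) \<longrightarrow>
           0 < r \<longrightarrow> (cylinder r :: ((real ^ 'n) \<times> real) set) \<subseteq> cylinder 1 \<longrightarrow> 2 * r < 1 \<longrightarrow>
           average (cylinder r) (max_transform \<alpha> a v f)
             \<le> ennreal (C * ln (2 / r) powr hexp p * lp_norm p v * Linfty_norm f)"
proof -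
  note \<alpha>' = \<alpha>
  have apos: "0 < a j" for j using a by (simp add: lacunary_def)
  obtain \<Lambda> cm cs c0 cx where pf: "poisson_family \<alpha> \<Lambda> cm cs c0 cx (\<lambda>j. kern \<alpha> (a j) :: (real ^ 'n) \<times> real \<Rightarrow> real) a"
    by (rule poisson_family_kern[OF \<alpha> \<rho> a])
  interpret poisson_family \<alpha> \<Lambda> cm cs c0 cx "\<lambda>j. kern \<alpha> (a j) :: (real ^ 'n) \<times> real \<Rightarrow> real" a by (rule pf)
  obtain ce where ce: "0 < ce" "\<And>\<tau> S. 0 < \<tau> \<Longrightarrow> 0 < S \<Longrightarrow>
    (\<integral>\<^sup>+(w :: (real ^ 'n) \<times> real). ennreal (kern \<alpha> \<tau> w) * indicator {w. snd w \<le> S} w \<partial>lborel) \<le> ennreal (ce * S / \<tau>\<^sup>2)"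
    by (rule kern_early[OF \<alpha>', where 'n='n]) blast
  have ce2: "0 < ce * 2" using ce(1) by simp
  have early: "(\<integral>\<^sup>+(w :: (real ^ 'n) \<times> real). ennreal (kern \<alpha> (a j) w) * indicator {w. snd w \<le> 2} w \<partial>lborel) \<le> ennreal (ce * 2 / (a j)\<^sup>2)" for j
    by (rule ce(2)[OF apos]) simp
  have \<alpha>2: "\<alpha> \<le> 2" using \<alpha>' by simp
  show ?thesis
  proof (rule local_maximal_bound[OF \<alpha>2 ce2 early], goal_cases)
    case C: (1 C)
    show ?thesis
  proof (intro exI[of _ C] conjI C(1) ballI allI impI)
    fix v and f :: "(real ^ 'n) \<times> real \<Rightarrow> real" and r :: real
    assume v: "v \<in> lp p" and f: "f \<in> Linfty" "supported_in f (cylinder 1)" and r: "0 < r" "2 * r < 1"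
    obtain F where F: "F \<in> bddL1" "AE z in lborel. f z = F z" "\<And>z. \<bar>F z\<bar> \<le> Linfty_norm f" "\<And>z. z \<notin> cylinder 1 \<Longrightarrow> F z = 0"
      using bounded_representative[OF f] by metis
    have cq: "conv (kern \<alpha> (a (j + 1))) F z - conv (kern \<alpha> (a j)) F z = conv (q j) F z" for j z
      unfolding q_def[abs_def] by (rule conv_diff_left[symmetric]) (intro kern_bddL1[OF \<alpha>' apos] F(1))+
    define E where "E = emeasure lborel (cylinder r :: ((real ^ 'n) \<times> real) set)"
    have E: "E \<noteq> 0" "E \<noteq> top" unfolding E_def emeasure_cylinder[OF r(1)] using r cvol_pos[where 'n='n] by auto
    have "average (cylinder r) (max_transform \<alpha> a v f) \<le>
        (ennreal (C * ln (2 / r) powr hexp p * lp_norm p v * Linfty_norm f) * E) / E"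
      unfolding average_eq E_def[symmetric] max_transform_conv[OF \<alpha>' apos F(1,2)] cq
      by (intro divide_right_mono_ennreal) (unfold E_def, rule C(2)[OF p v F(1,3,4) r])
    also have "\<dots> = ennreal (C * ln (2 / r) powr hexp p * lp_norm p v * Linfty_norm f)"
      by (rule ennreal_mult_divide_eq[OF E])
    finally show "average (cylinder r) (max_transform \<alpha> a v f) \<le> ennreal (C * ln (2 / r) powr hexp p * lp_norm p v * Linfty_norm f)" .
  qed
  qed
qed

text \<open>Half of \<epsilon> is for early times, through \<open>kern_early\<close> with S =
  \<tau>^2 / A, and half for large gauge, through Chebyshev's inequality for the \<alpha>-moment.
  \<open>A\<close> is the larger of the two values needed, and at least 4 for the arithmetic in
  \<open>osc_value\<close>.\<close>

lemma kern_concentration: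
  assumes \<alpha>: "0 < \<alpha>" "\<alpha> < 1" and \<epsilon>: "0 < \<epsilon>"
  obtains A where "4 \<le> A" "\<And>\<tau>. 0 < \<tau> \<Longrightarrow>
    (\<integral>\<^sup>+(w :: (real ^ 'n) \<times> real). ennreal (kern \<alpha> \<tau> w) * indicator {w. snd w \<le> \<tau>\<^sup>2 / A \<or> sqrt A * \<tau> \<le> pn w} w \<partial>lborel) \<le> ennreal \<epsilon>"
proof -
  obtain ce where ce: "0 < ce" "\<And>\<tau> S. 0 < \<tau> \<Longrightarrow> 0 < S \<Longrightarrow>
    (\<integral>\<^sup>+(w :: (real ^ 'n) \<times> real). ennreal (kern \<alpha> \<tau> w) * indicator {w. snd w \<le> S} w \<partial>lborel) \<le> ennreal (ce * S / \<tau>\<^sup>2)"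
    by (rule kern_early[OF \<alpha>, where 'n='n]) blast
  obtain cm where cm: "0 < cm" "\<And>\<tau>. 0 < \<tau> \<Longrightarrow>
    (\<integral>\<^sup>+(w :: (real ^ 'n) \<times> real). ennreal (kern \<alpha> \<tau> w * pn w powr \<alpha>) \<partial>lborel) \<le> ennreal (cm * \<tau> powr \<alpha>)"
    by (rule kern_moment[OF \<alpha>, where 'n='n]) blast
  define A where "A = max 4 (max (2 * ce / \<epsilon>) ((2 * cm / \<epsilon>) powr (2 / \<alpha>)))"
  have A: "4 \<le> A" "2 * ce / \<epsilon> \<le> A" "(2 * cm / \<epsilon>) powr (2 / \<alpha>) \<le> A" unfolding A_def by auto
  have A0: "0 < A" using A(1) by simp
  have A2: "2 * cm / \<epsilon> \<le> sqrt A powr \<alpha>"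
  proof -
    have "((2 * cm / \<epsilon>) powr (2 / \<alpha>)) powr (\<alpha> / 2) \<le> A powr (\<alpha> / 2)" using A(3) \<alpha> by (intro powr_mono2) auto
    moreover have "((2 * cm / \<epsilon>) powr (2 / \<alpha>)) powr (\<alpha> / 2) = 2 * cm / \<epsilon>" using cm(1) \<epsilon> \<alpha> by (simp add: powr_powr)
    moreover have "A powr (\<alpha> / 2) = sqrt A powr \<alpha>" using A0 by (simp add: powr_half_sqrt[symmetric] powr_powr)
    ultimately show ?thesis by simp
  qed
  show ?thesis
  proof (rule that[OF A(1)])
    fix \<tau> :: real assume \<tau>: "0 < \<tau>"
    have km [measurable]: "(kern \<alpha> \<tau> :: (real ^ 'n) \<times> real \<Rightarrow> real) \<in> borel_measurable borel"
      by (rule bddL1_meas[OF kern_bddL1[OF \<alpha> \<tau>]])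
    have [measurable]: "{w :: (real ^ 'n) \<times> real. snd w \<le> \<tau>\<^sup>2 / A} \<in> sets borel"
      by (intro borel_closed closed_Collect_le continuous_intros)
    define c where "c = (sqrt A * \<tau>) powr - \<alpha>"
    have "(\<integral>\<^sup>+(w :: (real ^ 'n) \<times> real). ennreal (kern \<alpha> \<tau> w) * indicator {w. snd w \<le> \<tau>\<^sup>2 / A \<or> sqrt A * \<tau> \<le> pn w} w \<partial>lborel)
      \<le> (\<integral>\<^sup>+(w :: (real ^ 'n) \<times> real). ennreal (kern \<alpha> \<tau> w) * indicator {w. snd w \<le> \<tau>\<^sup>2 / A} w + ennreal c * ennreal (kern \<alpha> \<tau> w * pn w powr \<alpha>) \<partial>lborel)"
    proof (rule nn_integral_mono)
      fix w :: "(real ^ 'n) \<times> real"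
      show "ennreal (kern \<alpha> \<tau> w) * indicator {w. snd w \<le> \<tau>\<^sup>2 / A \<or> sqrt A * \<tau> \<le> pn w} w \<le>
        ennreal (kern \<alpha> \<tau> w) * indicator {w. snd w \<le> \<tau>\<^sup>2 / A} w + ennreal c * ennreal (kern \<alpha> \<tau> w * pn w powr \<alpha>)"
      proof (cases "snd w \<le> \<tau>\<^sup>2 / A \<or> pn w < sqrt A * \<tau>")
        case True
        then show ?thesis by (auto simp: indicator_def)
      next
        case False
        have pos: "0 < sqrt A * \<tau>" using A0 \<tau> by simp
        have "(sqrt A * \<tau>) powr \<alpha> \<le> pn w powr \<alpha>" using False pos \<alpha> by (intro powr_mono2) auto
        then have "1 \<le> pn w powr \<alpha> / (sqrt A * \<tau>) powr \<alpha>" using pos by (subst le_divide_eq_1_pos) auto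
        then have "1 \<le> c * pn w powr \<alpha>" unfolding c_def powr_minus_divide by simp
        then have "kern \<alpha> \<tau> w * 1 \<le> kern \<alpha> \<tau> w * (c * pn w powr \<alpha>)"
          using kern_nonneg[OF \<alpha>, of \<tau> w] by (intro mult_left_mono)
        then have "ennreal (kern \<alpha> \<tau> w) \<le> ennreal c * ennreal (kern \<alpha> \<tau> w * pn w powr \<alpha>)"
          using kern_nonneg[OF \<alpha>, of \<tau> w] by (simp add: ennreal_mult[symmetric] c_def ennreal_leI mult_ac)
        then show ?thesis using False by (auto simp: indicator_def)
      qed
    qed
    also have "\<dots> = (\<integral>\<^sup>+(w :: (real ^ 'n) \<times> real). ennreal (kern \<alpha> \<tau> w) * indicator {w. snd w \<le> \<tau>\<^sup>2 / A} w \<partial>lborel)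
        + ennreal c * (\<integral>\<^sup>+(w :: (real ^ 'n) \<times> real). ennreal (kern \<alpha> \<tau> w * pn w powr \<alpha>) \<partial>lborel)"
      by (subst nn_integral_add, measurable, subst nn_integral_cmult) measurable
    also have "\<dots> \<le> ennreal (ce * (\<tau>\<^sup>2 / A) / \<tau>\<^sup>2) + ennreal c * ennreal (cm * \<tau> powr \<alpha>)"
      using \<tau> A0 by (intro add_mono mult_left_mono ce(2) cm(2)) auto
    also have "\<dots> = ennreal (ce / A + cm / sqrt A powr \<alpha>)"
      using \<tau> A0 ce(1) cm(1) by (simp add: c_def ennreal_mult[symmetric] ennreal_plus[symmetric] powr_mult powr_minus field_simps del: ennreal_plus)
    also have "\<dots> \<le> ennreal (\<epsilon> / 2 + \<epsilon> / 2)"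
    proof (intro ennreal_leI add_mono)
      show "ce / A \<le> \<epsilon> / 2" using A(2) A0 \<epsilon> by (simp add: field_simps)
      have "0 < sqrt A powr \<alpha>" using A0 by simp
      then show "cm / sqrt A powr \<alpha> \<le> \<epsilon> / 2" using A2 \<epsilon> by (simp add: field_simps)
    qed
    finally show "(\<integral>\<^sup>+(w :: (real ^ 'n) \<times> real). ennreal (kern \<alpha> \<tau> w) * indicator {w. snd w \<le> \<tau>\<^sup>2 / A \<or> sqrt A * \<tau> \<le> pn w} w \<partial>lborel) \<le> ennreal \<epsilon>"
      by simp
  qed
qed

section \<open>Sharpness\<close>

text \<open>\<open>osc B\<close> equals \<open>(-1)\<^sup>j\<close> at times \<open>-t\<close> with \<open>B\<^sup>2\<^sup>j\<^sup>-\<^sup>1 < t \<le> B\<^sup>2\<^sup>j\<^sup>+\<^sup>1\<close>. For large \<open>B\<close> most of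
  the mass of the kernel of height \<open>B\<^sup>j\<close> lies in that range, so near the origin the extension
  has the sign of \<open>(-1)\<^sup>j\<close> there.\<close>

definition scale_sign :: "int \<Rightarrow> real" where
  "scale_sign j = (if even j then 1 else - 1)"

definition osc :: "real \<Rightarrow> (real ^ 'n) \<times> real \<Rightarrow> real" where
  "osc B z = (if norm (fst z) < 1 \<and> - 1 \<le> snd z \<and> snd z < 0
     then scale_sign \<lceil>(log B (- snd z) - 1) / 2\<rceil> else 0)"

text \<open>The difference of the extensions of heights \<open>a (j + 1)\<close> and
  \<open>a j\<close> has sign opposite to \<open>scale_sign j\<close>; the minus sign makes all
  products positive. Only j < 0 is used, where the oscillation lives.\<close>

definition osc_coeff :: "real \<Rightarrow> int \<Rightarrow> real" where
  "osc_coeff \<beta> j = (if j < 0 then - scale_sign j * \<bar>real_of_int j\<bar> powr - \<beta> else 0)"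

lemma scale_sign_simps: "\<bar>scale_sign j\<bar> = 1" "scale_sign (j + 1) = - scale_sign j" "scale_sign j * scale_sign j = 1"
  by (auto simp: scale_sign_def)

lemma osc_measurable [measurable]: "osc B \<in> borel_measurable borel"
proof -
  have [measurable]: "scale_sign \<in> count_space UNIV \<rightarrow>\<^sub>M borel" by simp
  show ?thesis unfolding osc_def borel_prod[symmetric] by measurable
qed

lemma osc_le: "\<bar>osc B z\<bar> \<le> 1"
  unfolding osc_def by (simp add: scale_sign_simps)

lemma osc_outside: "z \<notin> cylinder 1 \<Longrightarrow> osc B z = 0"
  unfolding osc_def cylinder_def by (cases z) auto

lemma osc_bddL1: "(osc B :: (real ^ 'n) \<times> real \<Rightarrow> real) \<in> bddL1"
proof (rule bddL1_dom)
  show "(indicator (cylinder 1) :: (real ^ 'n) \<times> real \<Rightarrow> real) \<in> bddL1" by (rule indicator_cylinder_bddL1) simp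
  show "\<bar>osc B z\<bar> \<le> indicator (cylinder 1) z" for z :: "(real ^ 'n) \<times> real"
    using osc_le[of B z] osc_outside[of z B] by (auto simp: indicator_def)
qed measurable

lemma osc_Linfty:
  "(osc B :: (real ^ 'n) \<times> real \<Rightarrow> real) \<in> Linfty" "supported_in (osc B :: (real ^ 'n) \<times> real \<Rightarrow> real) (cylinder 1)"
  "0 < Linfty_norm (osc B :: (real ^ 'n) \<times> real \<Rightarrow> real)"
proof -
  have m: "(osc B :: (real ^ 'n) \<times> real \<Rightarrow> real) \<in> borel_measurable lebesgue"
    by (rule measurable_completion) simp
  have "esssup lebesgue (\<lambda>z :: (real ^ 'n) \<times> real. ereal \<bar>osc B z\<bar>) \<le> 1"
    using m by (intro esssup_I) (auto intro!: AE_I2 simp: osc_le)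
  then show L: "(osc B :: (real ^ 'n) \<times> real \<Rightarrow> real) \<in> Linfty"
    unfolding Linfty_def using m by (auto intro: le_less_trans)
  show "supported_in (osc B :: (real ^ 'n) \<times> real \<Rightarrow> real) (cylinder 1)"
    unfolding supported_in_def by (auto intro!: AE_I2 simp: osc_outside)
  show "0 < Linfty_norm (osc B :: (real ^ 'n) \<times> real \<Rightarrow> real)"
  proof (rule ccontr)
    assume "\<not> ?thesis"
    then have "AE z :: (real ^ 'n) \<times> real in lborel. \<bar>osc B z\<bar> \<le> 0"
      using Linfty_AE_bound[OF L] Linfty_norm_nonneg[of "osc B :: (real ^ 'n) \<times> real \<Rightarrow> real"]
      by (auto simp: AE_completion_iff order_antisym)
    then have ae: "AE z :: (real ^ 'n) \<times> real in lborel. z \<notin> ball 0 1 \<times> {- 1<..<0}"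
    proof eventually_elim
      case (elim z)
      then have "osc B z = 0" by simp
      then show ?case by (cases z) (auto simp: osc_def scale_sign_def split: if_splits)
    qed
    have o: "open ((ball 0 1 :: (real ^ 'n) set) \<times> {- 1<..<0 :: real})" by (intro open_Times) auto
    have "(ball 0 1 :: (real ^ 'n) set) \<times> {- 1<..<0 :: real} \<in> null_sets lborel"
      using ae o by (subst AE_iff_null_sets) auto
    then have "negligible ((ball 0 1 :: (real ^ 'n) set) \<times> {- 1<..<0 :: real})"
      by (simp add: negligible_iff_null_sets null_sets_completionI)
    moreover have "(0, - 1 / 2) \<in> (ball 0 1 :: (real ^ 'n) set) \<times> {- 1<..<0 :: real}" by simp
    ultimately show False using open_not_negligible[OF o] by blast
  qed
qed

text \<open>Write \<tau> = B^j. The hypotheses put the time of \<open>w\<close> between \<tau>^2 / A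
  and A \<tau>^2, and the time of \<open>z\<close> is too small to move the difference out of the
  range from \<tau>^2 / B to B \<tau>^2, where the rounded logarithm equals j. As j < 0 and B \<ge>
  4 A, the point also stays inside the support of \<open>osc B\<close>.\<close>

lemma osc_value:
  fixes z w :: "(real ^ 'n) \<times> real"
  assumes A: "4 \<le> A" and B: "4 * A \<le> B" and j: "j < 0" and z: "z \<in> cylinder r" and r: "2 * r < 1" "r \<le> (B powr j)\<^sup>2 / (2 * A)"
    and s: "(B powr j)\<^sup>2 / A < snd w" and p: "pn w < sqrt A * B powr j"
  shows "osc B (z - w) = scale_sign j"
proof -
  obtain x t y s where e: "z = (x, t)" "w = (y, s)" by (cases z, cases w) auto
  define \<tau> where "\<tau> = B powr j"
  have B0: "16 \<le> B" using A B by simp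
  have \<tau>: "0 < \<tau>" unfolding \<tau>_def using B0 by simp
  have A0: "0 < A" using A by simp
  have \<tau>B: "\<tau> \<le> 1 / B"
  proof -
    have "\<tau> \<le> B powr (- 1)" unfolding \<tau>_def using j B0 by (intro powr_mono) auto
    then show ?thesis using B0 by (simp add: powr_minus_divide)
  qed
  have sA: "sqrt A \<le> A / 2"
  proof (rule real_le_lsqrt)
    have "A * 4 \<le> A * A" using A by (intro mult_left_mono) auto
    then show "A \<le> (A / 2)\<^sup>2" by (simp add: power2_eq_square)
  qed (use A in auto)
  have "pn w < A / 2 * (1 / B)" using p sA \<tau>B \<tau> A0 B0 unfolding \<tau>_def[symmetric]
    by (smt (verit) mult_mono divide_nonneg_nonneg)
  also have "\<dots> \<le> 1 / 2" using B A0 B0 by (simp add: field_simps)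
  finally have pw: "pn w < 1 / 2" .
  have xt: "norm x < r" "- r \<le> t" "t \<le> r" using z by (auto simp: e cylinder_def)
  have ny: "norm y \<le> pn w" by (simp add: e pn_def)
  have 1: "norm (x - y) < 1" using norm_triangle_ineq4[of x y] xt ny pw r by linarith
  have ss: "\<tau>\<^sup>2 / A < s" using s by (simp add: e \<tau>_def)
  have s0: "0 < s" using ss \<tau> A0 by (smt (verit) divide_pos_pos zero_less_power)
  have "norm y + sqrt s < sqrt A * \<tau>" using p s0 unfolding e pn_def \<tau>_def by simp
  then have "sqrt s < sqrt A * \<tau>" using norm_ge_zero[of y] by linarith
  then have "(sqrt s)\<^sup>2 < (sqrt A * \<tau>)\<^sup>2" using s0 by (intro power_strict_mono) auto
  then have sA2: "s < A * \<tau>\<^sup>2" using s0 A0 by (simp add: power_mult_distrib)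
  have r\<tau>: "r \<le> \<tau>\<^sup>2 / A / 2" using r(2) unfolding \<tau>_def[symmetric] by simp
  have lo: "\<tau>\<^sup>2 / A / 2 < s - t" using ss xt r\<tau> by linarith
  have \<tau>2: "0 < \<tau>\<^sup>2" using \<tau> by simp
  have lo': "\<tau>\<^sup>2 / B < s - t"
  proof -
    have "\<tau>\<^sup>2 / B \<le> \<tau>\<^sup>2 / (2 * A)" using B A0 \<tau>2 by (intro divide_left_mono) auto
    then show ?thesis using lo by simp
  qed
  have hi: "s - t < \<tau>\<^sup>2 * B"
  proof -
    have "\<tau>\<^sup>2 / A / 2 \<le> \<tau>\<^sup>2 * 1" using A \<tau>2 by (simp add: field_simps)
    then have "s - t < A * \<tau>\<^sup>2 + \<tau>\<^sup>2" using sA2 xt r\<tau> by linarith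
    also have "\<dots> = \<tau>\<^sup>2 * (A + 1)" by (simp add: algebra_simps)
    also have "\<dots> \<le> \<tau>\<^sup>2 * B" using A B by (intro mult_left_mono) auto
    finally show ?thesis .
  qed
  have "\<tau>\<^sup>2 * B \<le> (1 / B)\<^sup>2 * B" using \<tau>B \<tau> B0 by (intro mult_right_mono power_mono) auto
  also have "\<dots> \<le> 1" using B0 by (simp add: power2_eq_square field_simps)
  finally have hi1: "s - t < 1" using hi by linarith
  have st0: "0 < s - t" using lo' \<tau>2 B0 by (smt (verit) divide_pos_pos)
  have l\<tau>: "log B (\<tau>\<^sup>2) = 2 * j" unfolding \<tau>_def using B0 by (simp add: log_nat_power[of _ B 2] )
  have lg1: "2 * real_of_int j - 1 < log B (s - t)"
  proof -
    have "log B (\<tau>\<^sup>2 / B) < log B (s - t)" using lo' \<tau>2 B0 st0 by (subst log_less_cancel_iff) auto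
    moreover have "log B (\<tau>\<^sup>2 / B) = 2 * j - 1" using l\<tau> \<tau>2 B0 by (simp add: log_divide)
    ultimately show ?thesis by simp
  qed
  have lg2: "log B (s - t) < 2 * real_of_int j + 1"
  proof -
    have "log B (s - t) < log B (\<tau>\<^sup>2 * B)" using hi \<tau>2 B0 st0 by (subst log_less_cancel_iff) auto
    moreover have "log B (\<tau>\<^sup>2 * B) = 2 * j + 1" using l\<tau> \<tau>2 B0 by (simp add: log_mult)
    ultimately show ?thesis by simp
  qed
  have "\<lceil>(log B (s - t) - 1) / 2\<rceil> = j" using lg1 lg2 by (intro ceiling_unique) auto
  then show ?thesis unfolding osc_def e using 1 st0 hi1 by simp
qed

text \<open>Outside the exceptional set of \<open>kern_concentration\<close> the function has the
  constant value \<open>scale_sign j\<close>. On that set, of mass at most c0 / 4, the deviation is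
  at most 2, which gives c0 / 2.\<close>

lemma osc_extension:
  assumes \<alpha>: "0 < \<alpha>" "\<alpha> < 1"
  defines "c0 \<equiv> norm1 (kern \<alpha> 1 :: (real ^ 'n) \<times> real \<Rightarrow> real)"
  obtains A where "4 \<le> A" "\<And>B j r z :: (real ^ 'n) \<times> real. 4 * A \<le> B \<Longrightarrow> j < 0 \<Longrightarrow> z \<in> cylinder r \<Longrightarrow> 2 * r < 1 \<Longrightarrow>
     r \<le> (B powr real_of_int j)\<^sup>2 / (2 * A) \<Longrightarrow>
     \<bar>conv (kern \<alpha> (B powr real_of_int j)) (osc B) z - scale_sign j * c0\<bar> \<le> c0 / 2"
proof -
  have c0: "0 < c0" unfolding c0_def by (rule kern_mass_pos[OF \<alpha>])
  then have "0 < c0 / 4" by simp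
  then obtain A where A: "4 \<le> A" "\<And>\<tau>. 0 < \<tau> \<Longrightarrow>
    (\<integral>\<^sup>+(w :: (real ^ 'n) \<times> real). ennreal (kern \<alpha> \<tau> w) * indicator {w. snd w \<le> \<tau>\<^sup>2 / A \<or> sqrt A * \<tau> \<le> pn w} w \<partial>lborel) \<le> ennreal (c0 / 4)"
    by (rule kern_concentration[OF \<alpha>, where 'n='n]) blast
  show ?thesis
  proof (rule that[OF A(1)])
    fix B r :: real and j :: int and z :: "(real ^ 'n) \<times> real"
    assume B: "4 * A \<le> B" and j: "j < 0" and z: "z \<in> cylinder r" and r: "2 * r < 1" "r \<le> (B powr real_of_int j)\<^sup>2 / (2 * A)"
    define \<tau> where "\<tau> = B powr real_of_int j"
    have \<tau>: "0 < \<tau>" unfolding \<tau>_def using A(1) B by simp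
    define bad where "bad = {w :: (real ^ 'n) \<times> real. snd w \<le> \<tau>\<^sup>2 / A \<or> sqrt A * \<tau> \<le> pn w}"
    have [measurable]: "bad \<in> sets borel"
      unfolding bad_def pn_def by (intro borel_closed closed_Collect_disj closed_Collect_le continuous_intros)
    have [measurable]: "(kern \<alpha> \<tau> :: (real ^ 'n) \<times> real \<Rightarrow> real) \<in> borel_measurable borel"
      by (rule bddL1_meas[OF kern_bddL1[OF \<alpha> \<tau>]])
    define h where "h w = kern \<alpha> \<tau> w * (osc B (z - w) - scale_sign j)" for w
    have i1: "integrable lborel (\<lambda>w. kern \<alpha> \<tau> w * osc B (z - w))" by (rule conv_int[OF kern_bddL1[OF \<alpha> \<tau>] osc_bddL1])
    have i2: "integrable lborel (\<lambda>w :: (real ^ 'n) \<times> real. kern \<alpha> \<tau> w * scale_sign j)"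
      using bddL1_int[OF kern_bddL1[OF \<alpha> \<tau>, where 'n='n]] by simp
    have h: "integrable lborel h" unfolding h_def right_diff_distrib by (rule Bochner_Integration.integrable_diff[OF i1 i2])
    have eq: "conv (kern \<alpha> \<tau>) (osc B) z - scale_sign j * c0 = (LINT w|lborel. h w)"
      unfolding h_def right_diff_distrib conv_def
      by (subst Bochner_Integration.integral_diff[OF i1 i2]) (simp add: kern_mass[OF \<alpha> \<tau>] c0_def)
    have "ennreal (norm (LINT w|lborel. h w)) \<le> (\<integral>\<^sup>+w. norm (h w) \<partial>lborel)"
      by (rule integral_norm_bound_ennreal[OF h])
    also have "\<dots> \<le> (\<integral>\<^sup>+w. 2 * (ennreal (kern \<alpha> \<tau> w) * indicator bad w) \<partial>lborel)"
    proof (rule nn_integral_mono)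
      fix w :: "(real ^ 'n) \<times> real"
      show "ennreal (norm (h w)) \<le> 2 * (ennreal (kern \<alpha> \<tau> w) * indicator bad w)"
      proof (cases "w \<in> bad")
        case True
        have "\<bar>osc B (z - w) - scale_sign j\<bar> \<le> 2"
          using osc_le[of B "z - w"] scale_sign_simps(1)[of j] by linarith
        then have "norm (h w) \<le> 2 * kern \<alpha> \<tau> w"
          unfolding h_def using kern_nonneg[OF \<alpha>, of \<tau> w]
          by (simp add: abs_mult mult.commute[of 2] mult_left_mono)
        then have "ennreal (norm (h w)) \<le> ennreal (2 * kern \<alpha> \<tau> w)" by (rule ennreal_leI)
        then show ?thesis using True kern_nonneg[OF \<alpha>, of \<tau> w] by (simp add: ennreal_mult)
      next
        case False
        then have "osc B (z - w) = scale_sign j"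
          unfolding bad_def \<tau>_def by (intro osc_value[OF A(1) B j z r]) auto
        then show ?thesis by (simp add: h_def)
      qed
    qed
    also have "\<dots> = 2 * (\<integral>\<^sup>+w. ennreal (kern \<alpha> \<tau> w) * indicator bad w \<partial>lborel)" by (rule nn_integral_cmult) measurable
    also have "\<dots> \<le> 2 * ennreal (c0 / 4)" unfolding bad_def by (intro mult_left_mono A(2) \<tau>) simp
    also have "\<dots> = ennreal (2 * (c0 / 4))" using c0 by (subst ennreal_mult) auto
    finally have "norm (LINT w|lborel. h w) \<le> c0 / 2" using c0 by simp
    then show "\<bar>conv (kern \<alpha> (B powr real_of_int j)) (osc B) z - scale_sign j * c0\<bar> \<le> c0 / 2"
      using eq unfolding \<tau>_def by simp
  qed
qed

section \<open>Lower bounds for the averages\<close>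

lemma average_mono_const:
  fixes g :: "(real ^ 'n) \<times> real \<Rightarrow> ennreal"
  assumes r: "0 < r" and le: "\<And>z. z \<in> cylinder r \<Longrightarrow> ennreal c \<le> g z"
  shows "ennreal c * emeasure lborel (cylinder r :: ((real ^ 'n) \<times> real) set)
    \<le> (\<integral>\<^sup>+z. g z * indicator (cylinder r) z \<partial>lborel)"
proof -
  have "ennreal c * emeasure lborel (cylinder r :: ((real ^ 'n) \<times> real) set) =
      (\<integral>\<^sup>+(z :: (real ^ 'n) \<times> real). ennreal c * indicator (cylinder r) z \<partial>lborel)"
    by (simp add: nn_integral_cmult_indicator)
  also have "\<dots> \<le> (\<integral>\<^sup>+z. g z * indicator (cylinder r) z \<partial>lborel)"
    by (intro nn_integral_mono) (auto simp: indicator_def le)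
  finally show ?thesis .
qed

text \<open>For small \<open>r\<close> the bound holds at every point of the cylinder: about ln (2 /
  r) scales each contribute at least a multiple of n^(-\<beta>), where n is their number.\<close>

lemma osc_lower_bound:
  assumes \<alpha>: "0 < \<alpha>" "\<alpha> < 1" and \<rho>: "1 < \<rho>" and \<beta>: "0 \<le> \<beta>" "\<beta> \<le> 1"
  obtains a B C where "lacunary \<rho> a" "0 < C"
    "\<And>r. 0 < r \<Longrightarrow> 2 * r < 1 \<Longrightarrow>
      ennreal (C * ln (2 / r) powr (1 - \<beta>)) \<le> average (cylinder r) (max_transform \<alpha> a (osc_coeff \<beta>) (osc B :: (real ^ 'n) \<times> real \<Rightarrow> real))"
proof -
  define c0 where "c0 = norm1 (kern \<alpha> 1 :: (real ^ 'n) \<times> real \<Rightarrow> real)"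
  have c0: "0 < c0" unfolding c0_def by (rule kern_mass_pos[OF \<alpha>])
  obtain A where A: "4 \<le> A" "\<And>B j r z :: (real ^ 'n) \<times> real. 4 * A \<le> B \<Longrightarrow> j < 0 \<Longrightarrow> z \<in> cylinder r \<Longrightarrow> 2 * r < 1 \<Longrightarrow>
     r \<le> (B powr real_of_int j)\<^sup>2 / (2 * A) \<Longrightarrow>
     \<bar>conv (kern \<alpha> (B powr real_of_int j)) (osc B) z - scale_sign j * c0\<bar> \<le> c0 / 2"
    unfolding c0_def by (rule osc_extension[OF \<alpha>, where 'n='n]) blast
  define B where "B = \<rho> + 4 * A"
  have B: "4 * A \<le> B" "\<rho> \<le> B" "1 < B" unfolding B_def using \<rho> A(1) by auto
  have lnB: "0 < ln B" using B by simp
  define a where "a j = B powr real_of_int j" for j :: int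
  have apos: "0 < a j" for j unfolding a_def using B by simp
  have lac: "lacunary \<rho> a"
  proof -
    have "a (j + 1) / a j = B" for j unfolding a_def using B by (simp add: powr_add)
    moreover have "strict_mono a" unfolding a_def strict_mono_def using B by (simp add: powr_less_mono)
    ultimately show ?thesis unfolding lacunary_def using apos B by auto
  qed
  define T where "T = max_transform \<alpha> a (osc_coeff \<beta>) (osc B :: (real ^ 'n) \<times> real \<Rightarrow> real)"
  \<comment> \<open>For r \<le> \<open>R n\<close> the smallness condition of
    \<open>osc_extension\<close> holds for every j from -n to -1.\<close>
  define R where "R n = B powr (- 2 * real n) / (2 * A)" for n :: nat
  have R: "0 < R n" for n unfolding R_def using A(1) B by simp
  have pt: "ennreal (c0 / 2 * real n powr (1 - \<beta>)) \<le> T z"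
    if n: "3 \<le> n" and r: "2 * r < 1" "r \<le> R n" and z: "z \<in> cylinder r" for n r z
  proof -
    define D where "D j = conv (kern \<alpha> (a (j + 1))) (osc B) z - conv (kern \<alpha> (a j)) (osc B) z" for j
    have near: "\<bar>conv (kern \<alpha> (a j)) (osc B) z - scale_sign j * c0\<bar> \<le> c0 / 2" if j: "- int n \<le> j" "j < 0" for j
      unfolding a_def
    proof (rule A(2)[OF B(1) j(2) z r(1)])
      have "(B powr real_of_int j)\<^sup>2 = B powr (2 * real_of_int j)"
        using B by (simp add: powr_powr mult.commute flip: powr_numeral)
      moreover have "B powr (- 2 * real n) \<le> B powr (2 * real_of_int j)" using B j by (intro powr_mono) auto
      ultimately have "R n \<le> (B powr real_of_int j)\<^sup>2 / (2 * A)"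
        unfolding R_def using A(1) by (intro divide_right_mono) auto
      then show "r \<le> (B powr real_of_int j)\<^sup>2 / (2 * A)" using r(2) by simp
    qed
    \<comment> \<open>The range stops at -2 because the extension at j + 1 also has to be near its
      limiting value, which requires j + 1 < 0.\<close>
    have summand: "c0 * real n powr - \<beta> \<le> osc_coeff \<beta> j * D j" if j: "j \<in> {- int n..- 2}" for j
    proof -
      have n1: "\<bar>conv (kern \<alpha> (a j)) (osc B) z - scale_sign j * c0\<bar> \<le> c0 / 2" using j by (intro near) auto
      have n2: "\<bar>conv (kern \<alpha> (a (j + 1))) (osc B) z - scale_sign (j + 1) * c0\<bar> \<le> c0 / 2" using j by (intro near) auto
      \<comment> \<open>The two extensions lie within c0 / 2 of c0 and of -c0, in the order given by
        the sign, so they differ by at least c0.\<close>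
      have D0: "c0 \<le> - scale_sign j * D j"
      proof -
        define x where "x = conv (kern \<alpha> (a j)) (osc B) z"
        define y where "y = conv (kern \<alpha> (a (j + 1))) (osc B) z"
        have "\<bar>x - scale_sign j * c0\<bar> \<le> c0 / 2" "\<bar>y + scale_sign j * c0\<bar> \<le> c0 / 2"
          using n1 n2 unfolding x_def y_def scale_sign_simps(2) by simp_all
        moreover have "scale_sign j = 1 \<or> scale_sign j = - 1" by (simp add: scale_sign_def)
        ultimately have "(x - c0 \<ge> - (c0 / 2) \<and> y + c0 \<le> c0 / 2 \<and> scale_sign j = 1)
            \<or> (x + c0 \<le> c0 / 2 \<and> y - c0 \<ge> - (c0 / 2) \<and> scale_sign j = - 1)"
          by (auto simp only: abs_le_iff mult_1_left mult_minus_left diff_minus_eq_add minus_le_iff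
              minus_diff_eq diff_conv_add_uminus minus_add_distrib minus_minus)
        then have "c0 \<le> - scale_sign j * (y - x)" by auto
        then show ?thesis unfolding D_def x_def y_def .
      qed
      have "real n powr - \<beta> \<le> \<bar>real_of_int j\<bar> powr - \<beta>" using j \<beta> by (intro powr_mono2') auto
      then have "c0 * real n powr - \<beta> \<le> (- scale_sign j * D j) * \<bar>real_of_int j\<bar> powr - \<beta>"
        using D0 c0 by (intro mult_mono) auto
      then show ?thesis using j by (simp add: osc_coeff_def mult_ac)
    qed
    \<comment> \<open>The block has n - 1 terms, at least n / 2 of them.\<close>
    have "c0 / 2 * real n powr (1 - \<beta>) = real n / 2 * (c0 * real n powr - \<beta>)"
      using n by (simp add: powr_diff powr_minus field_simps)
    also have "\<dots> \<le> real (card {- int n..- 2}) * (c0 * real n powr - \<beta>)"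
      using n c0 by (intro mult_right_mono) auto
    also have "\<dots> \<le> (\<Sum>j = - int n..- 2. osc_coeff \<beta> j * D j)"
      by (rule sum_bounded_below) (rule summand)
    also have "\<dots> \<le> \<bar>\<Sum>j = - int n..- 2. osc_coeff \<beta> j * D j\<bar>" by (rule abs_ge_self)
    finally have "ennreal (c0 / 2 * real n powr (1 - \<beta>)) \<le> ennreal \<bar>\<Sum>j = - int n..- 2. osc_coeff \<beta> j * D j\<bar>"
      by (rule ennreal_leI)
    \<comment> \<open>The maximal transform admits only N1 < N2; n \<ge> 3 makes -n < -2
      strict.\<close>
    also have "\<dots> \<le> T z"
      unfolding T_def max_transform_conv[OF \<alpha> apos osc_bddL1 AE_I2[OF refl]] D_def
      by (rule SUP_upper2[of "(- int n, - 2)"]) (use n in auto)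
    finally show ?thesis .
  qed
  \<comment> \<open>Below, ln (2 / r) = ln (4 A) + 2 x ln B with 1 \<le> n and x \<le> 2 n, so
    \<kappa> n is an upper bound for it.\<close>
  define \<kappa> where "\<kappa> = ln (4 * A) + 4 * ln B"
  have \<kappa>: "0 < \<kappa>" unfolding \<kappa>_def using A(1) lnB by (intro add_pos_pos) auto
  define c1 where "c1 = c0 / 2 * (1 / \<kappa>) powr (1 - \<beta>)"
  have c1: "0 < c1" unfolding c1_def using c0 \<kappa> by simp
  have small: "ennreal (c1 * ln (2 / r) powr (1 - \<beta>)) \<le> T z"
    if r: "0 < r" "2 * r < 1" "r \<le> R 3" and z: "z \<in> cylinder r" for r z
  proof -
    \<comment> \<open>The real solution of r = B^(-2 x) / (2 A); its integer part is the largest n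
      with r \<le> \<open>R n\<close>.\<close>
    define x where "x = ln (1 / (2 * A * r)) / (2 * ln B)"
    define n where "n = nat \<lfloor>x\<rfloor>"
    have A0: "0 < A" using A(1) by simp
    have x3: "3 \<le> x"
    proof -
      have "ln r \<le> ln (R 3)" using r R[of 3] by simp
      also have "ln (R 3) = - 6 * ln B - ln (2 * A)"
        unfolding R_def using B A0 by (simp add: ln_div ln_powr)
      finally have "6 * ln B \<le> ln (1 / (2 * A * r))" using r A0 by (simp add: ln_div ln_mult)
      then show ?thesis unfolding x_def using lnB by (simp add: field_simps)
    qed
    have n: "3 \<le> n" "real n \<le> x" "x < real n + 1" unfolding n_def using x3 by linarith+
    have rn: "r \<le> R n"
    proof -
      have "2 * real n * ln B \<le> ln (1 / (2 * A * r))" using n(2) lnB unfolding x_def by (simp add: field_simps)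
      then have "ln r \<le> ln (R n)" unfolding R_def using B A0 r by (simp add: ln_div ln_mult ln_powr)
      then show ?thesis using r R[of n] by simp
    qed
    have "2 / r = 4 * A * (1 / (2 * A * r))" using A0 by simp
    also have "ln \<dots> = ln (4 * A) + ln (1 / (2 * A * r))" using r A0 by (intro ln_mult_pos) auto
    finally have "ln (2 / r) = ln (4 * A) + ln (1 / (2 * A * r))" .
    also have "ln (1 / (2 * A * r)) = 2 * ln B * x" unfolding x_def using lnB by simp
    also have "ln (4 * A) + 2 * ln B * x \<le> ln (4 * A) * real n + 2 * ln B * (2 * real n)"
    proof (rule add_mono)
      have "ln (4 * A) * 1 \<le> ln (4 * A) * real n" using A(1) n by (intro mult_left_mono) auto
      then show "ln (4 * A) \<le> ln (4 * A) * real n" by simp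
      show "2 * ln B * x \<le> 2 * ln B * (2 * real n)" using n lnB by (intro mult_left_mono) auto
    qed
    also have "\<dots> = \<kappa> * real n" unfolding \<kappa>_def by (simp add: algebra_simps)
    finally have "ln (2 / r) * (1 / \<kappa>) \<le> real n" using \<kappa> by (simp add: field_simps)
    then have "(ln (2 / r) * (1 / \<kappa>)) powr (1 - \<beta>) \<le> real n powr (1 - \<beta>)"
      using \<kappa> \<beta> ln_two_div[OF r(1,2)] by (intro powr_mono2) auto
    then have "ln (2 / r) powr (1 - \<beta>) * (1 / \<kappa>) powr (1 - \<beta>) \<le> real n powr (1 - \<beta>)"
      using \<kappa> ln_two_div[OF r(1,2)] by (subst (asm) powr_mult) auto
    then have "c0 / 2 * (ln (2 / r) powr (1 - \<beta>) * (1 / \<kappa>) powr (1 - \<beta>)) \<le> c0 / 2 * real n powr (1 - \<beta>)"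
      using c0 by (intro mult_left_mono) auto
    then have "c1 * ln (2 / r) powr (1 - \<beta>) \<le> c0 / 2 * real n powr (1 - \<beta>)"
      unfolding c1_def by (simp only: mult_ac)
    then have "ennreal (c1 * ln (2 / r) powr (1 - \<beta>)) \<le> ennreal (c0 / 2 * real n powr (1 - \<beta>))" by (rule ennreal_leI)
    also have "\<dots> \<le> T z" by (rule pt[OF n(1) r(2) rn z])
    finally show ?thesis .
  qed
  \<comment> \<open>For r above \<open>R 3\<close> the logarithm stays bounded, and the integral is
    restricted to the fixed cylinder of radius \<open>r0\<close>. The loss in volume is at most the
    factor \<open>d\<close>, which is therefore put into the constant for all
    \<open>r\<close>.\<close>
  define r0 where "r0 = min (R 3) (1 / 4)"
  have r0: "0 < r0" "2 * r0 < 1" "r0 \<le> R 3" unfolding r0_def using R[of 3] by auto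
  define d where "d = r0 ^ (CARD('n) + 1)"
  have d: "0 < d" "d \<le> 1" unfolding d_def using r0 by (simp, intro power_le_one) auto
  define E where "E r = emeasure lborel (cylinder r :: ((real ^ 'n) \<times> real) set)" for r
  have E: "E r = ennreal (cvol TYPE('n) * r ^ (CARD('n) + 1))" "E r \<noteq> 0" "E r \<noteq> top" if "0 < r" for r
    unfolding E_def using emeasure_cylinder[OF that, where 'n='n] that cvol_pos[where 'n='n] by auto
  have avg: "ennreal (c1 * d * ln (2 / r) powr (1 - \<beta>)) \<le> average (cylinder r) T" if r: "0 < r" "2 * r < 1" for r
  proof -
    have L0: "0 \<le> ln (2 / r)" using ln_two_div[OF r] by simp
    have "ennreal (c1 * d * ln (2 / r) powr (1 - \<beta>)) * E r \<le> (\<integral>\<^sup>+z. T z * indicator (cylinder r) z \<partial>lborel)"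
    proof (cases "r \<le> R 3")
      case True
      have "ennreal (c1 * d * ln (2 / r) powr (1 - \<beta>)) * E r \<le> ennreal (c1 * ln (2 / r) powr (1 - \<beta>)) * E r"
      proof (intro mult_right_mono ennreal_leI)
        show "c1 * d \<le> c1" using c1 d by simp
      qed auto
      also have "\<dots> \<le> (\<integral>\<^sup>+z. T z * indicator (cylinder r) z \<partial>lborel)"
        unfolding E_def by (rule average_mono_const[OF r(1)]) (rule small[OF r True])
      finally show ?thesis .
    next
      case False
      then have rr: "r0 \<le> r" unfolding r0_def by simp
      have sub: "cylinder r0 \<subseteq> (cylinder r :: ((real ^ 'n) \<times> real) set)" using rr by (auto simp: cylinder_def)
      have "ennreal (c1 * d * ln (2 / r) powr (1 - \<beta>)) * E r \<le> ennreal (c1 * ln (2 / r0) powr (1 - \<beta>)) * E r0"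
      proof -
        have "ln (2 / r) \<le> ln (2 / r0)" using rr r0 r by (subst ln_le_cancel_iff) (auto intro: divide_left_mono)
        then have "ln (2 / r) powr (1 - \<beta>) \<le> ln (2 / r0) powr (1 - \<beta>)" using L0 \<beta> by (intro powr_mono2) auto
        moreover have "r ^ (CARD('n) + 1) \<le> 1" using r by (intro power_le_one) auto
        ultimately have "c1 * ln (2 / r) powr (1 - \<beta>) * (cvol TYPE('n) * d * r ^ (CARD('n) + 1))
            \<le> c1 * ln (2 / r0) powr (1 - \<beta>) * (cvol TYPE('n) * d * 1)"
          using c1 d r cvol_pos[where 'n='n] by (intro mult_mono mult_left_mono) auto
        then have *: "c1 * d * ln (2 / r) powr (1 - \<beta>) * (cvol TYPE('n) * r ^ (CARD('n) + 1))
            \<le> c1 * ln (2 / r0) powr (1 - \<beta>) * (cvol TYPE('n) * d)"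
          by (simp only: mult_ac mult_1_left)
        show ?thesis
          unfolding E(1)[OF r(1)] E(1)[OF r0(1)] d_def[symmetric]
          using *[THEN ennreal_leI] c1 d r cvol_pos[where 'n='n] by (simp only: ennreal_mult mult_nonneg_nonneg
              less_imp_le powr_ge_zero zero_le_power)
      qed
      also have "\<dots> \<le> (\<integral>\<^sup>+z. T z * indicator (cylinder r0) z \<partial>lborel)"
        unfolding E_def by (rule average_mono_const[OF r0(1)]) (rule small[OF r0])
      also have "\<dots> \<le> (\<integral>\<^sup>+z. T z * indicator (cylinder r) z \<partial>lborel)"
        using sub by (intro nn_integral_mono mult_left_mono) (auto simp: indicator_def)
      finally show ?thesis .
    qed
    then have "ennreal (c1 * d * ln (2 / r) powr (1 - \<beta>)) * E r / E r \<le> average (cylinder r) T"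
      unfolding average_eq E_def[symmetric] by (rule divide_right_mono_ennreal)
    then show ?thesis using ennreal_mult_divide_eq[OF E(2,3)[OF r(1)]] by simp
  qed
  show ?thesis
    by (rule that[OF lac _ avg[unfolded T_def]]) (use c1 d in auto)
qed

lemma osc_coeff_lp:
  assumes "1 \<le> p" "1 < \<beta> * p"
  shows "osc_coeff \<beta> \<in> lp (ereal p)"
proof -
  define g where "g n = - 1 - int n" for n
  have val: "\<bar>osc_coeff \<beta> (g n)\<bar> powr p = real (Suc n) powr - (\<beta> * p)" for n
  proof -
    have "\<bar>real_of_int (g n)\<bar> = real (Suc n)" by (simp add: g_def)
    moreover have "g n < 0" by (simp add: g_def)
    ultimately show ?thesis by (simp add: osc_coeff_def abs_mult scale_sign_simps powr_powr)
  qed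
  have "summable (\<lambda>n. real n powr - (\<beta> * p))" using assms by (simp add: summable_real_powr_iff)
  then have "summable (\<lambda>n. real (Suc n) powr - (\<beta> * p))" by (subst summable_Suc_iff)
  then have "(\<lambda>n. real (Suc n) powr - (\<beta> * p)) summable_on UNIV"
    by (intro norm_summable_imp_summable_on) simp
  then have "((\<lambda>j. \<bar>osc_coeff \<beta> j\<bar> powr p) \<circ> g) summable_on UNIV" by (simp add: o_def val)
  moreover have "inj g" by (auto simp: inj_def g_def)
  ultimately have "(\<lambda>j. \<bar>osc_coeff \<beta> j\<bar> powr p) summable_on range g" by (subst summable_on_reindex) auto
  moreover have "j \<in> range g" if "j < 0" for j
    using that by (intro image_eqI[of _ _ "nat (- 1 - j)"]) (auto simp: g_def)
  ultimately have "(\<lambda>j. \<bar>osc_coeff \<beta> j\<bar> powr p) summable_on UNIV"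
    by (subst summable_on_cong_neutral[where T="range g"]) (auto simp: osc_coeff_def)
  then show ?thesis unfolding lp_def by simp
qed

lemma osc_coeff_minus_one: "\<bar>osc_coeff \<beta> (- 1)\<bar> = 1"
  by (simp add: osc_coeff_def scale_sign_def)

text \<open>The norms of the extremal \<open>v\<close> and \<open>f\<close> are fixed positive
  numbers and go into the constant; \<open>h\<close> leaves room for a smaller power of the
  logarithm than the one proved.\<close>

lemma lower_bound_normalized:
  fixes g :: "(real ^ 'n) \<times> real \<Rightarrow> ennreal"
  assumes C: "0 < C" and lb: "\<And>r. 0 < r \<Longrightarrow> 2 * r < 1 \<Longrightarrow> ennreal (C * ln (2 / r) powr \<theta>) \<le> average (cylinder r) g"
    and V: "0 < V" and M: "0 < M" and h: "\<And>r. 0 < r \<Longrightarrow> 2 * r < 1 \<Longrightarrow> h r \<le> ln (2 / r) powr \<theta>"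
  shows "\<exists>C>0. \<forall>r. 0 < r \<longrightarrow> (cylinder r :: ((real ^ 'n) \<times> real) set) \<subseteq> cylinder 1 \<longrightarrow> 2 * r < 1 \<longrightarrow>
    average (cylinder r) g \<ge> ennreal (C * h r * V * M)"
proof (intro exI[of _ "C / (V * M)"] conjI allI impI)
  show "0 < C / (V * M)" using C V M by simp
  fix r :: real assume r: "0 < r" "2 * r < 1"
  have "C / (V * M) * h r * V * M = C * h r" using V M by simp
  also have "\<dots> \<le> C * ln (2 / r) powr \<theta>" using C h[OF r] by (intro mult_left_mono) auto
  finally show "ennreal (C / (V * M) * h r * V * M) \<le> average (cylinder r) g"
    using lb[OF r] ennreal_leI order_trans by blast
qed

lemma average_max_transform_ge_lp:
  assumes \<alpha>: "0 < \<alpha>" "\<alpha> < 1" and \<rho>: "1 < \<rho>" and p: "1 < p" and \<epsilon>: "0 < \<epsilon>" "\<epsilon> < p"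
  shows "\<exists>a v. \<exists>f :: (real ^ 'n) \<times> real \<Rightarrow> real.
           lacunary \<rho> a \<and> v \<in> lp (ereal p) \<and> f \<in> Linfty \<and> supported_in f (cylinder 1) \<and>
           lp_norm (ereal p) v \<noteq> 0 \<and> Linfty_norm f \<noteq> 0 \<and>
           (\<exists>C>0. \<forall>r. 0 < r \<longrightarrow> (cylinder r :: ((real ^ 'n) \<times> real) set) \<subseteq> cylinder 1 \<longrightarrow> 2 * r < 1 \<longrightarrow>
              average (cylinder r) (max_transform \<alpha> a v f)
                \<ge> ennreal (C * ln (2 / r) powr hexp (ereal (p - \<epsilon>)) * lp_norm (ereal p) v * Linfty_norm f))"
proof -
  \<comment> \<open>1 / (p - \<epsilon>) > 1 / p gives membership in l^p. The cap at 1 concerns p -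
    \<epsilon> < 1, where the required power of the logarithm is negative and the power 0 already
    suffices.\<close>
  define \<beta> where "\<beta> = min 1 (1 / (p - \<epsilon>))"
  have pe: "0 < p - \<epsilon>" using \<epsilon> by simp
  have \<beta>: "0 \<le> \<beta>" "\<beta> \<le> 1" unfolding \<beta>_def using pe by auto
  have "1 < 1 / (p - \<epsilon>) * p" using pe \<epsilon> by (simp add: field_simps)
  then have \<beta>p: "1 < \<beta> * p" unfolding \<beta>_def using p by (auto simp: min_def)
  have "hexp (ereal (p - \<epsilon>)) \<le> 1 - \<beta>" using pe by (subst hexp_simps) (auto simp: \<beta>_def)
  then have h: "ln (2 / r) powr hexp (ereal (p - \<epsilon>)) \<le> ln (2 / r) powr (1 - \<beta>)" if "0 < r" "2 * r < 1" for r
    using ln_two_div[OF that] by (intro powr_mono) auto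
  obtain a B C where ab: "lacunary \<rho> a" "0 < C"
    "\<And>r. 0 < r \<Longrightarrow> 2 * r < 1 \<Longrightarrow>
      ennreal (C * ln (2 / r) powr (1 - \<beta>)) \<le> average (cylinder r) (max_transform \<alpha> a (osc_coeff \<beta>) (osc B :: (real ^ 'n) \<times> real \<Rightarrow> real))"
    by (rule osc_lower_bound[OF \<alpha> \<rho> \<beta>, where 'n='n]) blast
  have v: "osc_coeff \<beta> \<in> lp (ereal p)" using p \<beta>p by (intro osc_coeff_lp) auto
  have "1 \<le> ereal p" using p by simp
  then have V: "0 < lp_norm (ereal p) (osc_coeff \<beta>)"
    using lp_nonneg_bound(4)[OF _ v, of "- 1"] osc_coeff_minus_one[of \<beta>] by simp
  show ?thesis
    by (intro exI[of _ a] exI[of _ "osc_coeff \<beta>"] exI[of _ "osc B"] conjI ab(1) v osc_Linfty(1,2)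
        lower_bound_normalized[OF ab(2,3) V osc_Linfty(3) h])
      (use V osc_Linfty(3)[of B, where 'n='n] in auto)
qed

lemma average_max_transform_ge_bounded:
  assumes \<alpha>: "0 < \<alpha>" "\<alpha> < 1" and \<rho>: "1 < \<rho>"
  shows "\<exists>a v. \<exists>f :: (real ^ 'n) \<times> real \<Rightarrow> real.
        lacunary \<rho> a \<and> v \<in> lp \<infinity> \<and> f \<in> Linfty \<and> supported_in f (cylinder 1) \<and>
        lp_norm \<infinity> v \<noteq> 0 \<and> Linfty_norm f \<noteq> 0 \<and>
        (\<exists>C>0. \<forall>r. 0 < r \<longrightarrow> (cylinder r :: ((real ^ 'n) \<times> real) set) \<subseteq> cylinder 1 \<longrightarrow> 2 * r < 1 \<longrightarrow>
           average (cylinder r) (max_transform \<alpha> a v f)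
             \<ge> ennreal (C * ln (2 / r) * lp_norm \<infinity> v * Linfty_norm f))"
proof -
  obtain a B C where ab: "lacunary \<rho> a" "0 < C"
    "\<And>r. 0 < r \<Longrightarrow> 2 * r < 1 \<Longrightarrow>
      ennreal (C * ln (2 / r) powr (1 - 0)) \<le> average (cylinder r) (max_transform \<alpha> a (osc_coeff 0) (osc B :: (real ^ 'n) \<times> real \<Rightarrow> real))"
    by (rule osc_lower_bound[OF \<alpha> \<rho>, of 0, where 'n='n]) auto
  have v: "osc_coeff 0 \<in> lp \<infinity>"
    unfolding lp_def bounded_iff by (auto intro!: exI[of _ 1] simp: osc_coeff_def scale_sign_simps)
  have V: "0 < lp_norm \<infinity> (osc_coeff 0)"
    using lp_nonneg_bound(4)[OF _ v, of "- 1"] osc_coeff_minus_one[of 0] by simp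
  have h: "ln (2 / r) \<le> ln (2 / r) powr (1 - 0)" if "0 < r" "2 * r < 1" for r :: real
    using ln_two_div[OF that] by simp
  show ?thesis
    by (intro exI[of _ a] exI[of _ "osc_coeff 0"] exI[of _ "osc B"] conjI ab(1) v osc_Linfty(1,2)
        lower_bound_normalized[OF ab(2,3) V osc_Linfty(3) h])
      (use V osc_Linfty(3)[of B, where 'n='n] in auto)
qed

theorem theorem1p5:
  fixes \<alpha> \<rho> :: real
  assumes "0 < \<alpha>" "\<alpha> < 1" "1 < \<rho>"
  shows
    "(\<forall>a p. lacunary \<rho> a \<longrightarrow> 1 \<le> p \<longrightarrow>
        (\<exists>C>0. \<forall>v \<in> lp p. \<forall>f :: (real ^ 'n) \<times> real \<Rightarrow> real. \<forall>r.
           f \<in> Linfty \<longrightarrow> supported_in f (cylinder 1) \<longrightarrow>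
           0 < r \<longrightarrow> (cylinder r :: ((real ^ 'n) \<times> real) set) \<subseteq> cylinder 1 \<longrightarrow> 2 * r < 1 \<longrightarrow>
           average (cylinder r) (max_transform \<alpha> a v f)
             \<le> ennreal (C * ln (2 / r) powr real_of_ereal (1 / conj_exp p)
                          * lp_norm p v * Linfty_norm f)))
   \<and> (\<forall>p \<epsilon> :: real. 1 < p \<longrightarrow> 0 < \<epsilon> \<longrightarrow> \<epsilon> < p \<longrightarrow>
        (\<exists>a v. \<exists>f :: (real ^ 'n) \<times> real \<Rightarrow> real.
           lacunary \<rho> a \<and> v \<in> lp (ereal p) \<and> f \<in> Linfty \<and> supported_in f (cylinder 1) \<and>
           lp_norm (ereal p) v \<noteq> 0 \<and> Linfty_norm f \<noteq> 0 \<and>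
           (\<exists>C>0. \<forall>r. 0 < r \<longrightarrow> (cylinder r :: ((real ^ 'n) \<times> real) set) \<subseteq> cylinder 1 \<longrightarrow> 2 * r < 1 \<longrightarrow>
              average (cylinder r) (max_transform \<alpha> a v f)
                \<ge> ennreal (C * ln (2 / r) powr real_of_ereal (1 / conj_exp (ereal (p - \<epsilon>)))
                             * lp_norm (ereal p) v * Linfty_norm f))))
   \<and> (\<exists>a v. \<exists>f :: (real ^ 'n) \<times> real \<Rightarrow> real.
        lacunary \<rho> a \<and> v \<in> lp \<infinity> \<and> f \<in> Linfty \<and> supported_in f (cylinder 1) \<and>
        lp_norm \<infinity> v \<noteq> 0 \<and> Linfty_norm f \<noteq> 0 \<and>
        (\<exists>C>0. \<forall>r. 0 < r \<longrightarrow> (cylinder r :: ((real ^ 'n) \<times> real) set) \<subseteq> cylinder 1 \<longrightarrow> 2 * r < 1 \<longrightarrow>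
           average (cylinder r) (max_transform \<alpha> a v f)
             \<ge> ennreal (C * ln (2 / r) * lp_norm \<infinity> v * Linfty_norm f)))"
  using average_max_transform_le[OF assms, where 'n='n] average_max_transform_ge_lp[OF assms, where 'n='n]
    average_max_transform_ge_bounded[OF assms, where 'n='n]
  unfolding hexp_def by (intro conjI allI impI)

end
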